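(* Let $0<q<\infty$ and $1\le p_1,p_2\le\infty$. There exist constants $0<k\le K<\infty$ depending only on $p_1,p_2,q$ such that for every interval $I\subset\mathbb R$ with nonempty interior (bounded or unbounded, with arbitrary endpoint type) and all measurable weights $u,v_1,v_2:I\to[0,\infty]$, $$k\,\mathfrak A_I^{\mathrm{dir}}\le C_I\le K\,\mathfrak A_I^{\mathrm{dir}}$$ (as an equivalence in $[0,\infty]$), where $C_I$ is the optimal constant of the bilinear Hardy inequality on $I$ and $$\mathfrak A_I^{\mathrm{dir}}=\sup_{J\Subset I}\ \sup_{m\ge1}\ \mathfrak A_J^{(m)}$$ is the directed global characteristic. If $p_1=p_2=\infty$, then $C_I=\mathfrak A_I^{\mathrm{dir}}$ exactly.
   Context: **Extended product and weighted functionals.** For $a,b\in[0,\infty]$ put $a\odot b=0$ if $a=0$ or $b=0$, $a\odot b=ab$ if $0<a,b<\infty$, and $a\odot b=\infty$ otherwise. For measurable $E\subset\mathbb R$, a measurable weight $w:E\to[0,\infty]$ and measurable $h\ge0$: $\|h\|_{L^s(w;E)}=\left(\int_E h(t)^s\odot w(t)\,dt\right)^{1/s}$ for $0<s<\infty$ and $\|h\|_{L^\infty(w;E)}=\operatorname{ess\,sup}_{t\in E}(h(t)\odot w(t))$. All functions are nonnegative and measurable. **Global constant.** $H_Ih(x)=\int_{I\cap(-\infty,x]}h(t)\,dt$ for $x\in I$, $\mathcal B_I(f,g)(x)=H_If(x)\odot H_Ig(x)$. $C_I$ is the infimum of all finite $C\ge0$ such that $\|\mathcal B_I(f,g)\|_{L^q(u;I)}\le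 C\|f\|_{L^{p_1}(v_1;I)}\|g\|_{L^{p_2}(v_2;I)}$ for all $f,g\ge0$ with both input functionals finite; $\inf\varnothing=+\infty$. $J\Subset I$ means $J=[c,d]$ is a nondegenerate compact interval contained in $I$. **Profiles.** Let $v:J\to[\delta,\infty]$ be measurable for some $\delta>0$, with $1/v=0$ and $v^{1-p'}=0$ on $\{v=\infty\}$; $p'=p/(p-1)$. For $1<p<\infty$: $\Phi_{p,v;J}(x)=\left(\int_c^x v^{1-p'}dt\right)^{1/p'}$. For $p=\infty$: $\Phi_{\infty,v;J}(x)=\int_c^x\frac{dt}{v(t)}$. For $p=1$: with $F_{v,J}(x)=\operatorname{ess\,sup}_{c<t<x}1/v(t)$ for $c<x\le d$, put $\Phi_{1,v;J}(x)=\lim_{y\downarrow x}F_{v,J}(y)$ for $c\le x<d$ and $\Phi_{1,v;J}(d)=F_{v,J}(d)$. **Stieltjes convention.** For $G:[c,d]\to[0,\infty)$ nondecreasing and right-continuous, $dG$ is the Borel measure on $[c,d]$ with $dG([c,x])=G(x)$ for all $x\in[c,d]$ (i.e. $G$ is extended by zero to the left of $c$); in particular $dG(\{c\})=G(c)$. **Regularised local characteristics.** Fix $J=[c,d]\Subset I$ and $m\ge1$. Put $u_m=u\wedge m$, $v_{i,m}=v_i+\frac1m$ (with $\infty+\frac1m=\infty$), all restricted to $J$. All of the following quantities are formed from $u_m,v_{1,m},v_{2,m}$ (and so depend on $m$): $\Phi_i=\Phi_{p_i,v_{i,m};J}$, $U(x)=\int_x^d u_m(t)\,dt$, and, when $q<p_i<\infty$,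 $\frac1{r_i}=\frac1q-\frac1{p_i}$ and $\mu_i=d(\Phi_i^{r_i})$. When $\frac1q>\frac1{p_1}+\frac1{p_2}$, put $\frac1\kappa=\frac1q-\frac1{p_1}-\frac1{p_2}$. Define - $\mathfrak B_1=\sup_{x\in J}U(x)^{1/q}\Phi_1(x)\Phi_2(x)$; - $\widehat{\mathfrak B}_2=\sup_{x\in J}\Phi_1(x)\left[\int_J U(\max\{x,t\})^{r_2/q}d\mu_2(t)\right]^{1/r_2}$; - $\widehat{\mathfrak B}_3=\sup_{x\in J}\Phi_2(x)\left[\int_J U(\max\{x,t\})^{r_1/q}d\mu_1(t)\right]^{1/r_1}$; - $\mathfrak B_4=\sup_{x\in J}\Phi_1(x)\left[\int_{[x,d]}U(t)^{r_2/q}d\mu_2(t)\right]^{1/r_2}$; - $\mathfrak B_5=\sup_{x\in J}\Phi_2(x)\left[\int_{(x,d]}U(t)^{r_1/q}d\mu_1(t)\right]^{1/r_1}$; - $\mathfrak B_6=\left[\int_J\left(\int_{[x,d]}U(t)^{r_2/q}d\mu_2(t)\right)^{\kappa/r_2}d(\Phi_1^\kappa)(x)\right]^{1/\kappa}$; - $\mathfrak B_7=\left[\int_J\left(\int_{(x,d]}U(t)^{r_1/q}d\mu_1(t)\right)^{\kappa/r_1}d(\Phi_2^\kappa)(x)\right]^{1/\kappa}$; - with $W_1(x)=\int_x^d\Phi_1(t)^qu_m(t)\,dt$: $\mathfrak B_{\infty,2}=\sup_{x\in J}\Phi_2(x)W_1(x)^{1/q}$ if $p_2\le q$, and $\mathfrak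 B_{\infty,2}=\left[\int_JW_1^{r_2/q}\,d(\Phi_2^{r_2})\right]^{1/r_2}$ if $q<p_2<\infty$; - with $W_2(x)=\int_x^d\Phi_2(t)^qu_m(t)\,dt$: $\mathfrak B_{1,\infty}=\sup_{x\in J}\Phi_1(x)W_2(x)^{1/q}$ if $p_1\le q$, and $\mathfrak B_{1,\infty}=\left[\int_JW_2^{r_1/q}\,d(\Phi_1^{r_1})\right]^{1/r_1}$ if $q<p_1<\infty$; - $\mathfrak B_{\infty,\infty}=\left[\int_J(\Phi_1\Phi_2)^qu_m\,dx\right]^{1/q}$. The complete regularised characteristic $\mathfrak A_J^{(m)}$ is: $\mathfrak B_1$ if $p_1,p_2\le q$; $\widehat{\mathfrak B}_2$ if $p_1\le q<p_2<\infty$; $\widehat{\mathfrak B}_3$ if $p_2\le q<p_1<\infty$; $\mathfrak B_4+\mathfrak B_5$ if $p_1,p_2<\infty$, $q<\min\{p_1,p_2\}$ and $\frac1q\le\frac1{p_1}+\frac1{p_2}$; $\mathfrak B_6+\mathfrak B_7$ if $p_1,p_2<\infty$, $q<\min\{p_1,p_2\}$ and $\frac1q>\frac1{p_1}+\frac1{p_2}$; $\mathfrak B_{\infty,2}$ if $p_1=\infty$, $p_2<\infty$; $\mathfrak B_{1,\infty}$ if $p_1<\infty$, $p_2=\infty$; $\mathfrak B_{\infty,\infty}$ if $p_1=p_2=\infty$. *)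

theory Defs
  imports "HOL-Analysis.Analysis" "HOL-Probability.Essential_Supremum"
begin

(* The extended product of the weighted theory (0 times infinity is 0) is the multiplication of
   ennreal, so it is written as * throughout.  Exponents p in [1, infinity] are of type ennreal.
   Functions and weights on a set E are functions on the whole line of which only the values
   on E matter; "measurable on E" is membership in borel_measurable (lebesgue_on E). *)

section \<open>Powers, weighted functionals and the global constant\<close>

(* Real powers on [0, infinity].  Negative exponents are needed for v^(1-p'), where the value at
   infinity is 0.  The exponent 0 never occurs below. *)
definition epowr :: "ennreal \<Rightarrow> real \<Rightarrow> ennreal"  (infixr \<open>epowr\<close> 80) where
  "x epowr s =
     (if x = top then (if s < 0 then 0 else if s = 0 then 1 else top)
      else if x = 0 \<and> s < 0 then top
      else ennreal (enn2real x powr s))"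

definition wfunctional :: "ennreal \<Rightarrow> (real \<Rightarrow> ennreal) \<Rightarrow> real set \<Rightarrow> (real \<Rightarrow> ennreal) \<Rightarrow> ennreal" where
  "wfunctional s w E h =
     (if s = top then esssup (lebesgue_on E) (\<lambda>t. h t * w t)
      else (\<integral>\<^sup>+t\<in>E. (h t epowr enn2real s * w t) \<partial>lebesgue) epowr (1 / enn2real s))"

definition hardy :: "real set \<Rightarrow> (real \<Rightarrow> ennreal) \<Rightarrow> real \<Rightarrow> ennreal" where
  "hardy I h x = (\<integral>\<^sup>+t\<in>I \<inter> {..x}. h t \<partial>lebesgue)"

definition bihardy ::
    "real set \<Rightarrow> (real \<Rightarrow> ennreal) \<Rightarrow> (real \<Rightarrow> ennreal) \<Rightarrow> real \<Rightarrow> ennreal" where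
  "bihardy I f g x = hardy I f x * hardy I g x"

definition hardy_const ::
    "real \<Rightarrow> ennreal \<Rightarrow> ennreal \<Rightarrow> real set \<Rightarrow> (real \<Rightarrow> ennreal) \<Rightarrow> (real \<Rightarrow> ennreal) \<Rightarrow> (real \<Rightarrow> ennreal)
      \<Rightarrow> ennreal" where
  "hardy_const q p1 p2 I u v1 v2 =
     Inf {C. C < top \<and>
        (\<forall>f g. f \<in> borel_measurable (lebesgue_on I) \<longrightarrow> g \<in> borel_measurable (lebesgue_on I) \<longrightarrow>
           wfunctional p1 v1 I f < top \<longrightarrow> wfunctional p2 v2 I g < top \<longrightarrow>
           wfunctional (ennreal q) u I (bihardy I f g)
             \<le> C * wfunctional p1 v1 I f * wfunctional p2 v2 I g)}"


section \<open>Profiles and Stieltjes measures\<close>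

definition inv_esssup :: "(real \<Rightarrow> ennreal) \<Rightarrow> real \<Rightarrow> real \<Rightarrow> ennreal" where
  "inv_esssup v c x = esssup (lebesgue_on {c<..<x}) (\<lambda>t. 1 / v t)"

(* In ennreal, 1 / top = 0. *)
definition profile :: "ennreal \<Rightarrow> (real \<Rightarrow> ennreal) \<Rightarrow> real \<Rightarrow> real \<Rightarrow> real \<Rightarrow> ennreal" where
  "profile p v c d x =
     (if p = top then (\<integral>\<^sup>+t\<in>{c..x}. (1 / v t) \<partial>lebesgue)
      else if p = 1 then
        (if x < d then Lim (at_right x) (inv_esssup v c) else inv_esssup v c d)
      else let p' = enn2real p / (enn2real p - 1) in
        (\<integral>\<^sup>+t\<in>{c..x}. (v t epowr (1 - p')) \<partial>lebesgue) epowr (1 / p'))"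

(* The measure dG on [c,d] with dG([c,x]) = G(x), realised as a Borel measure on the line that
   vanishes outside [c,d].  It is only meaningful if G is finite, nondecreasing and
   right-continuous on [c,d], as interval_measure requires. *)
definition stieltjes :: "real \<Rightarrow> real \<Rightarrow> (real \<Rightarrow> ennreal) \<Rightarrow> real measure" where
  "stieltjes c d G = interval_measure (\<lambda>x. if x < c then 0 else enn2real (G (min x d)))"


section \<open>Local characteristics\<close>

(* In this section U, P, P1, P2 stand for the tail U and the profiles \<Phi>, and W for the
   function W_1 or W_2. *)

definition char1 ::
    "real \<Rightarrow> real \<Rightarrow> real \<Rightarrow> (real \<Rightarrow> ennreal) \<Rightarrow> (real \<Rightarrow> ennreal) \<Rightarrow> (real \<Rightarrow> ennreal) \<Rightarrow> ennreal" where
  "char1 q c d U P1 P2 = (SUP x\<in>{c..d}. U x epowr (1 / q) * P1 x * P2 x)"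

(* With (P, P') = (\<Phi>_1, \<Phi>_2) and r = r_2 this is the hatted B_2, with (\<Phi>_2, \<Phi>_1) and r = r_1 the
   hatted B_3. *)
definition char_hat ::
    "real \<Rightarrow> real \<Rightarrow> real \<Rightarrow> real \<Rightarrow> (real \<Rightarrow> ennreal) \<Rightarrow> (real \<Rightarrow> ennreal) \<Rightarrow> (real \<Rightarrow> ennreal) \<Rightarrow> ennreal" where
  "char_hat q r c d U P P' =
     (SUP x\<in>{c..d}. P x *
        (\<integral>\<^sup>+t\<in>{c..d}. (U (max x t) epowr (r / q)) \<partial>stieltjes c d (\<lambda>y. P' y epowr r)) epowr (1 / r))"

(* The integral of U^(r/q) against d(P^r) over a set S, which is [x,d] or (x,d] below. *)
definition tail_int ::
    "real \<Rightarrow> real \<Rightarrow> real \<Rightarrow> real \<Rightarrow> (real \<Rightarrow> ennreal) \<Rightarrow> (real \<Rightarrow> ennreal) \<Rightarrow> real set \<Rightarrow> ennreal" where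
  "tail_int q r c d U P S =
     (\<integral>\<^sup>+t\<in>S. (U t epowr (r / q)) \<partial>stieltjes c d (\<lambda>y. P y epowr r))"

definition char4 ::
    "real \<Rightarrow> real \<Rightarrow> real \<Rightarrow> real \<Rightarrow> (real \<Rightarrow> ennreal) \<Rightarrow> (real \<Rightarrow> ennreal) \<Rightarrow> (real \<Rightarrow> ennreal) \<Rightarrow> ennreal" where
  "char4 q r2 c d U P1 P2 =
     (SUP x\<in>{c..d}. P1 x * tail_int q r2 c d U P2 {x..d} epowr (1 / r2))"

definition char5 ::
    "real \<Rightarrow> real \<Rightarrow> real \<Rightarrow> real \<Rightarrow> (real \<Rightarrow> ennreal) \<Rightarrow> (real \<Rightarrow> ennreal) \<Rightarrow> (real \<Rightarrow> ennreal) \<Rightarrow> ennreal" where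
  "char5 q r1 c d U P1 P2 =
     (SUP x\<in>{c..d}. P2 x * tail_int q r1 c d U P1 {x<..d} epowr (1 / r1))"

definition char6 ::
    "real \<Rightarrow> real \<Rightarrow> real \<Rightarrow> real \<Rightarrow> real \<Rightarrow> (real \<Rightarrow> ennreal) \<Rightarrow> (real \<Rightarrow> ennreal) \<Rightarrow> (real \<Rightarrow> ennreal) \<Rightarrow> ennreal" where
  "char6 q r2 \<kappa> c d U P1 P2 =
     (\<integral>\<^sup>+x\<in>{c..d}. (tail_int q r2 c d U P2 {x..d} epowr (\<kappa> / r2))
        \<partial>stieltjes c d (\<lambda>y. P1 y epowr \<kappa>)) epowr (1 / \<kappa>)"

definition char7 ::
    "real \<Rightarrow> real \<Rightarrow> real \<Rightarrow> real \<Rightarrow> real \<Rightarrow> (real \<Rightarrow> ennreal) \<Rightarrow> (real \<Rightarrow> ennreal) \<Rightarrow> (real \<Rightarrow> ennreal) \<Rightarrow> ennreal" where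
  "char7 q r1 \<kappa> c d U P1 P2 =
     (\<integral>\<^sup>+x\<in>{c..d}. (tail_int q r1 c d U P1 {x<..d} epowr (\<kappa> / r1))
        \<partial>stieltjes c d (\<lambda>y. P2 y epowr \<kappa>)) epowr (1 / \<kappa>)"

(* The case of exactly one infinite exponent: P is the profile of the finite exponent p, and W is
   built from the profile of the infinite one. *)
definition char_inf ::
    "real \<Rightarrow> ennreal \<Rightarrow> real \<Rightarrow> real \<Rightarrow> real \<Rightarrow> (real \<Rightarrow> ennreal) \<Rightarrow> (real \<Rightarrow> ennreal) \<Rightarrow> ennreal" where
  "char_inf q p r c d W P =
     (if p \<le> ennreal q then (SUP x\<in>{c..d}. P x * W x epowr (1 / q))
      else (\<integral>\<^sup>+x\<in>{c..d}. (W x epowr (r / q)) \<partial>stieltjes c d (\<lambda>y. P y epowr r)) epowr (1 / r))"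

definition char_inf_inf ::
    "real \<Rightarrow> real \<Rightarrow> real \<Rightarrow> (real \<Rightarrow> ennreal) \<Rightarrow> (real \<Rightarrow> ennreal) \<Rightarrow> (real \<Rightarrow> ennreal) \<Rightarrow> ennreal" where
  "char_inf_inf q c d w P1 P2 =
     (\<integral>\<^sup>+x\<in>{c..d}. ((P1 x * P2 x) epowr q * w x) \<partial>lebesgue) epowr (1 / q)"

(* The real numbers r1, r2, \<kappa> bound here are used only in the branches where they are positive
   and finite; elsewhere their values are irrelevant. *)
definition reg_char ::
    "real \<Rightarrow> ennreal \<Rightarrow> ennreal \<Rightarrow> (real \<Rightarrow> ennreal) \<Rightarrow> (real \<Rightarrow> ennreal) \<Rightarrow> (real \<Rightarrow> ennreal)
      \<Rightarrow> real \<Rightarrow> real \<Rightarrow> nat \<Rightarrow> ennreal" where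
  "reg_char q p1 p2 u v1 v2 c d m =
    (let um = (\<lambda>t. min (u t) (of_nat m));
         P1 = profile p1 (\<lambda>t. v1 t + 1 / of_nat m) c d;
         P2 = profile p2 (\<lambda>t. v2 t + 1 / of_nat m) c d;
         U = (\<lambda>x. \<integral>\<^sup>+t\<in>{x..d}. um t \<partial>lebesgue);
         W1 = (\<lambda>x. \<integral>\<^sup>+t\<in>{x..d}. (P1 t epowr q * um t) \<partial>lebesgue);
         W2 = (\<lambda>x. \<integral>\<^sup>+t\<in>{x..d}. (P2 t epowr q * um t) \<partial>lebesgue);
         r1 = 1 / (1 / q - 1 / enn2real p1);
         r2 = 1 / (1 / q - 1 / enn2real p2);
         \<kappa> = 1 / (1 / q - 1 / enn2real p1 - 1 / enn2real p2)
     in if p1 = top \<and> p2 = top then char_inf_inf q c d um P1 P2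
        else if p1 = top then char_inf q p2 r2 c d W1 P2
        else if p2 = top then char_inf q p1 r1 c d W2 P1
        else if p1 \<le> ennreal q \<and> p2 \<le> ennreal q then char1 q c d U P1 P2
        else if p1 \<le> ennreal q then char_hat q r2 c d U P1 P2
        else if p2 \<le> ennreal q then char_hat q r1 c d U P2 P1
        else if 1 / q \<le> 1 / enn2real p1 + 1 / enn2real p2
          then char4 q r2 c d U P1 P2 + char5 q r1 c d U P1 P2
        else char6 q r2 \<kappa> c d U P1 P2 + char7 q r1 \<kappa> c d U P1 P2)"

definition dir_char ::
    "real \<Rightarrow> ennreal \<Rightarrow> ennreal \<Rightarrow> real set \<Rightarrow> (real \<Rightarrow> ennreal) \<Rightarrow> (real \<Rightarrow> ennreal) \<Rightarrow> (real \<Rightarrow> ennreal)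
      \<Rightarrow> ennreal" where
  "dir_char q p1 p2 I u v1 v2 =
     (SUP (c, d)\<in>{(c, d). c < d \<and> {c..d} \<subseteq> I}. SUP m\<in>{1..}. reg_char q p1 p2 u v1 v2 c d m)"

end

theory Submission
  imports Defs "HOL-Probability.Distribution_Functions"
begin

text \<open>
  Both sides of the equivalence are compared with an inequality about sequences.  Let
  \<Phi> be the profile of a weight on a compact interval J = [c,d].  Its dyadic levels
  \<Phi>(d) / 2^n cut the set where \<Phi> > 0 into cells on which \<Phi> is constant up to a factor 2.
  Hoelder's inequality on the cells and geometric summation dominate the Hardy transform of f by a
  step function with the value a(n) * level n on the n-th cell, where the l^p norm of a is at most
  four times the weighted norm of f (hardy_le_cell_step).  Conversely every sequence a is realised
  by a function f of no larger norm whose Hardy transform dominates half of the step function that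
  jumps by a(n) * level n where \<Phi> reaches level n.  For p = 1 the mass of f may have to be
  put slightly to the right of that point, because 1 / v may come close to its essential supremum
  only there; the shift is removed at the end by monotone convergence.  The predicate profile_scale
  collects these two facts, and ex_profile_scale proves them for every finite p.  So the bilinear
  inequality on J bounds the integral of the q-th powers of two cumulative step functions against u
  by the q-th powers of the sequence norms, and such a bound for two step functions with one value
  per cell implies the bilinear inequality; each passage costs a fixed factor
  (bilinear_bound_of_admissible, admissible_of_upper_bound).

  The Stieltjes measure d(\<Phi>^r) is the image of Lebesgue measure under a generalised inverse of
  \<Phi>^r.  So integrals of monotone functions against it are comparable, up to a shift of
  the index, to sums over the levels with weights level(n)^r, and jumps of \<Phi> need no separate treatment
  (nn_integral_mu_lower, nn_integral_mu_upper).  This turns the characteristics into conditions on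
  sequences, too.

  For one sequence the inequality is elementary: unit sequences and the inclusion of l^p in l^q
  settle p \<le> q, Hoelder's inequality and its converse settle q < p (cell_step_upper_sup,
  cell_step_upper_int, lower_sup, lower_int).  For two sequences, necessity follows by freezing one
  of them and applying the linear result to the other one, or by applying it twice (necessary_sup,
  necessary_hat, necessary_int).  Sufficiency follows in the same way if some exponent is at most q
  (sufficient_sup, sufficient_hat).  If q is smaller than both exponents, the pairs of cells of the
  two scales that meet form a staircase.  It is split into the pairs for which the first scale
  reaches its next level no later than the second one, and the other pairs.  In the first class
  each cell of the second scale meets at most two cells of the first one, so Hoelder's inequality
  in each row and over the rows loses only a constant; the second class is symmetric (staircase).
  What remains is an inequality for one sequence, which is governed by a supremum if
  1/q \<le> 1/p1 + 1/p2 and by a sum with exponent \<kappa> otherwise.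

  If p = \<infinity>, the function 1 / v has norm at most 1 and its Hardy transform \<Phi> dominates
  that of every f, up to the factor norm of f.  An infinite exponent thus only changes the output
  weight, without any loss, which gives equality when both exponents are infinite.

  From compact intervals to I: restricting the functions to J, lowering u and raising v1, v2 keeps
  an inequality valid with the same constant, so every regularised characteristic is bounded by
  C_I.  Conversely I is exhausted by compact intervals and f, g are truncated to bounded functions;
  for these the effect of adding 1/m to the weights disappears as m grows, and monotone convergence
  gives the inequality on I (admissible_of_dir_char).
\<close>

section \<open>Powers and series of extended nonnegative numbers\<close>

lemma epowr_0 [simp]: "0 < s \<Longrightarrow> 0 epowr s = 0"
  by (simp add: epowr_def)

lemma epowr_top [simp]: "0 < s \<Longrightarrow> top epowr s = top"
  by (simp add: epowr_def)

lemma epowr_one [simp]: "1 epowr s = 1"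
  by (simp add: epowr_def)

lemma epowr_1 [simp]: "x epowr 1 = x"
  by (cases x) (auto simp: epowr_def)

lemma epowr_ennreal: "0 \<le> x \<Longrightarrow> 0 < s \<Longrightarrow> ennreal x epowr s = ennreal (x powr s)"
  by (auto simp: epowr_def)

lemma epowr_ennreal': "0 < x \<Longrightarrow> ennreal x epowr s = ennreal (x powr s)"
  by (auto simp: epowr_def)

lemma epowr_eq_0_iff [simp]: "0 < s \<Longrightarrow> x epowr s = 0 \<longleftrightarrow> x = 0"
  by (cases x) (auto simp: epowr_def)

lemma epowr_eq_top_iff [simp]: "0 < s \<Longrightarrow> x epowr s = top \<longleftrightarrow> x = top"
  by (cases x) (auto simp: epowr_def)

lemma epowr_less_top_iff [simp]: "0 < s \<Longrightarrow> x epowr s < top \<longleftrightarrow> x < top"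
  by (simp add: less_top[symmetric])

lemma epowr_mono: "x \<le> y \<Longrightarrow> 0 < s \<Longrightarrow> x epowr s \<le> y epowr s"
  by (cases x; cases y) (auto simp: epowr_ennreal top_unique intro!: ennreal_leI powr_mono2)

lemma epowr_mult:
  assumes "0 < s" shows "(x * y) epowr s = x epowr s * y epowr s"
proof (cases x; cases y)
  fix r t assume "x = ennreal r" "0 \<le> r" "y = ennreal t" "0 \<le> t"
  then show ?thesis using assms
    by (simp add: epowr_ennreal ennreal_mult[symmetric] powr_mult)
qed (use assms in \<open>auto simp: ennreal_mult_top ennreal_top_mult epowr_ennreal\<close>)

lemma epowr_epowr:
  assumes "0 < s" "0 < t" shows "(x epowr s) epowr t = x epowr (s * t)"
  using assms by (cases x) (auto simp: epowr_ennreal powr_powr)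

lemma epowr_add:
  assumes "0 < s" "0 < t" shows "x epowr (s + t) = x epowr s * x epowr t"
  using assms by (cases x) (auto simp: epowr_ennreal powr_add ennreal_mult)

lemma epowr_le_iff [simp]: "0 < s \<Longrightarrow> x epowr s \<le> y epowr s \<longleftrightarrow> x \<le> y"
proof
  assume s: "0 < s" and le: "x epowr s \<le> y epowr s"
  have "(x epowr s) epowr (1/s) \<le> (y epowr s) epowr (1/s)"
    by (rule epowr_mono[OF le]) (use s in auto)
  with s show "x \<le> y" by (simp add: epowr_epowr)
qed (rule epowr_mono)

lemma epowr_inverse [simp]: "0 < s \<Longrightarrow> (x epowr s) epowr (1 / s) = x" "0 < s \<Longrightarrow> (x epowr (1 / s)) epowr s = x"
  by (simp_all add: epowr_epowr)

lemma epowr_le_iff': "0 < s \<Longrightarrow> x epowr (1 / s) \<le> y \<longleftrightarrow> x \<le> y epowr s"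
  using epowr_le_iff[of s "x epowr (1 / s)" y] by simp

lemma le_epowr_iff': "0 < s \<Longrightarrow> y \<le> x epowr (1 / s) \<longleftrightarrow> y epowr s \<le> x"
  using epowr_le_iff[of s y "x epowr (1 / s)"] by simp

lemma epowr_SUP:
  assumes "0 < s" "I \<noteq> {}" shows "(SUP i\<in>I. f i) epowr s = (SUP i\<in>I. f i epowr s)"
proof (rule antisym)
  have "(SUP i\<in>I. f i) \<le> (SUP i\<in>I. f i epowr s) epowr (1 / s)"
    using assms by (intro SUP_least) (simp add: le_epowr_iff', rule SUP_upper)
  then show "(SUP i\<in>I. f i) epowr s \<le> (SUP i\<in>I. f i epowr s)"
    using assms by (simp add: le_epowr_iff')
qed (use assms in \<open>auto intro!: SUP_least epowr_mono SUP_upper\<close>)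

lemma measurable_epowr [measurable (raw)]:
  "f \<in> borel_measurable M \<Longrightarrow> (\<lambda>x. f x epowr s) \<in> borel_measurable M"
proof -
  have "(\<lambda>x. x epowr s) \<in> borel_measurable borel"
    unfolding epowr_def
  proof (intro measurable_If)
    show "(\<lambda>x::ennreal. ennreal (enn2real x powr s)) \<in> borel_measurable borel" by measurable
    show "{x \<in> space borel. x = (0::ennreal) \<and> s < 0} \<in> sets borel" by (cases "s < 0") auto
  qed auto
  then show "f \<in> borel_measurable M \<Longrightarrow> (\<lambda>x. f x epowr s) \<in> borel_measurable M"
    by (rule measurable_compose_rev)
qed

lemma epowr_indicator [simp]: "0 < s \<Longrightarrow> (f * indicator A x) epowr s = f epowr s * indicator A x"
  by (auto split: split_indicator)

lemma SUP_mult_incseq: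
  fixes f g :: "nat \<Rightarrow> ennreal"
  assumes "incseq f" "incseq g"
  shows "(SUP n. f n) * (SUP n. g n) = (SUP n. f n * g n)"
proof (rule antisym)
  show "(SUP n. f n) * (SUP n. g n) \<le> (SUP n. f n * g n)"
    unfolding SUP_mult_left_ennreal SUP_mult_right_ennreal
  proof (intro SUP_least)
    fix i j
    have "f j * g i \<le> f (max i j) * g (max i j)"
      using incseqD[OF assms(1), of j "max i j"] incseqD[OF assms(2), of i "max i j"] by (intro mult_mono) auto
    also have "\<dots> \<le> (SUP n. f n * g n)" by (rule SUP_upper) simp
    finally show "f j * g i \<le> (SUP n. f n * g n)" .
  qed
qed (auto intro!: SUP_least mult_mono SUP_upper)

lemma suminf_swap_ennreal:
  fixes f :: "nat \<Rightarrow> nat \<Rightarrow> ennreal"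
  shows "(\<Sum>i. \<Sum>j. f i j) = (\<Sum>j. \<Sum>i. f i j)"
  using nn_integral_suminf[of "\<lambda>j i. f i j" "count_space UNIV"] by (simp add: nn_integral_count_space_nat)

lemma suminf_single:
  fixes f :: "nat \<Rightarrow> ennreal"
  assumes "\<And>k. k \<noteq> n \<Longrightarrow> f k = 0" shows "suminf f = f n"
  using suminf_finite[of "{n}" f] assms by simp

lemma suminf_Suc_le:
  fixes f :: "nat \<Rightarrow> ennreal"
  shows "(\<Sum>n. f (Suc n)) \<le> (\<Sum>n. f n)"
proof (rule suminf_le_const)
  fix N
  have "(\<Sum>n<N. f (Suc n)) \<le> (\<Sum>n<Suc N. f n)" by (simp add: sum.lessThan_Suc_shift del: sum.lessThan_Suc)
  also have "\<dots> \<le> (\<Sum>n. f n)" by (rule sum_le_suminf) auto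
  finally show "(\<Sum>n<N. f (Suc n)) \<le> (\<Sum>n. f n)" .
qed simp

text \<open>
  The infinite cases hold because both exponents are positive; otherwise this is the real
  inequality.
\<close>

lemma young_ennreal:
  fixes x y :: ennreal
  assumes "1 < a" "1 < b" "1/a + 1/b = 1"
  shows "x * y \<le> x epowr a * ennreal (1 / a) + y epowr b * ennreal (1 / b)"
proof (cases x; cases y)
  fix r t assume *: "x = ennreal r" "0 \<le> r" "y = ennreal t" "0 \<le> t"
  have "r * t \<le> r powr a / a + t powr b / b"
    using Youngs_inequality[of a b r t] assms * by simp
  then show ?thesis using assms *
    by (simp add: epowr_ennreal flip: ennreal_mult ennreal_plus)
qed (use assms in \<open>auto simp: ennreal_top_mult ennreal_mult_top\<close>)

text \<open>
  Normalise both factors and integrate Young's inequality.  Factors of integral 0 or \<infinity>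
  are treated apart, since they cannot be normalised.
\<close>

lemma nn_integral_Hoelder:
  fixes f g :: "'a \<Rightarrow> ennreal"
  assumes ab: "1 < a" "1 < b" "1/a + 1/b = 1"
    and [measurable]: "f \<in> borel_measurable M" "g \<in> borel_measurable M"
  shows "(\<integral>\<^sup>+x. f x * g x \<partial>M) \<le> (\<integral>\<^sup>+x. f x epowr a \<partial>M) epowr (1/a) * (\<integral>\<^sup>+x. g x epowr b \<partial>M) epowr (1/b)"
proof -
  define X where "X = (\<integral>\<^sup>+x. f x epowr a \<partial>M)"
  define Y where "Y = (\<integral>\<^sup>+x. g x epowr b \<partial>M)"
  have ab0: "0 < a" "0 < b" using ab by auto
  consider "X = 0" | "Y = 0" | "X \<noteq> 0" "Y \<noteq> 0" "X = top \<or> Y = top" | "X \<noteq> 0" "Y \<noteq> 0" "X \<noteq> top" "Y \<noteq> top"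
    by blast
  then show ?thesis
  proof cases
    case 1
    then have "AE x in M. f x = 0"
      using ab0 unfolding X_def by (subst (asm) nn_integral_0_iff_AE) auto
    then have "(\<integral>\<^sup>+x. f x * g x \<partial>M) = (\<integral>\<^sup>+x. 0 \<partial>M)"
      by (intro nn_integral_cong_AE) auto
    then show ?thesis by simp
  next
    case 2
    then have "AE x in M. g x = 0"
      using ab0 unfolding Y_def by (subst (asm) nn_integral_0_iff_AE) auto
    then have "(\<integral>\<^sup>+x. f x * g x \<partial>M) = (\<integral>\<^sup>+x. 0 \<partial>M)"
      by (intro nn_integral_cong_AE) auto
    then show ?thesis by simp
  next
    case 3
    then have "X epowr (1/a) * Y epowr (1/b) = top"
      using ab0 by (auto simp: ennreal_mult_eq_top_iff)
    then show ?thesis unfolding X_def Y_def by simp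
  next
    case 4
    define A where "A = X epowr (1/a)"
    define B where "B = Y epowr (1/b)"
    have AB: "A \<noteq> 0" "A \<noteq> top" "B \<noteq> 0" "B \<noteq> top" using 4 ab0 by (auto simp: A_def B_def)
    have inv: "A * (1/A) = 1" "B * (1/B) = 1"
      using AB by (simp_all add: ennreal_times_divide mult.commute ennreal_divide_self less_top[symmetric])
    have pw: "X * (1/A) epowr a = 1" "Y * (1/B) epowr b = 1"
    proof -
      have "X * (1/A) epowr a = (A * (1/A)) epowr a"
        using ab0 by (simp add: epowr_mult A_def)
      then show "X * (1/A) epowr a = 1" by (simp add: inv)
      have "Y * (1/B) epowr b = (B * (1/B)) epowr b"
        using ab0 by (simp add: epowr_mult B_def)
      then show "Y * (1/B) epowr b = 1" by (simp add: inv)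
    qed
    have scale: "f x * g x = (A * B) * ((f x * (1/A)) * (g x * (1/B)))" for x
    proof -
      have "f x * g x = (A * (1/A)) * (B * (1/B)) * (f x * g x)" by (simp only: inv mult_1)
      then show ?thesis by (simp only: mult_ac)
    qed
    have "(\<integral>\<^sup>+x. f x * g x \<partial>M) = (\<integral>\<^sup>+x. (A * B) * ((f x * (1/A)) * (g x * (1/B))) \<partial>M)"
      by (intro nn_integral_cong scale)
    also have "\<dots> = (A * B) * (\<integral>\<^sup>+x. (f x * (1/A)) * (g x * (1/B)) \<partial>M)"
      by (rule nn_integral_cmult) measurable
    also have "(\<integral>\<^sup>+x. (f x * (1/A)) * (g x * (1/B)) \<partial>M)
        \<le> (\<integral>\<^sup>+x. (f x * (1/A)) epowr a * ennreal (1/a) + (g x * (1/B)) epowr b * ennreal (1/b) \<partial>M)"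
      by (intro nn_integral_mono young_ennreal ab)
    also have "\<dots> = X * (1/A) epowr a * ennreal (1/a) + Y * (1/B) epowr b * ennreal (1/b)"
      unfolding X_def Y_def using ab0
      by (subst nn_integral_add) (auto simp: epowr_mult nn_integral_multc)
    also have "\<dots> = 1"
      using ab by (simp add: pw flip: ennreal_plus)
    finally show ?thesis by (simp add: A_def B_def X_def Y_def mult_left_mono)
  qed
qed

lemma suminf_Hoelder:
  fixes f g :: "nat \<Rightarrow> ennreal"
  assumes "1 < a" "1 < b" "1/a + 1/b = 1"
  shows "(\<Sum>n. f n * g n) \<le> (\<Sum>n. f n epowr a) epowr (1/a) * (\<Sum>n. g n epowr b) epowr (1/b)"
  using nn_integral_Hoelder[OF assms, of f "count_space UNIV" g] by (simp add: nn_integral_count_space_nat)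

text \<open>
  The inclusion of l^s in l^t: every term is at most the s-norm, so t - s of the t factors can
  be pulled out of the sum.
\<close>

lemma suminf_epowr_mono_exponent:
  fixes f :: "nat \<Rightarrow> ennreal"
  assumes "0 < s" "s \<le> t"
  shows "(\<Sum>n. f n epowr t) \<le> (\<Sum>n. f n epowr s) epowr (t / s)"
proof (cases "s = t")
  case False
  define S where "S = (\<Sum>n. f n epowr s)"
  have st: "0 < (t - s) / s" "t / s = 1 + (t - s) / s" using assms False by (auto simp: field_simps)
  have le: "f n epowr s \<le> S" for n
    unfolding S_def using ennreal_suminf_lessD[of "\<lambda>n. f n epowr s" _ n] by (meson leI less_irrefl)
  have "f n epowr t \<le> f n epowr s * S epowr ((t - s) / s)" for n
  proof -
    have "f n epowr t = f n epowr s * f n epowr (t - s)"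
      using assms False epowr_add[of s "t - s" "f n"] by simp
    also have "f n epowr (t - s) = (f n epowr s) epowr ((t - s) / s)"
      using assms st(1) by (simp add: epowr_epowr)
    also have "\<dots> \<le> S epowr ((t - s) / s)" by (intro epowr_mono le st)
    finally show ?thesis by (simp add: mult_left_mono)
  qed
  then have "(\<Sum>n. f n epowr t) \<le> (\<Sum>n. f n epowr s * S epowr ((t - s) / s))"
    by (intro suminf_le) auto
  also have "\<dots> = S epowr (t / s)"
    unfolding st(2) using st(1) by (subst epowr_add) (auto simp: S_def)
  finally show ?thesis by (simp add: S_def)
qed (use assms in simp)

lemma suminf_le_ennreal: "(\<And>n. f n \<le> (g n :: ennreal)) \<Longrightarrow> (\<Sum>n. f n) \<le> (\<Sum>n. g n)"
  by (intro suminf_le) auto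

text \<open>
  The Schur test: Jensen's inequality for the weights k n l of row n (a Hoelder inequality with
  the kernel split into two powers), and then summation over the rows, where the columns are
  used.
\<close>

lemma suminf_Schur:
  fixes k :: "nat \<Rightarrow> nat \<Rightarrow> ennreal"
  assumes r: "1 \<le> r" and rows: "\<And>n. (\<Sum>l. k n l) \<le> A" and cols: "\<And>l. (\<Sum>n. k n l) \<le> A"
  shows "(\<Sum>n. (\<Sum>l. k n l * b l) epowr r) \<le> A epowr r * (\<Sum>l. b l epowr r)"
proof (cases "r = 1")
  case True
  have "(\<Sum>n. \<Sum>l. k n l * b l) = (\<Sum>l. (\<Sum>n. k n l) * b l)"
    by (subst suminf_swap_ennreal) simp
  also have "\<dots> \<le> (\<Sum>l. A * b l)" by (intro suminf_le_ennreal mult_right_mono cols) auto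
  finally show ?thesis using True by simp
next
  case False
  with r have r: "1 < r" by simp
  define r' where "r' = r / (r - 1)"
  have r': "1 < r'" "1 / r' + 1 / r = 1" "0 < r'" "r / r' = r - 1" "1 / r' * r = r - 1"
    using r by (auto simp: r'_def field_simps)
  have Jensen: "(\<Sum>l. k n l * b l) epowr r \<le> A epowr (r - 1) * (\<Sum>l. k n l * b l epowr r)" for n
  proof -
    have split: "k n l = k n l epowr (1/r') * k n l epowr (1/r)" for l
      using r r' epowr_add[of "1/r'" "1/r" "k n l"] by simp
    have "(\<Sum>l. k n l * b l) = (\<Sum>l. k n l epowr (1/r') * (k n l epowr (1/r) * b l))"
      by (subst split) (simp add: mult.assoc)
    also have "\<dots> \<le> (\<Sum>l. (k n l epowr (1/r')) epowr r') epowr (1/r')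
        * (\<Sum>l. (k n l epowr (1/r) * b l) epowr r) epowr (1/r)"
      by (rule suminf_Hoelder) (use r r' in auto)
    also have "\<dots> = (\<Sum>l. k n l) epowr (1/r') * (\<Sum>l. k n l * b l epowr r) epowr (1/r)"
      using r r' by (simp add: epowr_mult)
    also have "\<dots> \<le> A epowr (1/r') * (\<Sum>l. k n l * b l epowr r) epowr (1/r)"
      using r' by (intro mult_right_mono epowr_mono rows) auto
    finally have "(\<Sum>l. k n l * b l) epowr r \<le> (A epowr (1/r') * (\<Sum>l. k n l * b l epowr r) epowr (1/r)) epowr r"
      using r by (intro epowr_mono) auto
    also have "\<dots> = A epowr (r - 1) * (\<Sum>l. k n l * b l epowr r)"
      using r r' by (simp add: epowr_mult epowr_epowr)
    finally show ?thesis .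
  qed
  have "(\<Sum>n. (\<Sum>l. k n l * b l) epowr r) \<le> (\<Sum>n. A epowr (r - 1) * (\<Sum>l. k n l * b l epowr r))"
    by (intro suminf_le_ennreal Jensen)
  also have "\<dots> = A epowr (r - 1) * (\<Sum>l. (\<Sum>n. k n l) * b l epowr r)"
    by (simp, subst suminf_swap_ennreal) simp
  also have "\<dots> \<le> A epowr (r - 1) * (\<Sum>l. A * b l epowr r)"
    by (intro mult_left_mono suminf_le_ennreal mult_right_mono cols) auto
  also have "\<dots> = A epowr r * (\<Sum>l. b l epowr r)"
    using r epowr_add[of "r - 1" 1 A] by (simp add: mult.assoc)
  finally show ?thesis .
qed

lemma suminf_geometric_ennreal:
  assumes "0 \<le> \<theta>" "\<theta> < 1" shows "(\<Sum>m. ennreal (\<theta> ^ m)) = ennreal (1 / (1 - \<theta>))"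
  using assms by (subst suminf_ennreal2) (auto simp: suminf_geometric intro!: summable_geometric)

text \<open>
  The kernels \<theta>^|l - n| cut to one side of the diagonal have row and column sums at most
  1 / (1 - \<theta>).  This is the discrete Hardy inequality for geometrically growing weights:
  cumulative sums cost no more than a constant.
\<close>

lemma suminf_geometric_tail_le:
  fixes b :: "nat \<Rightarrow> ennreal"
  assumes "0 \<le> \<theta>" "\<theta> < 1" "1 \<le> r"
  shows "(\<Sum>n. (\<Sum>l. (if n \<le> l then ennreal (\<theta> ^ (l - n)) else 0) * b l) epowr r)
      \<le> ennreal (1 / (1 - \<theta>)) epowr r * (\<Sum>l. b l epowr r)" (is ?A)
    and "(\<Sum>n. (\<Sum>l. (if l \<le> n then ennreal (\<theta> ^ (n - l)) else 0) * b l) epowr r)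
      \<le> ennreal (1 / (1 - \<theta>)) epowr r * (\<Sum>l. b l epowr r)" (is ?B)
proof -
  have up: "(\<Sum>l. (if n \<le> l then ennreal (\<theta> ^ (l - n)) else 0)) \<le> ennreal (1 / (1 - \<theta>))" for n
  proof -
    have "(\<Sum>l. (if n \<le> l then ennreal (\<theta> ^ (l - n)) else 0)) = (\<Sum>m. ennreal (\<theta> ^ m))"
      using suminf_offset[of "\<lambda>l. if n \<le> l then ennreal (\<theta> ^ (l - n)) else 0" n] by simp
    then show ?thesis using assms by (simp only: suminf_geometric_ennreal order_refl)
  qed
  have down: "(\<Sum>l. (if l \<le> n then ennreal (\<theta> ^ (n - l)) else 0)) \<le> ennreal (1 / (1 - \<theta>))" for n
  proof -
    have "(\<Sum>l. (if l \<le> n then ennreal (\<theta> ^ (n - l)) else 0)) = (\<Sum>l\<le>n. ennreal (\<theta> ^ (n - l)))"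
      by (subst suminf_finite[of "{..n}"]) auto
    also have "\<dots> = (\<Sum>l\<le>n. ennreal (\<theta> ^ l))"
      by (rule sum.reindex_bij_witness[of _ "\<lambda>l. n - l" "\<lambda>l. n - l"]) auto
    also have "\<dots> \<le> (\<Sum>m. ennreal (\<theta> ^ m))" by (rule sum_le_suminf) auto
    finally show ?thesis using assms by (simp only: suminf_geometric_ennreal)
  qed
  show ?A by (rule suminf_Schur[OF \<open>1 \<le> r\<close>]) (auto intro: up down)
  show ?B by (rule suminf_Schur[OF \<open>1 \<le> r\<close>]) (auto intro: up down)
qed

text \<open>
  The converse of Hoelder's inequality.  Testing with the truncations of b^(P' - 1), which are
  finite sequences with finite entries, gives S \<le> B * S^(1/P) for the partial sums S of
  b^P'; these are finite, so the factor may be cancelled.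
\<close>

lemma suminf_dual_bound:
  fixes b :: "nat \<Rightarrow> ennreal"
  assumes P: "1 < P" "1 < P'" "1/P + 1/P' = 1" and fin: "\<And>n. b n < top"
    and bd: "\<And>a. (\<And>n. a n < top) \<Longrightarrow> finite {n. a n \<noteq> 0} \<Longrightarrow> (\<Sum>n. a n * b n) \<le> B * (\<Sum>n. a n epowr P) epowr (1/P)"
  shows "(\<Sum>n. b n epowr P') \<le> B epowr P'"
proof -
  have P0: "0 < P" "0 < P'" "0 < P' - 1" using P by auto
  have PP: "P' - 1 + 1 = P'" "(P' - 1) * P = P'"
    using P by (auto simp: field_simps)
  have "(\<Sum>n<N. b n epowr P') \<le> B epowr P'" for N
  proof -
    define S where "S = (\<Sum>n<N. b n epowr P')"
    have Sfin: "S < top" using fin P0 by (auto simp: S_def less_top)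
    define a where "a n = (if n < N then b n epowr (P' - 1) else 0)" for n
    have "a n < top" for n using fin P0 by (auto simp: a_def)
    moreover have "finite {n. a n \<noteq> 0}" by (rule finite_subset[of _ "{..<N}"]) (auto simp: a_def split: if_splits)
    ultimately have "(\<Sum>n. a n * b n) \<le> B * (\<Sum>n. a n epowr P) epowr (1/P)" by (rule bd)
    also have "(\<Sum>n. a n * b n) = S"
      unfolding S_def a_def using epowr_add[of "P' - 1" 1] P0 PP
      by (subst suminf_finite[of "{..<N}"]) auto
    also have "(\<Sum>n. a n epowr P) = S"
      unfolding S_def a_def using P0 PP
      by (subst suminf_finite[of "{..<N}"]) (auto simp: epowr_epowr)
    finally have le: "S \<le> B * S epowr (1/P)" .
    show ?thesis
    proof (cases "S = 0")
      case False
      have "S = S epowr (1/P') * S epowr (1/P)"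
        using P P0 epowr_add[of "1/P'" "1/P" S] by (simp add: add.commute)
      with le have "S epowr (1/P') * S epowr (1/P) \<le> B * S epowr (1/P)" by simp
      then have "S epowr (1/P') \<le> B"
        using False Sfin P0 by (subst (asm) ennreal_mult_le_mult_iff[of "S epowr (1/P)", unfolded mult.commute[of "S epowr (1/P)"]]) auto
      then show ?thesis using P0 by (simp add: epowr_le_iff' S_def)
    qed (simp add: S_def)
  qed
  then show ?thesis by (intro suminf_le_const) auto
qed

section \<open>Stieltjes measures and dyadic levels\<close>

text \<open>
  The profile of a weight on [c,d], extended to the line by 0 to the left of c and by its last
  value to the right of d.  A positive value at c then is a jump and becomes an atom of the
  Stieltjes measure.
\<close>

locale scale =
  fixes G :: "real \<Rightarrow> real" and c d :: real
  assumes cd: "c \<le> d"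
    and mono: "\<And>x y. x \<le> y \<Longrightarrow> G x \<le> G y"
    and right_cont: "\<And>a. continuous (at_right a) G"
    and below: "\<And>x. x < c \<Longrightarrow> G x = 0"
    and above: "\<And>x. d \<le> x \<Longrightarrow> G x = G d"
begin

lemma nonneg [simp]: "0 \<le> G x"
  using mono[of "min x (c - 1)" x] below[of "min x (c - 1)"] by auto

lemma le_total: "G x \<le> G d"
  using mono[of x "max x d"] above[of "max x d"] by auto

definition gen_inv :: "real \<Rightarrow> real" where
  "gen_inv \<tau> = Inf {x. \<tau> \<le> G x}"

text \<open>
  Right continuity puts the infimum itself into the superlevel set, which makes gen_inv and G a
  Galois connection.
\<close>

lemma gen_inv_le_iff:
  assumes "0 < \<tau>" "\<tau> \<le> G d" shows "gen_inv \<tau> \<le> t \<longleftrightarrow> \<tau> \<le> G t"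
proof -
  have lb: "c \<le> x" if "\<tau> \<le> G x" for x
    using that assms below[of x] by (cases "x < c") auto
  then have bdd: "bdd_below {x. \<tau> \<le> G x}" unfolding bdd_below_def by blast
  have "\<tau> \<le> G (gen_inv \<tau>)"
  proof (rule tendsto_lowerbound)
    show "(G \<longlongrightarrow> G (gen_inv \<tau>)) (at_right (gen_inv \<tau>))"
      using right_cont[of "gen_inv \<tau>"] unfolding continuous_within .
    have "\<tau> \<le> G y" if "gen_inv \<tau> < y" for y
    proof -
      obtain x where "\<tau> \<le> G x" "x < y"
      proof -
        have "{x. \<tau> \<le> G x} \<noteq> {}" using assms(2) by auto
        then have "\<exists>x\<in>{x. \<tau> \<le> G x}. x < y" by (rule cInf_lessD) (use \<open>gen_inv \<tau> < y\<close> in \<open>simp add: gen_inv_def\<close>)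
        then show ?thesis using that by auto
      qed
      then show ?thesis using mono[of x y] by simp
    qed
    then show "\<forall>\<^sub>F y in at_right (gen_inv \<tau>). \<tau> \<le> G y"
      by (auto simp: eventually_at_filter)
  qed simp
  then show ?thesis
    using mono[of "gen_inv \<tau>" t] cInf_lower[OF _ bdd, of t] by (auto simp: gen_inv_def)
qed

lemma le_gen_inv: "0 < \<tau> \<Longrightarrow> \<tau> \<le> G d \<Longrightarrow> \<tau> \<le> G (gen_inv \<tau>)"
  using gen_inv_le_iff[of \<tau> "gen_inv \<tau>"] by simp

lemma gen_inv_bounds: "0 < \<tau> \<Longrightarrow> \<tau> \<le> G d \<Longrightarrow> c \<le> gen_inv \<tau> \<and> gen_inv \<tau> \<le> d"
  using le_gen_inv[of \<tau>] below[of "gen_inv \<tau>"] gen_inv_le_iff[of \<tau> d] by (cases "gen_inv \<tau> < c") auto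

definition mu :: "real \<Rightarrow> real measure" where
  "mu r = interval_measure (\<lambda>x. G x powr r)"

lemma sets_mu [simp, measurable_cong]: "sets (mu r) = sets borel"
  by (simp add: mu_def)

lemma mono_powr: "0 < r \<Longrightarrow> x \<le> y \<Longrightarrow> G x powr r \<le> G y powr r"
  by (intro powr_mono2 mono) auto

lemma right_cont_powr: "0 < r \<Longrightarrow> continuous (at_right a) (\<lambda>x. G x powr r)"
  using right_cont[of a] unfolding continuous_within by (intro tendsto_powr') auto

text \<open>
  The generalised inverse of G^r on (0, G(d)^r].  Outside this range it is constant, so that it
  is measurable on the whole line.
\<close>

definition gen_inv_powr :: "real \<Rightarrow> real \<Rightarrow> real" where
  "gen_inv_powr r s = (if 0 < s \<and> s \<le> G d powr r then gen_inv (s powr (1/r)) else c)"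

lemma gen_inv_powr_le_iff:
  assumes "0 < r" "0 < s" "s \<le> G d powr r" shows "gen_inv_powr r s \<le> t \<longleftrightarrow> s \<le> G t powr r"
proof -
  have "s powr (1/r) \<le> (G d powr r) powr (1/r)" using assms by (intro powr_mono2) auto
  then have "s powr (1/r) \<le> G d" using assms by (simp add: powr_powr)
  then have "gen_inv_powr r s \<le> t \<longleftrightarrow> s powr (1/r) \<le> G t"
    using assms by (simp add: gen_inv_powr_def gen_inv_le_iff)
  also have "\<dots> \<longleftrightarrow> (s powr (1/r)) powr r \<le> G t powr r"
    using assms powr_mono2[of r "s powr (1/r)" "G t"] powr_less_mono2[of r "G t" "s powr (1/r)"] by fastforce
  also have "(s powr (1/r)) powr r = s" using assms by (simp add: powr_powr)
  finally show ?thesis .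
qed

lemma gen_inv_powr_measurable [measurable]: assumes "0 < r" shows "gen_inv_powr r \<in> borel_measurable borel"
proof (rule borel_measurableI_le)
  fix t
  have "{s. gen_inv_powr r s \<le> t} = {0<..G d powr r} \<inter> {..G t powr r} \<union> (if c \<le> t then - {0<..G d powr r} else {})"
  proof (rule set_eqI)
    fix s
    show "s \<in> {s. gen_inv_powr r s \<le> t} \<longleftrightarrow>
        s \<in> {0<..G d powr r} \<inter> {..G t powr r} \<union> (if c \<le> t then - {0<..G d powr r} else {})"
    proof (cases "0 < s \<and> s \<le> G d powr r")
      case True then show ?thesis using gen_inv_powr_le_iff[OF assms, of s t] by simp
    next
      case False then show ?thesis by (auto simp: gen_inv_powr_def)
    qed
  qed
  also have "\<dots> \<in> sets borel" by auto
  finally show "{s \<in> space borel. gen_inv_powr r s \<le> t} \<in> sets borel" by simp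
qed

text \<open>
  The preimage of (a,b] under the generalised inverse is (G(a)^r, G(b)^r], by the Galois
  connection.  Atoms of the Stieltjes measure correspond to intervals on which the inverse is
  constant, and are thereby distributed over the levels that the jump passes.
\<close>

lemma mu_eq_distr:
  assumes r: "0 < r"
  shows "mu r = distr (density lborel (indicator {0<..G d powr r})) borel (gen_inv_powr r)"
    (is "_ = ?D")
proof (rule measure_eqI_generator_eq)
  let ?E = "range (\<lambda>(a, b). {a<..b::real})"
  show "Int_stable ?E"
  proof (rule Int_stableI)
    fix A B assume "A \<in> ?E" "B \<in> ?E"
    then obtain a b a' b' where "A = {a<..b}" "B = {a'<..b'}" by auto
    then have "A \<inter> B = (\<lambda>(a, b). {a<..b}) (max a a', min b b')" by auto
    then show "A \<inter> B \<in> ?E" by blast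
  qed
  show "?E \<subseteq> Pow UNIV" by simp
  show "sets (mu r) = sigma_sets UNIV ?E" "sets ?D = sigma_sets UNIV ?E"
    by (simp_all add: borel_sigma_sets_Ioc)
  show "range (\<lambda>i. {- real i<..real i}) \<subseteq> ?E" by auto
  show "(\<Union>i. {- real i<..real i}) = UNIV" by (rule UN_Ioc_eq_UNIV)
  have emu: "emeasure (mu r) {a<..b} = ennreal (if a \<le> b then G b powr r - G a powr r else 0)" for a b
    unfolding mu_def using r by (subst emeasure_interval_measure_Ioc_eq) (auto intro: mono_powr right_cont_powr)
  show "emeasure (mu r) {- real i<..real i} \<noteq> \<infinity>" for i
    by (simp add: emu)
  fix X assume "X \<in> ?E"
  then obtain a b where X: "X = {a<..b}" by auto
  have "emeasure ?D {a<..b} = (\<integral>\<^sup>+s. indicator {0<..G d powr r} s * indicator {a<..b} (gen_inv_powr r s) \<partial>lborel)"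
  proof -
    have "emeasure ?D {a<..b} = (\<integral>\<^sup>+x. indicator {a<..b} x \<partial>?D)" by simp
    also have "\<dots> = (\<integral>\<^sup>+s. indicator {0<..G d powr r} s * indicator {a<..b} (gen_inv_powr r s) \<partial>lborel)"
      using r by (subst nn_integral_distr) (auto simp: nn_integral_density simp del: nn_integral_indicator)
    finally show ?thesis .
  qed
  also have "\<dots> = (\<integral>\<^sup>+s. indicator (if a \<le> b then {G a powr r<..G b powr r} else {}) s \<partial>lborel)"
  proof (rule nn_integral_cong)
    fix s
    have "0 < s" if "G a powr r < s" for s using that powr_ge_zero[of "G a" r] by linarith
    moreover have "s \<le> G d powr r" if "s \<le> G b powr r"
      using that powr_mono2[of r "G b" "G d"] le_total[of b] r by auto
    moreover have "G b powr r \<le> G a powr r" if "\<not> a \<le> b" using that r by (intro mono_powr) auto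
    ultimately show "indicator {0<..G d powr r} s * indicator {a<..b} (gen_inv_powr r s) =
        (indicator (if a \<le> b then {G a powr r<..G b powr r} else {}) s :: ennreal)"
      using gen_inv_powr_le_iff[OF r, of s a] gen_inv_powr_le_iff[OF r, of s b]
      by (auto simp: indicator_def split: if_splits)
  qed
  also have "\<dots> = ennreal (if a \<le> b then G b powr r - G a powr r else 0)"
    using r mono_powr[of r a b] by auto
  finally show "emeasure (mu r) X = emeasure ?D X" by (simp add: X emu)
qed

lemma nn_integral_mu:
  assumes "0 < r" and [measurable]: "h \<in> borel_measurable borel"
  shows "(\<integral>\<^sup>+x. h x \<partial>mu r) = (\<integral>\<^sup>+s. h (gen_inv_powr r s) * indicator {0<..G d powr r} s \<partial>lborel)"
  using assms(1) unfolding mu_eq_distr[OF assms(1)]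
  by (simp add: nn_integral_distr nn_integral_density mult.commute)

subsection \<open>Dyadic levels\<close>

definition level :: "nat \<Rightarrow> real" where "level n = G d / 2 ^ n"

definition level_pt :: "nat \<Rightarrow> real" where "level_pt n = gen_inv (level n)"

definition cell :: "nat \<Rightarrow> real set" where "cell n = {t. level n \<le> G t \<and> G t < 2 * level n}"

lemma level_nonneg [simp]: "0 \<le> level n" by (simp add: level_def)
lemma level_0 [simp]: "level 0 = G d" by (simp add: level_def)
lemma level_Suc: "level n = 2 * level (Suc n)" by (simp add: level_def)
lemma level_pos: "0 < G d \<Longrightarrow> 0 < level n" by (simp add: level_def)
lemma level_antimono: "m \<le> n \<Longrightarrow> level n \<le> level m" unfolding level_def by (intro divide_left_mono) auto
lemma level_le: "level n \<le> G d" using level_antimono[of 0 n] by simp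

lemma level_shift: "l \<le> n \<Longrightarrow> level n = level l * (1/2) ^ (n - l)"
  by (simp add: level_def power_diff field_simps)

lemma level_pt_le_iff: "0 < G d \<Longrightarrow> level_pt n \<le> t \<longleftrightarrow> level n \<le> G t"
  unfolding level_pt_def by (intro gen_inv_le_iff level_pos level_le)

lemma level_pt_bounds: "0 < G d \<Longrightarrow> c \<le> level_pt n \<and> level_pt n \<le> d"
  unfolding level_pt_def by (intro gen_inv_bounds level_pos level_le)

lemma G_measurable [measurable]: "G \<in> borel_measurable borel"
  by (intro borel_measurable_mono monoI mono)

lemma cell_sets [measurable]: "cell n \<in> sets borel"
  unfolding cell_def by measurable

lemma cell_unique: "t \<in> cell m \<Longrightarrow> t \<in> cell n \<Longrightarrow> m = n"
proof (induction m n rule: linorder_wlog)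
  case (le a b)
  show ?case
  proof (rule ccontr)
    assume "a \<noteq> b"
    then have "level b \<le> level (Suc a)" using le by (intro level_antimono) auto
    with le level_Suc[of a] show False by (auto simp: cell_def)
  qed
qed auto

lemma disjoint_cell: "disjoint_family cell"
  unfolding disjoint_family_on_def using cell_unique by blast

lemma ex_cell: assumes "0 < G t" obtains n where "t \<in> cell n"
proof -
  have pos: "0 < G d" using assms le_total[of t] by linarith
  obtain n where n: "G d / G t < 2 ^ n" using real_arch_pow[of 2 "G d / G t"] by auto
  then have ex: "level n \<le> G t" using assms by (auto simp: level_def field_simps)
  define m where "m = (LEAST n. level n \<le> G t)"
  have m: "level m \<le> G t" unfolding m_def using ex by (rule LeastI)
  have "G t < 2 * level m"
  proof (cases m)
    case 0 then show ?thesis using pos le_total[of t] by simp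
  next
    case (Suc k)
    then have "\<not> level k \<le> G t" unfolding m_def by (intro not_less_Least) auto
    then show ?thesis using level_Suc[of k] Suc by simp
  qed
  with m show ?thesis by (intro that[of m]) (simp add: cell_def)
qed

text \<open>
  The cells of index at most n lie between level n and the maximum of G, hence they fill the
  half-line on which G is at least level n.
\<close>

lemma superlevel_eq_UN_cell: assumes "0 < G d" shows "{level_pt n..} = (\<Union>l\<le>n. cell l)"
proof (intro set_eqI iffI)
  fix t assume "t \<in> {level_pt n..}"
  then have t: "level n \<le> G t" using assms by (simp add: level_pt_le_iff)
  then obtain l where l: "t \<in> cell l" using ex_cell[of t] level_pos[OF assms, of n] by fastforce
  have "l \<le> n"
  proof (rule ccontr)
    assume "\<not> l \<le> n"
    then have "level l \<le> level (Suc n)" by (intro level_antimono) auto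
    with l t level_Suc[of n] show False by (auto simp: cell_def)
  qed
  with l show "t \<in> (\<Union>l\<le>n. cell l)" by auto
next
  fix t assume "t \<in> (\<Union>l\<le>n. cell l)"
  then obtain l where "l \<le> n" "level l \<le> G t" by (auto simp: cell_def)
  then show "t \<in> {level_pt n..}" using level_antimono[of l n] assms by (auto simp: level_pt_le_iff)
qed

text \<open>
  The range (0, G(d)^r] of the powers of G is cut at the r-th powers of the levels.
\<close>

lemma nn_integral_mu_blocks:
  assumes r: "0 < r" and [measurable]: "H \<in> borel_measurable borel"
  shows "(\<integral>\<^sup>+x. H x \<partial>mu r) =
    (\<Sum>n. \<integral>\<^sup>+s. H (gen_inv_powr r s) * indicator {level (Suc n) powr r<..level n powr r} s \<partial>lborel)"
proof -
  let ?B = "\<lambda>n. {level (Suc n) powr r<..level n powr r}"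
  have disj: "disjoint_family ?B"
  proof -
    have "n = m" if "n \<le> m" "s \<in> ?B n" "s \<in> ?B m" for n m s
    proof (rule ccontr)
      assume "n \<noteq> m"
      then have "level m powr r \<le> level (Suc n) powr r" using r that by (intro powr_mono2 level_antimono) auto
      with that show False by auto
    qed
    then have "n = m" if "s \<in> ?B n" "s \<in> ?B m" for n m s
      using that nle_le[of n m] by blast
    then show ?thesis unfolding disjoint_family_on_def by blast
  qed
  have UN: "(\<Union>n. ?B n) = {0<..G d powr r}"
  proof (intro set_eqI iffI)
    fix s assume "s \<in> (\<Union>n. ?B n)"
    then obtain n where n: "level (Suc n) powr r < s" "s \<le> level n powr r" by auto
    moreover have "level n powr r \<le> G d powr r" using r by (intro powr_mono2 level_le) auto
    moreover have "0 < s" using n(1) powr_ge_zero[of "level (Suc n)" r] by linarith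
    ultimately show "s \<in> {0<..G d powr r}" by auto
  next
    fix s assume s: "s \<in> {0<..G d powr r}"
    have "(\<lambda>n. level n powr r) \<longlonglongrightarrow> 0 powr r"
    proof (intro tendsto_powr')
      have "(\<lambda>n. G d * (1/2) ^ n) \<longlonglongrightarrow> G d * 0" by (intro tendsto_mult tendsto_const LIMSEQ_realpow_zero) auto
      then show "level \<longlonglongrightarrow> 0" by (simp add: level_def[abs_def] field_simps)
    qed (use r in auto)
    then have "\<forall>\<^sub>F n in sequentially. level n powr r < s" using s by (intro order_tendstoD) auto
    then obtain n where n: "level n powr r < s" by (auto simp: eventually_sequentially)
    define m where "m = (LEAST n. level n powr r < s)"
    have m: "level m powr r < s" unfolding m_def using n by (rule LeastI)
    obtain k where k: "m = Suc k" using m s by (cases m) auto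
    then have "\<not> level k powr r < s" unfolding m_def by (intro not_less_Least) auto
    with m k show "s \<in> (\<Union>n. ?B n)" by auto
  qed
  have "(\<integral>\<^sup>+x. H x \<partial>mu r) = (\<integral>\<^sup>+s. (\<Sum>n. H (gen_inv_powr r s) * indicator (?B n) s) \<partial>lborel)"
    unfolding nn_integral_mu[OF assms] by (simp add: suminf_indicator[OF disj] UN)
  also have "\<dots> = (\<Sum>n. \<integral>\<^sup>+s. H (gen_inv_powr r s) * indicator (?B n) s \<partial>lborel)"
    using r by (intro nn_integral_suminf) auto
  finally show ?thesis .
qed

lemma gen_inv_powr_block:
  assumes r: "0 < r" and pos: "0 < G d" and s: "s \<in> {level (Suc n) powr r<..level n powr r}"
  shows "level_pt (Suc n) \<le> gen_inv_powr r s" "gen_inv_powr r s \<le> level_pt n"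
proof -
  have le: "level n powr r \<le> G d powr r" using r by (intro powr_mono2 level_le) auto
  have "level (Suc n) powr r < s" using s by simp
  then have "0 < s" using powr_ge_zero[of "level (Suc n)" r] by linarith
  with s le have s': "0 < s" "s \<le> G d powr r" by auto
  have "s \<le> G (gen_inv_powr r s) powr r" using gen_inv_powr_le_iff[OF r s', of "gen_inv_powr r s"] by simp
  then have "level (Suc n) powr r < G (gen_inv_powr r s) powr r" using s by auto
  then have "level (Suc n) \<le> G (gen_inv_powr r s)"
    using r powr_mono2[of r "G (gen_inv_powr r s)" "level (Suc n)"] by (cases "level (Suc n) \<le> G (gen_inv_powr r s)") auto
  then show "level_pt (Suc n) \<le> gen_inv_powr r s" using pos by (simp add: level_pt_le_iff)
  have "level n \<le> G (level_pt n)" using level_pt_le_iff[OF pos, of n "level_pt n"] by simp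
  then have "level n powr r \<le> G (level_pt n) powr r" using r by (intro powr_mono2) auto
  then show "gen_inv_powr r s \<le> level_pt n" using s unfolding gen_inv_powr_le_iff[OF r s'] by auto
qed

lemma block_length:
  assumes "0 < r" shows "emeasure lborel {level (Suc n) powr r<..level n powr r} = ennreal (1 - (1/2) powr r) * ennreal (level n powr r)"
proof -
  have "level (Suc n) powr r = (1/2) powr r * level n powr r"
    unfolding level_Suc[of n] by (simp add: powr_mult powr_divide)
  moreover have "(1/2::real) powr r \<le> 1" using assms powr_mono2[of r "1/2" 1] by simp
  moreover have "level (Suc n) powr r \<le> level n powr r" using assms by (intro powr_mono2 level_antimono) auto
  ultimately show ?thesis by (simp add: algebra_simps flip: ennreal_mult)
qed

text \<open>
  The n-th block has length comparable to level(n)^r, and there the integrand is evaluated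
  between two consecutive level points.
\<close>

lemma nn_integral_mu_lower:
  assumes r: "0 < r" and H [measurable]: "H \<in> borel_measurable borel"
    and le: "\<And>n t. 0 < G d \<Longrightarrow> level_pt (Suc n) \<le> t \<Longrightarrow> t \<le> level_pt n \<Longrightarrow> e n \<le> H t"
  shows "ennreal (1 - (1/2) powr r) * (\<Sum>n. ennreal (level n powr r) * e n) \<le> (\<integral>\<^sup>+x. H x \<partial>mu r)"
proof (cases "0 < G d")
  case True
  have "ennreal (1 - (1/2) powr r) * (\<Sum>n. ennreal (level n powr r) * e n) =
      (\<Sum>n. \<integral>\<^sup>+s. e n * indicator {level (Suc n) powr r<..level n powr r} s \<partial>lborel)"
    using r by (simp add: nn_integral_cmult block_length mult_ac flip: ennreal_suminf_cmult)
  also have "\<dots> \<le> (\<Sum>n. \<integral>\<^sup>+s. H (gen_inv_powr r s) * indicator {level (Suc n) powr r<..level n powr r} s \<partial>lborel)"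
    using gen_inv_powr_block[OF r True] le[OF True]
    by (intro suminf_le_ennreal nn_integral_mono) (auto split: split_indicator)
  also have "\<dots> = (\<integral>\<^sup>+x. H x \<partial>mu r)" by (rule nn_integral_mu_blocks[symmetric, OF r H])
  finally show ?thesis .
next
  case False
  then have "G d = 0" using nonneg[of d] by linarith
  then show ?thesis by (simp add: level_def)
qed

lemma nn_integral_mu_upper:
  assumes r: "0 < r" and H [measurable]: "H \<in> borel_measurable borel"
    and le: "\<And>n t. 0 < G d \<Longrightarrow> level_pt (Suc n) \<le> t \<Longrightarrow> t \<le> level_pt n \<Longrightarrow> H t \<le> e n"
  shows "(\<integral>\<^sup>+x. H x \<partial>mu r) \<le> (\<Sum>n. ennreal (level n powr r) * e n)"
proof (cases "0 < G d")
  case True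
  have "(\<integral>\<^sup>+x. H x \<partial>mu r) = (\<Sum>n. \<integral>\<^sup>+s. H (gen_inv_powr r s) * indicator {level (Suc n) powr r<..level n powr r} s \<partial>lborel)"
    by (rule nn_integral_mu_blocks[OF r H])
  also have "\<dots> \<le> (\<Sum>n. \<integral>\<^sup>+s. e n * indicator {level (Suc n) powr r<..level n powr r} s \<partial>lborel)"
    using gen_inv_powr_block[OF r True] le[OF True]
    by (intro suminf_le_ennreal nn_integral_mono) (auto split: split_indicator)
  also have "\<dots> = (\<Sum>n. e n * (ennreal (1 - (1/2) powr r) * ennreal (level n powr r)))"
    using r by (simp add: nn_integral_cmult block_length)
  also have "\<dots> \<le> (\<Sum>n. e n * (1 * ennreal (level n powr r)))"
    by (intro suminf_le_ennreal mult_mono) (auto simp: ennreal_le_1)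
  finally show ?thesis by (simp add: mult.commute)
next
  case False
  then have "G d = 0" using nonneg[of d] by linarith
  then show ?thesis by (simp add: nn_integral_mu[OF r H])
qed

end

section \<open>The linear inequality for step functions\<close>

lemma antimono_tail: "sets \<nu> = sets borel \<Longrightarrow> x \<le> y \<Longrightarrow> emeasure \<nu> {y..} \<le> emeasure \<nu> {x..}" for x y :: real
  by (rule emeasure_mono) auto

lemma borel_measurable_antimono_ennreal:
  fixes h :: "real \<Rightarrow> ennreal"
  assumes "\<And>x y. x \<le> y \<Longrightarrow> h y \<le> h x"
  shows "h \<in> borel_measurable borel"
proof (rule borel_measurableI_ge)
  fix y
  have "is_interval {x. y \<le> h x}"
    unfolding is_interval_1 using assms by (auto intro: order_trans)
  then show "{x \<in> space borel. y \<le> h x} \<in> sets borel"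
    by (simp add: real_interval_borel_measurable)
qed

lemma powr_half_less_1: "0 < r \<Longrightarrow> (1/2::real) powr r < 1"
  using powr_less_mono2[of r "1/2" 1] by simp

context scale
begin

text \<open>
  One value per cell.  These functions dominate Hardy transforms, and their integrals are sums
  over the cells.
\<close>

definition cell_step :: "(nat \<Rightarrow> ennreal) \<Rightarrow> real \<Rightarrow> ennreal" where
  "cell_step a t = (\<Sum>n. a n * ennreal (level n) * indicator (cell n) t)"

text \<open>
  A jump by a n * level n at the point where G reaches level n.  These functions are dominated
  by Hardy transforms and, unlike the ones with one value per cell, they are monotone.
\<close>

definition cumul_step :: "(nat \<Rightarrow> ennreal) \<Rightarrow> real \<Rightarrow> ennreal" where
  "cumul_step a t = (\<Sum>n. a n * ennreal (level n) * indicator {t. level n \<le> G t} t)"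

lemma level_powr_Suc: "level n powr r = 2 powr r * level (Suc n) powr r"
  by (subst level_Suc) (simp add: powr_mult)

lemma cell_step_measurable [measurable]: "cell_step a \<in> borel_measurable borel"
  unfolding cell_step_def[abs_def] by measurable

lemma cumul_step_measurable [measurable]: "cumul_step a \<in> borel_measurable borel"
  unfolding cumul_step_def[abs_def] by measurable

lemma suminf_cell: "t \<in> cell n \<Longrightarrow> (\<Sum>m. f m * indicator (cell m) t) = (f n :: ennreal)"
proof -
  assume n: "t \<in> cell n"
  then have "t \<in> cell m \<longleftrightarrow> m = n" for m using cell_unique by blast
  then show ?thesis by (subst suminf_finite[of "{n}"]) auto
qed

lemma cell_step_eq: "t \<in> cell n \<Longrightarrow> cell_step a t = a n * ennreal (level n)"
  unfolding cell_step_def by (rule suminf_cell)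

lemma cell_step_eq_0: "(\<And>n. t \<notin> cell n) \<Longrightarrow> cell_step a t = 0"
  unfolding cell_step_def by simp

lemma cell_step_epowr:
  assumes "0 < s"
  shows "cell_step a t epowr s = (\<Sum>n. (a n * ennreal (level n)) epowr s * indicator (cell n) t)"
proof (cases "\<exists>n. t \<in> cell n")
  case True
  then obtain n where n: "t \<in> cell n" by auto
  then have "(\<Sum>n. (a n * ennreal (level n)) epowr s * indicator (cell n) t) = (a n * ennreal (level n)) epowr s"
    by (rule suminf_cell)
  then show ?thesis using cell_step_eq[OF n] by simp
next
  case False
  then show ?thesis using assms by (simp add: cell_step_eq_0)
qed

lemma cell_step_le_cumul_step: "cell_step a t \<le> cumul_step a t"
  unfolding cell_step_def cumul_step_def
  by (intro suminf_le_ennreal mult_left_mono) (auto simp: indicator_def cell_def)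

lemma cumul_step_mono: "x \<le> y \<Longrightarrow> cumul_step a x \<le> cumul_step a y"
  unfolding cumul_step_def using mono[of x y]
  by (intro suminf_le_ennreal mult_left_mono) (auto simp: indicator_def)

lemma nn_integral_cell_step:
  assumes "0 < s" and [measurable_cong]: "sets \<nu> = sets borel"
  shows "(\<integral>\<^sup>+t. cell_step a t epowr s \<partial>\<nu>) = (\<Sum>n. (a n * ennreal (level n)) epowr s * emeasure \<nu> (cell n))"
proof -
  have "(\<integral>\<^sup>+t. cell_step a t epowr s \<partial>\<nu>) = (\<Sum>n. \<integral>\<^sup>+t. (a n * ennreal (level n)) epowr s * indicator (cell n) t \<partial>\<nu>)"
    unfolding cell_step_epowr[OF assms(1)] by (intro nn_integral_suminf) measurable
  also have "\<dots> = (\<Sum>n. (a n * ennreal (level n)) epowr s * emeasure \<nu> (cell n))"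
    by (subst nn_integral_cmult_indicator) (auto simp: assms)
  finally show ?thesis .
qed

lemma cell_subset: "0 < G d \<Longrightarrow> cell n \<subseteq> {level_pt n..}"
  by (auto simp: cell_def level_pt_le_iff)

lemma cell_empty: "\<not> 0 < G d \<Longrightarrow> cell n = {}"
  using nonneg[of d] by (auto simp: cell_def level_def) (meson nonneg not_less)

lemma emeasure_cell_le:
  assumes "sets \<nu> = sets borel" shows "emeasure \<nu> (cell n) \<le> emeasure \<nu> {level_pt n..}"
  using cell_subset[of n] cell_empty[of n] assms
  by (cases "0 < G d") (auto intro!: emeasure_mono)

text \<open>
  The hypothesis at the point where G reaches level n bounds the weight of the n-th cell, and
  the inclusion of l^p in l^q sums over the cells.
\<close>

lemma cell_step_upper_sup:
  assumes q: "0 < q" "0 < p" "p \<le> q" and \<nu>: "sets \<nu> = sets borel"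
    and A: "\<And>x. x \<in> {c..d} \<Longrightarrow> ennreal (G x) epowr q * emeasure \<nu> {x..} \<le> A"
  shows "(\<integral>\<^sup>+t. cell_step a t epowr q \<partial>\<nu>) \<le> A * (\<Sum>n. a n epowr p) epowr (q / p)"
proof -
  have "(a n * ennreal (level n)) epowr q * emeasure \<nu> (cell n) \<le> A * a n epowr q" for n
  proof (cases "0 < G d")
    case True
    have "ennreal (level n) epowr q * emeasure \<nu> (cell n) \<le> ennreal (G (level_pt n)) epowr q * emeasure \<nu> {level_pt n..}"
      using q level_pt_le_iff[OF True, of n "level_pt n"]
      by (intro mult_mono epowr_mono emeasure_cell_le \<nu>) (auto intro: ennreal_leI)
    also have "\<dots> \<le> A" using level_pt_bounds[OF True, of n] by (intro A) auto
    finally have "a n epowr q * (ennreal (level n) epowr q * emeasure \<nu> (cell n)) \<le> a n epowr q * A"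
      by (rule mult_left_mono) simp
    then show ?thesis using q by (simp add: epowr_mult mult_ac)
  qed (simp add: cell_empty)
  then have "(\<integral>\<^sup>+t. cell_step a t epowr q \<partial>\<nu>) \<le> (\<Sum>n. A * a n epowr q)"
    unfolding nn_integral_cell_step[OF q(1) \<nu>] by (intro suminf_le_ennreal)
  also have "\<dots> \<le> A * (\<Sum>n. a n epowr p) epowr (q / p)"
    using q by (simp add: mult_left_mono suminf_epowr_mono_exponent)
  finally show ?thesis .
qed

text \<open>
  Hoelder's inequality over the cells with exponents p/q and r/q.  The second factor is the sum
  of level(n)^r * tail^(r/q) at the level points, which is a lower sum for the Stieltjes
  integral.
\<close>

lemma cell_step_upper_int:
  assumes q: "0 < q" "q < p" "1 / r = 1 / q - 1 / p" and \<nu>: "sets \<nu> = sets borel"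
  shows "(\<integral>\<^sup>+t. cell_step a t epowr q \<partial>\<nu>) \<le> ennreal ((1 / (1 - (1/2) powr r)) powr (q / r)) *
    (\<integral>\<^sup>+x. emeasure \<nu> {x..} epowr (r / q) \<partial>mu r) epowr (q / r) * (\<Sum>n. a n epowr p) epowr (q / p)"
proof -
  have "1 / p < 1 / q" using q by (simp add: frac_less2)
  then have "0 < 1 / r" using q by simp
  then have r0: "0 < r" by simp
  have "1 / r < 1 / q" using q by simp
  then have rq: "q < r" using r0 q frac_le[of 1 1 r q] by (cases "q < r") auto
  have dual: "1 < p / q" "1 < r / q" "1 / (p / q) + 1 / (r / q) = 1"
    using q r0 rq by (auto simp: field_simps)
  let ?k = "1 - (1/2::real) powr r"
  have k: "0 < ?k" using powr_half_less_1[OF r0] by simp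
  have meas: "(\<lambda>x. emeasure \<nu> {x..} epowr (r / q)) \<in> borel_measurable borel"
    using q r0 by (intro borel_measurable_antimono_ennreal epowr_mono antimono_tail \<nu>) auto
  have "ennreal ?k * (\<Sum>n. ennreal (level n powr r) * emeasure \<nu> {level_pt n..} epowr (r / q)) \<le>
      (\<integral>\<^sup>+x. emeasure \<nu> {x..} epowr (r / q) \<partial>mu r)" (is "_ * ?S \<le> ?I")
    using q r0 meas by (intro nn_integral_mu_lower epowr_mono antimono_tail \<nu>) auto
  then have "ennreal (1 / ?k) * (ennreal ?k * ?S) \<le> ennreal (1 / ?k) * ?I"
    by (rule mult_left_mono) simp
  then have S: "?S \<le> ennreal (1 / ?k) * ?I"
    using k r0 by (simp add: mult.assoc[symmetric] flip: ennreal_mult)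
  have "(\<integral>\<^sup>+t. cell_step a t epowr q \<partial>\<nu>) \<le>
      (\<Sum>n. a n epowr q * (ennreal (level n) epowr q * emeasure \<nu> {level_pt n..}))"
    unfolding nn_integral_cell_step[OF q(1) \<nu>] using q
    by (intro suminf_le_ennreal) (simp add: epowr_mult mult.assoc mult_left_mono emeasure_cell_le \<nu>)
  also have "\<dots> \<le> (\<Sum>n. (a n epowr q) epowr (p / q)) epowr (1 / (p / q)) *
      (\<Sum>n. (ennreal (level n) epowr q * emeasure \<nu> {level_pt n..}) epowr (r / q)) epowr (1 / (r / q))"
    by (rule suminf_Hoelder[OF dual])
  also have "(\<Sum>n. (a n epowr q) epowr (p / q)) epowr (1 / (p / q)) = (\<Sum>n. a n epowr p) epowr (q / p)"
    using q by (simp add: epowr_epowr)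
  also have "(\<Sum>n. (ennreal (level n) epowr q * emeasure \<nu> {level_pt n..}) epowr (r / q)) = ?S"
    using q r0 by (simp add: epowr_mult epowr_epowr epowr_ennreal powr_powr)
  also have "?S epowr (1 / (r / q)) = ?S epowr (q / r)" by simp
  also have "(\<Sum>n. a n epowr p) epowr (q / p) * ?S epowr (q / r) \<le>
      (\<Sum>n. a n epowr p) epowr (q / p) * (ennreal (1 / ?k) * ?I) epowr (q / r)"
    using q r0 S by (intro mult_left_mono epowr_mono) auto
  also have "(ennreal (1 / ?k) * ?I) epowr (q / r) = ennreal ((1 / ?k) powr (q / r)) * ?I epowr (q / r)"
    using q r0 k by (simp add: epowr_mult epowr_ennreal)
  finally show ?thesis by (simp only: mult_ac)
qed

lemma cumul_step_single: "cumul_step (\<lambda>k. if k = n then 1 else 0) t = ennreal (level n) * indicator {t. level n \<le> G t} t"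
  unfolding cumul_step_def by (rule trans[OF suminf_single[of n]]) auto

lemma suminf_single_epowr: "0 < p \<Longrightarrow> (\<Sum>k. (if k = n then 1 else 0) epowr p) = (1::ennreal)"
  by (rule trans[OF suminf_single[of n]]) auto

text \<open>
  The unit sequence at the index of the cell of x: its step function has the height level n
  \<ge> G x / 2 from x on.
\<close>

lemma lower_sup:
  assumes s: "0 < s" "0 < p" and \<nu>: "sets \<nu> = sets borel"
    and bd: "\<And>a. (\<And>n. a n < top) \<Longrightarrow> finite {n. a n \<noteq> 0} \<Longrightarrow>
      (\<integral>\<^sup>+t. cumul_step a t epowr s \<partial>\<nu>) \<le> B * (\<Sum>n. a n epowr p) epowr (s / p)"
  shows "ennreal (G x) epowr s * emeasure \<nu> {x..} \<le> ennreal (2 powr s) * B"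
proof (cases "0 < G x")
  case True
  then obtain n where n: "x \<in> cell n" by (rule ex_cell)
  have "ennreal (G x) epowr s \<le> ennreal (2 * level n) epowr s"
    using n s by (intro epowr_mono ennreal_leI) (auto simp: cell_def)
  also have "\<dots> = ennreal (2 powr s) * ennreal (level n) epowr s"
    using s epowr_ennreal[of 2 s] by (simp add: ennreal_mult epowr_mult)
  finally have "ennreal (G x) epowr s * emeasure \<nu> {x..} \<le> ennreal (2 powr s) * (ennreal (level n) epowr s * emeasure \<nu> {x..})"
    by (simp add: mult_right_mono flip: mult.assoc)
  also have "ennreal (level n) epowr s * emeasure \<nu> {x..} = (\<integral>\<^sup>+t. ennreal (level n) epowr s * indicator {x..} t \<partial>\<nu>)"
    by (subst nn_integral_cmult_indicator) (auto simp: \<nu>)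
  also have "\<dots> \<le> (\<integral>\<^sup>+t. cumul_step (\<lambda>k. if k = n then 1 else 0) t epowr s \<partial>\<nu>)"
    using n mono s by (intro nn_integral_mono) (auto simp: cumul_step_single cell_def indicator_def intro: order_trans)
  also have "\<dots> \<le> B * (\<Sum>k. (if k = n then 1 else 0) epowr p) epowr (s / p)"
    by (rule bd) auto
  finally show ?thesis using s by (simp add: suminf_single_epowr mult_left_mono)
next
  case False
  then have "G x = 0" using nonneg[of x] by linarith
  then show ?thesis using s by simp
qed

text \<open>
  By duality the hypothesis controls the r/s-th powers of the numbers level(n)^s * \<nu>(cell
  n).  The tail from the n-th level point on is the sum of the first n + 1 cells, and level(n)^s
  decays geometrically, so tails instead of cells cost a constant.  The remaining sum is an
  upper sum for the Stieltjes integral, up to a shift of the index by one.  Finiteness of B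
  makes the cells have finite measure, as duality requires.
\<close>

lemma lower_int:
  assumes s: "0 < s" "s < p" "1 / r = 1 / s - 1 / p" and \<nu>: "sets \<nu> = sets borel" and B: "B < top"
    and bd: "\<And>a. (\<And>n. a n < top) \<Longrightarrow> finite {n. a n \<noteq> 0} \<Longrightarrow>
      (\<integral>\<^sup>+t. cumul_step a t epowr s \<partial>\<nu>) \<le> B * (\<Sum>n. a n epowr p) epowr (s / p)"
  shows "(\<integral>\<^sup>+x. emeasure \<nu> {x..} epowr (r / s) \<partial>mu r) \<le>
    ennreal (2 powr r * (1 / (1 - (1/2) powr s)) powr (r / s)) * B epowr (r / s)"
proof -
  have "1 / p < 1 / s" using s by (simp add: frac_less2)
  then have "0 < 1 / r" using s by simp
  then have r0: "0 < r" by simp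
  have "1 / r < 1 / s" using s by simp
  then have rs: "s < r" using r0 s frac_le[of 1 1 r s] by (cases "s < r") auto
  have dual: "1 < p / s" "1 < r / s" "1 / (p / s) + 1 / (r / s) = 1"
    using s r0 rs by (auto simp: field_simps)
  define b where "b n = ennreal (level n) epowr s * emeasure \<nu> (cell n)" for n
  \<comment> \<open>The hypothesis for the sequence \<alpha>^(1/s), restricted to one value per
  cell.\<close>
  have test: "(\<Sum>n. \<alpha> n * b n) \<le> B * (\<Sum>n. \<alpha> n epowr (p / s)) epowr (1 / (p / s))"
    if "\<And>n. \<alpha> n < top" "finite {n. \<alpha> n \<noteq> 0}" for \<alpha>
  proof -
    have "(\<Sum>n. \<alpha> n * b n) = (\<integral>\<^sup>+t. cell_step (\<lambda>n. \<alpha> n epowr (1 / s)) t epowr s \<partial>\<nu>)"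
      using s unfolding nn_integral_cell_step[OF s(1) \<nu>] by (simp add: b_def epowr_mult mult.assoc)
    also have "\<dots> \<le> (\<integral>\<^sup>+t. cumul_step (\<lambda>n. \<alpha> n epowr (1 / s)) t epowr s \<partial>\<nu>)"
      using s by (intro nn_integral_mono epowr_mono cell_step_le_cumul_step)
    also have "\<dots> \<le> B * (\<Sum>n. (\<alpha> n epowr (1 / s)) epowr p) epowr (s / p)"
      using s that by (intro bd) auto
    finally show ?thesis using s by (simp add: epowr_epowr)
  qed
  have "b n < top" for n
  proof -
    have "b n = (\<Sum>k. (if k = n then 1 else 0) * b k)"
      by (subst suminf_finite[of "{n}"]) auto
    also have "\<dots> \<le> B * (\<Sum>k. (if k = n then 1 else 0) epowr (p / s)) epowr (1 / (p / s))"
      by (rule test) auto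
    also have "\<dots> < top" using B s by (simp add: suminf_single_epowr)
    finally show ?thesis .
  qed
  then have sb: "(\<Sum>n. b n epowr (r / s)) \<le> B epowr (r / s)"
    using dual test by (intro suminf_dual_bound[of "p / s"]) auto
  have lev: "ennreal (level n powr r) * emeasure \<nu> {level_pt n..} epowr (r / s) =
      (\<Sum>l. (if l \<le> n then ennreal (((1/2) powr s) ^ (n - l)) else 0) * b l) epowr (r / s)" if pos: "0 < G d" for n
  proof -
    have "emeasure \<nu> {level_pt n..} = (\<Sum>l\<le>n. emeasure \<nu> (cell l))"
      unfolding superlevel_eq_UN_cell[OF pos]
      by (rule sum_emeasure[symmetric]) (use disjoint_cell in \<open>auto simp: \<nu> disjoint_family_on_def\<close>)
    then have "ennreal (level n) epowr s * emeasure \<nu> {level_pt n..} = (\<Sum>l\<le>n. ennreal (level n) epowr s * emeasure \<nu> (cell l))"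
      by (simp add: sum_distrib_left)
    also have "\<dots> = (\<Sum>l\<le>n. ennreal (((1/2) powr s) ^ (n - l)) * b l)"
    proof (intro sum.cong refl)
      fix l assume "l \<in> {..n}"
      then have "level n powr s = ((1/2) powr s) ^ (n - l) * level l powr s"
        using level_pos[OF pos] by (subst level_shift[of l n]) (auto simp: powr_mult powr_power powr_realpow[symmetric] powr_powr mult.commute)
      then show "ennreal (level n) epowr s * emeasure \<nu> (cell l) = ennreal (((1/2) powr s) ^ (n - l)) * b l"
        using s by (simp add: b_def epowr_ennreal ennreal_mult mult.assoc)
    qed
    also have "\<dots> = (\<Sum>l. (if l \<le> n then ennreal (((1/2) powr s) ^ (n - l)) else 0) * b l)"
      by (subst suminf_finite[of "{..n}"]) auto
    finally have "(ennreal (level n) epowr s * emeasure \<nu> {level_pt n..}) epowr (r / s) =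
      (\<Sum>l. (if l \<le> n then ennreal (((1/2) powr s) ^ (n - l)) else 0) * b l) epowr (r / s)" by simp
    then show ?thesis using s r0 by (simp add: epowr_mult epowr_epowr epowr_ennreal powr_powr)
  qed
  have levs: "(\<Sum>n. ennreal (level n powr r) * emeasure \<nu> {level_pt n..} epowr (r / s)) \<le>
      ennreal ((1 / (1 - (1/2) powr s)) powr (r / s)) * B epowr (r / s)"
  proof (cases "0 < G d")
    case True
    have "(\<Sum>n. ennreal (level n powr r) * emeasure \<nu> {level_pt n..} epowr (r / s)) =
       (\<Sum>n. (\<Sum>l. (if l \<le> n then ennreal (((1/2) powr s) ^ (n - l)) else 0) * b l) epowr (r / s))"
      by (simp add: lev[OF True])
    also have "\<dots> \<le> ennreal (1 / (1 - (1/2) powr s)) epowr (r / s) * (\<Sum>n. b n epowr (r / s))"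
      using powr_half_less_1[OF s(1)] dual by (intro suminf_geometric_tail_le) auto
    also have "\<dots> \<le> ennreal (1 / (1 - (1/2) powr s)) epowr (r / s) * B epowr (r / s)"
      by (rule mult_left_mono[OF sb]) simp
    finally show ?thesis using powr_half_less_1[OF s(1)] s r0 by (simp add: epowr_ennreal)
  next
    case False
    then have "G d = 0" using nonneg[of d] by linarith
    then show ?thesis by (simp add: level_def)
  qed
  have meas: "(\<lambda>x. emeasure \<nu> {x..} epowr (r / s)) \<in> borel_measurable borel"
    using s r0 by (intro borel_measurable_antimono_ennreal epowr_mono antimono_tail \<nu>) auto
  have "(\<integral>\<^sup>+x. emeasure \<nu> {x..} epowr (r / s) \<partial>mu r) \<le>
      (\<Sum>n. ennreal (level n powr r) * emeasure \<nu> {level_pt (Suc n)..} epowr (r / s))"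
    using s r0 meas by (intro nn_integral_mu_upper epowr_mono antimono_tail \<nu>) auto
  also have "\<dots> = (\<Sum>n. ennreal (2 powr r) * (ennreal (level (Suc n) powr r) * emeasure \<nu> {level_pt (Suc n)..} epowr (r / s)))"
    by (intro suminf_cong) (subst level_powr_Suc, simp add: ennreal_mult mult.assoc)
  also have "\<dots> = ennreal (2 powr r) * (\<Sum>n. ennreal (level (Suc n) powr r) * emeasure \<nu> {level_pt (Suc n)..} epowr (r / s))"
    by (rule ennreal_suminf_cmult)
  also have "\<dots> \<le> ennreal (2 powr r) * (ennreal ((1 / (1 - (1/2) powr s)) powr (r / s)) * B epowr (r / s))"
    by (rule mult_left_mono[OF order_trans[OF suminf_Suc_le levs]]) simp
  also have "\<dots> = ennreal (2 powr r * (1 / (1 - (1/2) powr s)) powr (r / s)) * B epowr (r / s)"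
    by (subst ennreal_mult) (simp_all add: mult.assoc)
  finally show ?thesis .
qed

end

section \<open>Two scales: one sequence at a time\<close>

locale two_scales = A: scale G1 c d + B: scale G2 c d
  for G1 G2 :: "real \<Rightarrow> real" and c d :: real +
  fixes \<nu> :: "real measure"
  assumes sets_nu [simp, measurable_cong]: "sets \<nu> = sets borel"
begin

lemma swap: "two_scales G2 G1 c d \<nu>"
  by unfold_locales auto

definition tail :: "real \<Rightarrow> ennreal" where "tail x = emeasure \<nu> {x..}"

lemma tail_antimono: "x \<le> y \<Longrightarrow> tail y \<le> tail x"
  unfolding tail_def by (intro antimono_tail) simp

lemma tail_measurable [measurable]: "tail \<in> borel_measurable borel"
  by (intro borel_measurable_antimono_ennreal tail_antimono)

text \<open>
  Only finite sequences with finite entries are tested.  Then all sums are finite, and at a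
  point that is not a level point the step function takes its value already a little to the
  left.
\<close>

definition bilinear_bound :: "real \<Rightarrow> real \<Rightarrow> real \<Rightarrow> ennreal \<Rightarrow> bool" where
  "bilinear_bound q p1 p2 B \<longleftrightarrow>
    (\<forall>a b. (\<forall>n. a n < top) \<longrightarrow> finite {n. a n \<noteq> 0} \<longrightarrow> (\<forall>n. b n < top) \<longrightarrow> finite {n. b n \<noteq> 0} \<longrightarrow>
      (\<integral>\<^sup>+t. A.cumul_step a t epowr q * B.cumul_step b t epowr q \<partial>\<nu>)
        \<le> B * (\<Sum>n. a n epowr p1) epowr (q / p1) * (\<Sum>n. b n epowr p2) epowr (q / p2))"

lemma bilinear_boundD:
  assumes "bilinear_bound q p1 p2 B" "\<And>n. a n < top" "finite {n. a n \<noteq> 0}" "\<And>n. b n < top" "finite {n. b n \<noteq> 0}"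
  shows "(\<integral>\<^sup>+t. A.cumul_step a t epowr q * B.cumul_step b t epowr q \<partial>\<nu>)
        \<le> B * (\<Sum>n. a n epowr p1) epowr (q / p1) * (\<Sum>n. b n epowr p2) epowr (q / p2)"
  using assms unfolding bilinear_bound_def by blast

lemma bilinear_bound_swap:
  assumes "bilinear_bound q p1 p2 B" shows "two_scales.bilinear_bound G2 G1 d \<nu> q p2 p1 B"
  unfolding two_scales.bilinear_bound_def[OF swap]
proof (intro allI impI)
  fix a b :: "nat \<Rightarrow> ennreal"
  assume "\<forall>n. a n < top" "finite {n. a n \<noteq> 0}" "\<forall>n. b n < top" "finite {n. b n \<noteq> 0}"
  then show "(\<integral>\<^sup>+t. B.cumul_step a t epowr q * A.cumul_step b t epowr q \<partial>\<nu>)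
        \<le> B * (\<Sum>n. a n epowr p2) epowr (q / p2) * (\<Sum>n. b n epowr p1) epowr (q / p1)"
    using bilinear_boundD[OF assms, of b a] by (simp add: mult_ac)
qed

text \<open>
  With k = G1(x)^q this is, up to a factor, the output measure seen by the second sequence when
  the first one is a unit sequence located at x.
\<close>

definition cut :: "real \<Rightarrow> ennreal \<Rightarrow> real measure" where
  "cut x k = density \<nu> (\<lambda>t. k * indicator {x..} t)"

lemma sets_cut [simp, measurable_cong]: "sets (cut x k) = sets borel" by (simp add: cut_def)

lemma nn_integral_cut:
  assumes [measurable]: "h \<in> borel_measurable borel"
  shows "(\<integral>\<^sup>+t. h t \<partial>cut x k) = k * (\<integral>\<^sup>+t. h t * indicator {x..} t \<partial>\<nu>)"
  unfolding cut_def by (simp add: nn_integral_density nn_integral_cmult[symmetric] mult_ac)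

lemma emeasure_cut: "emeasure (cut x k) {z..} = k * tail (max x z)"
proof -
  have "emeasure (cut x k) {z..} = (\<integral>\<^sup>+t. indicator {z..} t \<partial>cut x k)" by simp
  also have "\<dots> = k * (\<integral>\<^sup>+t. indicator {z..} t * indicator {x..} t \<partial>\<nu>)"
    by (rule nn_integral_cut) simp
  also have "(\<integral>\<^sup>+t. indicator {z..} t * indicator {x..} t \<partial>\<nu>) = (\<integral>\<^sup>+t. indicator {max x z..} t \<partial>\<nu>)"
    by (intro nn_integral_cong) (auto simp: indicator_def)
  finally show ?thesis by (simp add: tail_def)
qed

text \<open>
  The linear lower bound in the first sequence, with the second one absorbed into the measure.
\<close>

lemma bilinear_bound_row:
  assumes q: "0 < q" "0 < p1" "0 < p2" and bd: "bilinear_bound q p1 p2 B"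
    and b: "\<And>n. b n < top" "finite {n. b n \<noteq> 0}"
  shows "(\<integral>\<^sup>+t. B.cumul_step b t epowr q \<partial>cut x (ennreal (G1 x) epowr q))
    \<le> ennreal (2 powr q) * B * (\<Sum>n. b n epowr p2) epowr (q / p2)"
proof -
  define \<nu>' where "\<nu>' = density \<nu> (\<lambda>t. B.cumul_step b t epowr q)"
  have [simp, measurable_cong]: "sets \<nu>' = sets borel" by (simp add: \<nu>'_def)
  have "ennreal (G1 x) epowr q * emeasure \<nu>' {x..} \<le>
      ennreal (2 powr q) * (B * (\<Sum>n. b n epowr p2) epowr (q / p2))"
  proof (rule A.lower_sup[OF q(1,2)])
    fix a :: "nat \<Rightarrow> ennreal" assume a: "\<And>n. a n < top" "finite {n. a n \<noteq> 0}"
    have "(\<integral>\<^sup>+t. A.cumul_step a t epowr q \<partial>\<nu>') = (\<integral>\<^sup>+t. A.cumul_step a t epowr q * B.cumul_step b t epowr q \<partial>\<nu>)"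
      by (simp add: \<nu>'_def nn_integral_density mult_ac)
    also have "\<dots> \<le> B * (\<Sum>n. a n epowr p1) epowr (q / p1) * (\<Sum>n. b n epowr p2) epowr (q / p2)"
      by (rule bilinear_boundD[OF bd a b])
    finally show "(\<integral>\<^sup>+t. A.cumul_step a t epowr q \<partial>\<nu>') \<le>
        B * (\<Sum>n. b n epowr p2) epowr (q / p2) * (\<Sum>n. a n epowr p1) epowr (q / p1)"
      by (simp only: mult_ac)
  qed simp
  moreover have "emeasure \<nu>' {x..} = (\<integral>\<^sup>+t. B.cumul_step b t epowr q * indicator {x..} t \<partial>\<nu>)"
    by (simp add: \<nu>'_def emeasure_density)
  ultimately show ?thesis by (simp add: nn_integral_cut mult.assoc)
qed

lemma necessary_sup:
  assumes q: "0 < q" "0 < p1" "0 < p2" and bd: "bilinear_bound q p1 p2 B"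
  shows "(ennreal (G1 x) * ennreal (G2 x)) epowr q * tail x \<le> ennreal (2 powr q * 2 powr q) * B"
proof -
  have "ennreal (G2 x) epowr q * emeasure (cut x (ennreal (G1 x) epowr q)) {x..} \<le> ennreal (2 powr q) * (ennreal (2 powr q) * B)"
    by (rule B.lower_sup[OF q(1,3)]) (auto intro: bilinear_bound_row[OF q bd])
  then show ?thesis using q by (simp add: emeasure_cut epowr_mult mult_ac ennreal_mult)
qed

text \<open>
  The linear lower bound once more, for the measure cut at x: its tail from t on is G1(x)^q
  times the tail from max x t on.
\<close>

lemma necessary_hat:
  assumes q: "0 < q" "0 < p1" "q < p2" "1 / r = 1 / q - 1 / p2" and r: "0 < r" and bd: "bilinear_bound q p1 p2 B" and B: "B < top"
  shows "ennreal (G1 x) epowr r * (\<integral>\<^sup>+t. tail (max x t) epowr (r / q) \<partial>B.mu r) \<le>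
    ennreal (2 powr r * (1 / (1 - (1/2) powr q)) powr (r / q) * 2 powr r) * B epowr (r / q)"
proof -
  have p2: "0 < p2" using q by simp
  have "(\<integral>\<^sup>+t. emeasure (cut x (ennreal (G1 x) epowr q)) {t..} epowr (r / q) \<partial>B.mu r) \<le>
    ennreal (2 powr r * (1 / (1 - (1/2) powr q)) powr (r / q)) * (ennreal (2 powr q) * B) epowr (r / q)"
    by (rule B.lower_int[OF q(1,3,4)])
      (use B in \<open>auto intro: bilinear_bound_row[OF q(1,2) p2 bd] simp: ennreal_mult_less_top\<close>)
  also have "(\<integral>\<^sup>+t. emeasure (cut x (ennreal (G1 x) epowr q)) {t..} epowr (r / q) \<partial>B.mu r) =
     ennreal (G1 x) epowr r * (\<integral>\<^sup>+t. tail (max x t) epowr (r / q) \<partial>B.mu r)"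
    unfolding emeasure_cut using q r by (simp add: epowr_mult epowr_epowr nn_integral_cmult)
  also have "(ennreal (2 powr q) * B) epowr (r / q) = ennreal (2 powr r) * B epowr (r / q)"
    using q r by (simp add: epowr_mult epowr_ennreal powr_powr)
  finally show ?thesis by (simp add: mult.assoc ennreal_mult)
qed

text \<open>
  The inner integral of the characteristics in which both exponents exceed q: tail^(r/q)
  integrated against the Stieltjes measure of the second scale, over a set S that is a closed or
  open half-line.
\<close>

definition tail_mu :: "real \<Rightarrow> real \<Rightarrow> real set \<Rightarrow> ennreal" where
  "tail_mu q r S = (\<integral>\<^sup>+t. tail t epowr (r / q) * indicator S t \<partial>B.mu r)"

lemma tail_mu_mono: "S \<subseteq> S' \<Longrightarrow> tail_mu q r S \<le> tail_mu q r S'"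
  unfolding tail_mu_def by (intro nn_integral_mono mult_left_mono) (auto simp: indicator_def)

text \<open>
  The two integrands agree on [x,\<infinity>).  So the condition that is sharp for p1 \<le> q is
  necessary for all exponents and implies the weaker one for q < p1.
\<close>

lemma tail_mu_le_hat:
  assumes "0 < q" "0 < r" shows "tail_mu q r {x..} \<le> (\<integral>\<^sup>+t. tail (max x t) epowr (r / q) \<partial>B.mu r)"
  unfolding tail_mu_def using assms by (intro nn_integral_mono) (auto simp: indicator_def max_def)

text \<open>
  The linear lower bound is used twice.  For fixed a it is applied in b, to \<nu> weighted by
  the q-th power of the step function of a.  This step function is nondecreasing, so it may be
  moved out of the tail at the cost of an inequality.  The result is a linear inequality for a
  with exponent r in place of q, and a second application gives the exponent \<kappa>.
\<close>

lemma necessary_int: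
  assumes q: "0 < q" "q < p1" "q < p2" and r: "1 / r = 1 / q - 1 / p2" "0 < r" "r < p1"
    and \<kappa>: "1 / \<kappa> = 1 / r - 1 / p1" "0 < \<kappa>"
    and bd: "bilinear_bound q p1 p2 B" and B: "B < top"
  shows "(\<integral>\<^sup>+x. tail_mu q r {x..} epowr (\<kappa> / r) \<partial>A.mu \<kappa>) \<le>
    ennreal (2 powr \<kappa> * (1 / (1 - (1/2) powr r)) powr (\<kappa> / r) *
      (2 powr r * (1 / (1 - (1/2) powr q)) powr (r / q)) powr (\<kappa> / r)) * B epowr (\<kappa> / q)"
proof -
  let ?K = "2 powr r * (1 / (1 - (1/2::real) powr q)) powr (r / q)"
  have kq: "0 < (1/2::real) powr q" "(1/2::real) powr q < 1" using powr_half_less_1[OF q(1)] by auto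
  have K: "0 < ?K" using kq by (intro mult_pos_pos) auto
  define \<rho> where "\<rho> = density (B.mu r) (\<lambda>t. tail t epowr (r / q))"
  have [simp, measurable_cong]: "sets \<rho> = sets borel" by (simp add: \<rho>_def)
  have \<rho>: "emeasure \<rho> {x..} = tail_mu q r {x..}" for x
    by (simp add: \<rho>_def emeasure_density tail_mu_def)
  have main: "(\<integral>\<^sup>+t. A.cumul_step a t epowr r \<partial>\<rho>) \<le> (ennreal ?K * B epowr (r / q)) * (\<Sum>n. a n epowr p1) epowr (r / p1)"
    if a: "\<And>n. a n < top" "finite {n. a n \<noteq> 0}" for a
  proof -
    define \<nu>' where "\<nu>' = density \<nu> (\<lambda>t. A.cumul_step a t epowr q)"
    have [simp, measurable_cong]: "sets \<nu>' = sets borel" by (simp add: \<nu>'_def)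
    let ?S = "(\<Sum>n. a n epowr p1)"
    have S: "?S < top"
    proof -
      have "?S = (\<Sum>n\<in>{n. a n \<noteq> 0}. a n epowr p1)" using q that by (intro suminf_finite) auto
      also have "\<dots> < top" using that q by (auto simp: less_top)
      finally show ?thesis .
    qed
    have "(\<integral>\<^sup>+t. A.cumul_step a t epowr r \<partial>\<rho>) = (\<integral>\<^sup>+t. (A.cumul_step a t epowr q * tail t) epowr (r / q) \<partial>B.mu r)"
      using q r by (simp add: \<rho>_def nn_integral_density epowr_mult epowr_epowr mult.commute)
    also have "\<dots> \<le> (\<integral>\<^sup>+t. emeasure \<nu>' {t..} epowr (r / q) \<partial>B.mu r)"
    proof (intro nn_integral_mono epowr_mono)
      fix t
      have "A.cumul_step a t epowr q * tail t = (\<integral>\<^sup>+s. A.cumul_step a t epowr q * indicator {t..} s \<partial>\<nu>)"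
        by (subst nn_integral_cmult_indicator) (auto simp: tail_def)
      also have "\<dots> \<le> (\<integral>\<^sup>+s. A.cumul_step a s epowr q * indicator {t..} s \<partial>\<nu>)"
        using q by (intro nn_integral_mono) (auto simp: indicator_def intro: A.cumul_step_mono)
      also have "\<dots> = emeasure \<nu>' {t..}" by (simp add: \<nu>'_def emeasure_density)
      finally show "A.cumul_step a t epowr q * tail t \<le> emeasure \<nu>' {t..}" .
    qed (use q r in auto)
    also have "\<dots> \<le> ennreal ?K * (B * ?S epowr (q / p1)) epowr (r / q)"
    proof (rule B.lower_int[OF q(1,3) r(1)])
      show "B * ?S epowr (q / p1) < top" using B S q by (simp add: ennreal_mult_less_top)
      fix b :: "nat \<Rightarrow> ennreal" assume b: "\<And>n. b n < top" "finite {n. b n \<noteq> 0}"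
      have "(\<integral>\<^sup>+t. B.cumul_step b t epowr q \<partial>\<nu>') = (\<integral>\<^sup>+t. A.cumul_step a t epowr q * B.cumul_step b t epowr q \<partial>\<nu>)"
        by (simp add: \<nu>'_def nn_integral_density)
      then show "(\<integral>\<^sup>+t. B.cumul_step b t epowr q \<partial>\<nu>') \<le> B * ?S epowr (q / p1) * (\<Sum>n. b n epowr p2) epowr (q / p2)"
        using bilinear_boundD[OF bd a b] by simp
    qed simp
    also have "\<dots> = (ennreal ?K * B epowr (r / q)) * ?S epowr (r / p1)"
      using q r by (simp add: epowr_mult epowr_epowr mult.assoc)
    finally show ?thesis .
  qed
  have "(\<integral>\<^sup>+x. emeasure \<rho> {x..} epowr (\<kappa> / r) \<partial>A.mu \<kappa>) \<le>
    ennreal (2 powr \<kappa> * (1 / (1 - (1/2) powr r)) powr (\<kappa> / r)) * (ennreal ?K * B epowr (r / q)) epowr (\<kappa> / r)"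
    by (rule A.lower_int[OF r(2,3) \<kappa>(1)]) (use B q r main in \<open>auto simp: ennreal_mult_less_top\<close>)
  also have "(ennreal ?K * B epowr (r / q)) epowr (\<kappa> / r) = ennreal (?K powr (\<kappa> / r)) * B epowr (\<kappa> / q)"
    using K q r \<kappa> by (simp only: epowr_mult epowr_ennreal less_imp_le divide_pos_pos) (simp add: epowr_epowr)
  finally show ?thesis unfolding \<rho> using K by (simp add: mult.assoc ennreal_mult)
qed

text \<open>
  If p2 \<le> q, the linear upper bound in the second sequence reduces the bilinear inequality
  to linear ones in the first sequence, one for every cut measure.
\<close>

lemma iterate_upper:
  assumes q: "0 < q" "0 < p2" "p2 \<le> q"
    and rows: "\<And>x. x \<in> {c..d} \<Longrightarrow> (\<integral>\<^sup>+t. A.cell_step a t epowr q \<partial>cut x (ennreal (G2 x) epowr q)) \<le> M"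
  shows "(\<integral>\<^sup>+t. A.cell_step a t epowr q * B.cell_step b t epowr q \<partial>\<nu>) \<le> M * (\<Sum>n. b n epowr p2) epowr (q / p2)"
proof -
  define \<nu>' where "\<nu>' = density \<nu> (\<lambda>t. A.cell_step a t epowr q)"
  have [simp, measurable_cong]: "sets \<nu>' = sets borel" by (simp add: \<nu>'_def)
  have "(\<integral>\<^sup>+t. A.cell_step a t epowr q * B.cell_step b t epowr q \<partial>\<nu>) = (\<integral>\<^sup>+t. B.cell_step b t epowr q \<partial>\<nu>')"
    by (simp add: \<nu>'_def nn_integral_density)
  also have "\<dots> \<le> M * (\<Sum>n. b n epowr p2) epowr (q / p2)"
  proof (rule B.cell_step_upper_sup[OF q])
    fix x assume "x \<in> {c..d}"
    then show "ennreal (G2 x) epowr q * emeasure \<nu>' {x..} \<le> M"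
      using rows[of x] by (simp add: \<nu>'_def emeasure_density nn_integral_cut)
  qed simp
  finally show ?thesis .
qed

lemma sufficient_sup:
  assumes q: "0 < q" "0 < p1" "p1 \<le> q" "0 < p2" "p2 \<le> q"
    and A: "\<And>x. x \<in> {c..d} \<Longrightarrow> (ennreal (G1 x) * ennreal (G2 x)) epowr q * tail x \<le> M"
  shows "(\<integral>\<^sup>+t. A.cell_step a t epowr q * B.cell_step b t epowr q \<partial>\<nu>) \<le>
    M * (\<Sum>n. a n epowr p1) epowr (q / p1) * (\<Sum>n. b n epowr p2) epowr (q / p2)"
proof (rule iterate_upper[OF q(1,4,5)])
  fix x assume x: "x \<in> {c..d}"
  show "(\<integral>\<^sup>+t. A.cell_step a t epowr q \<partial>cut x (ennreal (G2 x) epowr q)) \<le> M * (\<Sum>n. a n epowr p1) epowr (q / p1)"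
  proof (rule A.cell_step_upper_sup[OF q(1-3)])
    fix z assume z: "z \<in> {c..d}"
    let ?w = "max x z"
    have "ennreal (G1 z) epowr q * emeasure (cut x (ennreal (G2 x) epowr q)) {z..} =
        (ennreal (G1 z) * ennreal (G2 x)) epowr q * tail ?w"
      using q by (simp add: emeasure_cut epowr_mult mult.assoc)
    also have "\<dots> \<le> (ennreal (G1 ?w) * ennreal (G2 ?w)) epowr q * tail ?w"
      using q by (intro mult_right_mono epowr_mono mult_mono ennreal_leI A.mono B.mono) auto
    also have "\<dots> \<le> M" using x z by (intro A) auto
    finally show "ennreal (G1 z) epowr q * emeasure (cut x (ennreal (G2 x) epowr q)) {z..} \<le> M" .
  qed simp
qed

lemma sufficient_hat:
  assumes q: "0 < q" "q < p1" "1 / r = 1 / q - 1 / p1" "0 < p2" "p2 \<le> q" and r: "0 < r"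
    and A: "\<And>x. x \<in> {c..d} \<Longrightarrow> ennreal (G2 x) * (\<integral>\<^sup>+t. tail (max x t) epowr (r / q) \<partial>A.mu r) epowr (1 / r) \<le> M"
  shows "(\<integral>\<^sup>+t. A.cell_step a t epowr q * B.cell_step b t epowr q \<partial>\<nu>) \<le>
    ennreal ((1 / (1 - (1/2) powr r)) powr (q / r)) * M epowr q *
      (\<Sum>n. a n epowr p1) epowr (q / p1) * (\<Sum>n. b n epowr p2) epowr (q / p2)"
proof (rule iterate_upper[OF q(1,4,5)])
  fix x assume x: "x \<in> {c..d}"
  have "(\<integral>\<^sup>+t. A.cell_step a t epowr q \<partial>cut x (ennreal (G2 x) epowr q)) \<le>
      ennreal ((1 / (1 - (1/2) powr r)) powr (q / r)) *
      (\<integral>\<^sup>+z. emeasure (cut x (ennreal (G2 x) epowr q)) {z..} epowr (r / q) \<partial>A.mu r) epowr (q / r) *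
      (\<Sum>n. a n epowr p1) epowr (q / p1)"
    by (rule A.cell_step_upper_int[OF q(1-3)]) simp
  also have "(\<integral>\<^sup>+z. emeasure (cut x (ennreal (G2 x) epowr q)) {z..} epowr (r / q) \<partial>A.mu r) =
      ennreal (G2 x) epowr r * (\<integral>\<^sup>+t. tail (max x t) epowr (r / q) \<partial>A.mu r)"
    unfolding emeasure_cut using q r by (simp add: epowr_mult epowr_epowr nn_integral_cmult)
  also have "\<dots> epowr (q / r) = (ennreal (G2 x) * (\<integral>\<^sup>+t. tail (max x t) epowr (r / q) \<partial>A.mu r) epowr (1 / r)) epowr q"
    using q(1) r by (simp add: epowr_mult epowr_epowr)
  finally have "(\<integral>\<^sup>+t. A.cell_step a t epowr q \<partial>cut x (ennreal (G2 x) epowr q)) \<le>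
      ennreal ((1 / (1 - (1/2) powr r)) powr (q / r)) *
      (ennreal (G2 x) * (\<integral>\<^sup>+t. tail (max x t) epowr (r / q) \<partial>A.mu r) epowr (1 / r)) epowr q *
      (\<Sum>n. a n epowr p1) epowr (q / p1)" .
  also have "\<dots> \<le> ennreal ((1 / (1 - (1/2) powr r)) powr (q / r)) * M epowr q * (\<Sum>n. a n epowr p1) epowr (q / p1)"
    using q by (intro mult_right_mono mult_left_mono epowr_mono A x) auto
  finally show "(\<integral>\<^sup>+t. A.cell_step a t epowr q \<partial>cut x (ennreal (G2 x) epowr q)) \<le>
    ennreal ((1 / (1 - (1/2) powr r)) powr (q / r)) * M epowr q * (\<Sum>n. a n epowr p1) epowr (q / p1)" .
qed

end

section \<open>Two scales: the staircase of cells\<close>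

context scale
begin

text \<open>
  The shift of the index by one only costs a factor 2^\<kappa>, and without the shift this is a
  lower sum.
\<close>

lemma suminf_level_shift_le:
  assumes \<kappa>: "0 < \<kappa>" and T: "\<And>x y. x \<le> y \<Longrightarrow> T y \<le> T x"
  shows "(\<Sum>j. ennreal (level j powr \<kappa>) * T (level_pt (Suc j))) \<le>
    ennreal (2 powr \<kappa> / (1 - (1/2) powr \<kappa>)) * (\<integral>\<^sup>+x. T x \<partial>mu \<kappa>)"
proof -
  let ?c = "1 - (1/2::real) powr \<kappa>"
  have c: "0 < ?c" using powr_half_less_1[OF \<kappa>] by simp
  have "ennreal ?c * (\<Sum>j. ennreal (level j powr \<kappa>) * T (level_pt j)) \<le> (\<integral>\<^sup>+x. T x \<partial>mu \<kappa>)"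
    using \<kappa> T by (intro nn_integral_mu_lower borel_measurable_antimono_ennreal) auto
  then have "ennreal (1 / ?c) * (ennreal ?c * (\<Sum>j. ennreal (level j powr \<kappa>) * T (level_pt j))) \<le> ennreal (1 / ?c) * (\<integral>\<^sup>+x. T x \<partial>mu \<kappa>)"
    by (rule mult_left_mono) simp
  then have le: "(\<Sum>j. ennreal (level j powr \<kappa>) * T (level_pt j)) \<le> ennreal (1 / ?c) * (\<integral>\<^sup>+x. T x \<partial>mu \<kappa>)"
    using c \<kappa> by (simp add: mult.assoc[symmetric] flip: ennreal_mult)
  have "(\<Sum>j. ennreal (level j powr \<kappa>) * T (level_pt (Suc j))) = (\<Sum>j. ennreal (2 powr \<kappa>) * (ennreal (level (Suc j) powr \<kappa>) * T (level_pt (Suc j))))"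
    by (intro suminf_cong) (subst level_powr_Suc, simp add: ennreal_mult mult.assoc)
  also have "\<dots> = ennreal (2 powr \<kappa>) * (\<Sum>j. ennreal (level (Suc j) powr \<kappa>) * T (level_pt (Suc j)))"
    by (rule ennreal_suminf_cmult)
  also have "\<dots> \<le> ennreal (2 powr \<kappa>) * (ennreal (1 / ?c) * (\<integral>\<^sup>+x. T x \<partial>mu \<kappa>))"
    by (rule mult_left_mono[OF order_trans[OF suminf_Suc_le le]]) simp
  also have "\<dots> = ennreal (2 powr \<kappa> / ?c) * (\<integral>\<^sup>+x. T x \<partial>mu \<kappa>)"
    using c by (simp add: mult.assoc[symmetric] flip: ennreal_mult)
  finally show ?thesis .
qed

lemma suminf_cell_indicator_le: "(\<Sum>j. indicator (cell j) w) \<le> (1 :: ennreal)"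
proof (cases "\<exists>n. w \<in> cell n")
  case True
  then obtain n where "w \<in> cell n" by auto
  from suminf_cell[OF this, of "\<lambda>_. 1"] show ?thesis by simp
qed simp

end

context two_scales
begin

text \<open>
  Let w be the point where the second scale reaches level k + 1.  It lies left of the cell k,
  which meets the cell j of the first scale, so G1(w) < 2 * level j; and the relation says G1(w)
  \<ge> level (j + 1).  Hence w belongs to the cell j or to the cell j + 1.
\<close>

lemma row_multiplicity:
  assumes R: "\<And>j. R j \<Longrightarrow> A.cell j \<inter> B.cell k \<noteq> {} \<and> A.level_pt (Suc j) \<le> B.level_pt (Suc k)"
  shows "(\<Sum>j. if R j then 1 else 0) \<le> (2 :: ennreal)"
proof -
  let ?w = "B.level_pt (Suc k)"
  have "(if R j then 1 else 0) \<le> indicator (A.cell j) ?w + (indicator (A.cell (Suc j)) ?w :: ennreal)" for j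
  proof (cases "R j")
    case True
    then obtain t where t: "t \<in> A.cell j" "t \<in> B.cell k" and le: "A.level_pt (Suc j) \<le> ?w" using R by blast
    have pos: "0 < G1 d" "0 < G2 d" using t A.cell_empty B.cell_empty by auto
    have "A.level (Suc j) \<le> G1 ?w" using le A.level_pt_le_iff[OF pos(1)] by simp
    moreover have "?w \<le> t"
      using t(2) B.level_pt_le_iff[OF pos(2)] B.level_antimono[of k "Suc k"] by (auto simp: B.cell_def)
    then have "G1 ?w < 2 * A.level j" using A.mono[of ?w t] t(1) by (auto simp: A.cell_def)
    ultimately have "?w \<in> A.cell j \<or> ?w \<in> A.cell (Suc j)"
      using A.level_Suc[of j] by (auto simp: A.cell_def)
    then show ?thesis by (auto simp: indicator_def)
  qed simp
  then have "(\<Sum>j. if R j then 1 else 0) \<le> (\<Sum>j. indicator (A.cell j) ?w + (indicator (A.cell (Suc j)) ?w :: ennreal))"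
    by (rule suminf_le_ennreal)
  also have "\<dots> = (\<Sum>j. indicator (A.cell j) ?w) + (\<Sum>j. indicator (A.cell (Suc j)) ?w)"
    by (rule suminf_add[symmetric]) auto
  also have "\<dots> \<le> 1 + 1"
    by (intro add_mono A.suminf_cell_indicator_le order_trans[OF suminf_Suc_le A.suminf_cell_indicator_le])
  finally show ?thesis by simp
qed

text \<open>
  Hoelder's inequality with exponents r/q and p2/q, first over k in the row of each j and then
  over j.  The r/q-th powers of level(k)^q times the measures in row j add up to a lower sum for
  tail_mu over S j, because S j contains everything from the level point k + 1 on.  The powers
  of b are counted at most twice by the preceding lemma.
\<close>

lemma rows_upper:
  assumes q: "0 < q" "q < p2" "1 / r = 1 / q - 1 / p2" and r: "0 < r"
    and R: "\<And>j k. R j k \<Longrightarrow> A.cell j \<inter> B.cell k \<noteq> {} \<and> A.level_pt (Suc j) \<le> B.level_pt (Suc k) \<and> {B.level_pt (Suc k)..} \<subseteq> S j"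
    and S [measurable]: "\<And>j. S j \<in> sets borel"
  shows "(\<Sum>j. \<Sum>k. if R j k then (a j * ennreal (A.level j)) epowr q * ((b k * ennreal (B.level k)) epowr q *
        emeasure \<nu> (A.cell j \<inter> B.cell k)) else 0) \<le>
    ennreal ((1 / (1 - (1/2) powr r)) powr (q / r) * 2 powr (q / p2)) *
    (\<Sum>j. (a j * ennreal (A.level j)) epowr r * tail_mu q r (S j)) epowr (q / r) *
    (\<Sum>k. b k epowr p2) epowr (q / p2)"
proof -
  have "1 / r < 1 / q" using q by simp
  then have rq: "q < r" using r q frac_le[of 1 1 r q] by (cases "q < r") auto
  have dual: "1 < p2 / q" "1 < r / q" "1 / (r / q) + 1 / (p2 / q) = 1"
    using q r rq by (auto simp: field_simps)
  let ?c = "1 - (1/2::real) powr r"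
  have c: "0 < ?c" using powr_half_less_1[OF r] by simp
  let ?al = "\<lambda>j. a j * ennreal (A.level j)"
  define m where "m j k = ennreal (B.level k) epowr q * emeasure \<nu> (A.cell j \<inter> B.cell k)" for j k
  define z where "z j = (\<Sum>k. if R j k then b k epowr p2 else 0)" for j
  define Q where "Q j = ennreal (1 / ?c) * tail_mu q r (S j)" for j
  have mQ: "(\<Sum>k. (if R j k then m j k else 0) epowr (r / q)) \<le> Q j" for j
  proof -
    have "ennreal ?c * (\<Sum>k. ennreal (B.level k powr r) * (if R j k then tail (B.level_pt k) epowr (r / q) else 0)) \<le> tail_mu q r (S j)"
      unfolding tail_mu_def
    proof (rule B.nn_integral_mu_lower[OF r])
      fix k t assume t: "B.level_pt (Suc k) \<le> t" "t \<le> B.level_pt k"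
      show "(if R j k then tail (B.level_pt k) epowr (r / q) else 0) \<le> tail t epowr (r / q) * indicator (S j) t"
      proof (cases "R j k")
        case True
        then have "t \<in> S j" using R[of j k] t by auto
        then show ?thesis using True t q r by (simp add: epowr_mono tail_antimono)
      qed simp
    qed simp
    then have "ennreal (1 / ?c) * (ennreal ?c * (\<Sum>k. ennreal (B.level k powr r) * (if R j k then tail (B.level_pt k) epowr (r / q) else 0))) \<le> Q j"
      unfolding Q_def by (rule mult_left_mono) simp
    then have "(\<Sum>k. ennreal (B.level k powr r) * (if R j k then tail (B.level_pt k) epowr (r / q) else 0)) \<le> Q j"
      using c r by (simp add: mult.assoc[symmetric] flip: ennreal_mult)
    moreover have "(if R j k then m j k else 0) epowr (r / q) \<le>
        ennreal (B.level k powr r) * (if R j k then tail (B.level_pt k) epowr (r / q) else 0)" for k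
    proof (cases "R j k")
      case True
      have "emeasure \<nu> (A.cell j \<inter> B.cell k) \<le> emeasure \<nu> (B.cell k)" by (rule emeasure_mono) auto
      also have "\<dots> \<le> tail (B.level_pt k)" unfolding tail_def by (rule B.emeasure_cell_le) simp
      finally have "m j k \<le> ennreal (B.level k) epowr q * tail (B.level_pt k)" unfolding m_def by (rule mult_left_mono) simp
      then have "m j k epowr (r / q) \<le> (ennreal (B.level k) epowr q * tail (B.level_pt k)) epowr (r / q)"
        using q r by (intro epowr_mono) auto
      also have "\<dots> = ennreal (B.level k powr r) * tail (B.level_pt k) epowr (r / q)"
        using q r by (simp add: epowr_mult epowr_epowr epowr_ennreal powr_powr)
      finally show ?thesis using True by simp
    qed (use q r in simp)
    ultimately show ?thesis by (rule order_trans[OF suminf_le_ennreal, rotated])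
  qed
  have row: "(\<Sum>k. if R j k then ?al j epowr q * ((b k * ennreal (B.level k)) epowr q * emeasure \<nu> (A.cell j \<inter> B.cell k)) else 0)
      \<le> (?al j epowr q * Q j epowr (q / r)) * z j epowr (q / p2)" for j
  proof -
    have "(\<Sum>k. if R j k then ?al j epowr q * ((b k * ennreal (B.level k)) epowr q * emeasure \<nu> (A.cell j \<inter> B.cell k)) else 0)
      = (\<Sum>k. ?al j epowr q * ((if R j k then m j k else 0) * (if R j k then b k epowr q else 0)))"
      using q by (intro suminf_cong) (simp add: m_def epowr_mult mult_ac)
    also have "\<dots> = ?al j epowr q * (\<Sum>k. (if R j k then m j k else 0) * (if R j k then b k epowr q else 0))"
      by (rule ennreal_suminf_cmult)
    also have "\<dots> \<le> ?al j epowr q * ((\<Sum>k. (if R j k then m j k else 0) epowr (r / q)) epowr (1 / (r / q)) *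
        (\<Sum>k. (if R j k then b k epowr q else 0) epowr (p2 / q)) epowr (1 / (p2 / q)))"
      by (rule mult_left_mono[OF suminf_Hoelder[OF dual(2,1,3)]]) simp
    also have "(\<Sum>k. (if R j k then b k epowr q else 0) epowr (p2 / q)) = z j"
      unfolding z_def using q by (intro suminf_cong) (simp add: epowr_epowr)
    also have "?al j epowr q * ((\<Sum>k. (if R j k then m j k else 0) epowr (r / q)) epowr (1 / (r / q)) * z j epowr (1 / (p2 / q)))
        \<le> ?al j epowr q * (Q j epowr (1 / (r / q)) * z j epowr (1 / (p2 / q)))"
      using q r by (intro mult_left_mono mult_right_mono epowr_mono mQ) auto
    finally show ?thesis by (simp add: mult.assoc)
  qed
  have zsum: "(\<Sum>j. z j) \<le> 2 * (\<Sum>k. b k epowr p2)"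
  proof -
    have "(\<Sum>j. z j) = (\<Sum>k. \<Sum>j. if R j k then b k epowr p2 else 0)"
      unfolding z_def by (rule suminf_swap_ennreal)
    also have "\<dots> = (\<Sum>k. (\<Sum>j. if R j k then 1 else 0) * b k epowr p2)"
      by (intro suminf_cong) (simp flip: ennreal_suminf_multc, intro suminf_cong, simp)
    also have "\<dots> \<le> (\<Sum>k. 2 * b k epowr p2)"
    proof (intro suminf_le_ennreal mult_right_mono row_multiplicity)
      fix k j assume "R j k"
      then show "A.cell j \<inter> B.cell k \<noteq> {} \<and> A.level_pt (Suc j) \<le> B.level_pt (Suc k)" using R by blast
    qed simp
    finally show ?thesis by simp
  qed
  have "(\<Sum>j. \<Sum>k. if R j k then ?al j epowr q * ((b k * ennreal (B.level k)) epowr q * emeasure \<nu> (A.cell j \<inter> B.cell k)) else 0)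
      \<le> (\<Sum>j. (?al j epowr q * Q j epowr (q / r)) * z j epowr (q / p2))"
    by (intro suminf_le_ennreal row)
  also have "\<dots> \<le> (\<Sum>j. (?al j epowr q * Q j epowr (q / r)) epowr (r / q)) epowr (1 / (r / q)) *
      (\<Sum>j. (z j epowr (q / p2)) epowr (p2 / q)) epowr (1 / (p2 / q))"
    by (rule suminf_Hoelder[OF dual(2,1,3)])
  also have "(\<Sum>j. (z j epowr (q / p2)) epowr (p2 / q)) = (\<Sum>j. z j)"
    using q by (simp add: epowr_epowr)
  also have "(\<Sum>j. (?al j epowr q * Q j epowr (q / r)) epowr (r / q)) = (\<Sum>j. ennreal (1 / ?c) * (?al j epowr r * tail_mu q r (S j)))"
    using q r by (intro suminf_cong) (simp add: epowr_mult epowr_epowr Q_def mult_ac)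
  also have "\<dots> = ennreal (1 / ?c) * (\<Sum>j. ?al j epowr r * tail_mu q r (S j))"
    by (rule ennreal_suminf_cmult)
  finally have "(\<Sum>j. \<Sum>k. if R j k then ?al j epowr q * ((b k * ennreal (B.level k)) epowr q * emeasure \<nu> (A.cell j \<inter> B.cell k)) else 0)
    \<le> (ennreal (1 / ?c) * (\<Sum>j. ?al j epowr r * tail_mu q r (S j))) epowr (1 / (r / q)) * (\<Sum>j. z j) epowr (1 / (p2 / q))" .
  also have "\<dots> \<le> (ennreal (1 / ?c) * (\<Sum>j. ?al j epowr r * tail_mu q r (S j))) epowr (1 / (r / q)) *
      (2 * (\<Sum>k. b k epowr p2)) epowr (1 / (p2 / q))"
    using q by (intro mult_left_mono epowr_mono zsum) auto
  also have "\<dots> = ennreal ((1 / ?c) powr (q / r) * 2 powr (q / p2)) *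
    (\<Sum>j. ?al j epowr r * tail_mu q r (S j)) epowr (q / r) * (\<Sum>k. b k epowr p2) epowr (q / p2)"
    using q r c epowr_ennreal[of 2 "q / p2"] by (simp add: epowr_mult epowr_ennreal ennreal_mult mult_ac)
  finally show ?thesis .
qed

text \<open>
  The case 1/q \<le> 1/p1 + 1/p2, where p1 \<le> r and l^p1 is contained in l^r.
\<close>

lemma row_coefficients_sup:
  assumes "0 < p1" "p1 \<le> r" "0 < q" and M: "\<And>j. ennreal (A.level j) epowr r * T j \<le> M epowr r"
  shows "(\<Sum>j. (a j * ennreal (A.level j)) epowr r * T j) epowr (q / r) \<le> M epowr q * (\<Sum>j. a j epowr p1) epowr (q / p1)"
proof -
  have "(\<Sum>j. (a j * ennreal (A.level j)) epowr r * T j) \<le> (\<Sum>j. M epowr r * a j epowr r)"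
  proof (rule suminf_le_ennreal)
    fix j
    have "(a j * ennreal (A.level j)) epowr r * T j = (ennreal (A.level j) epowr r * T j) * a j epowr r"
      using assms by (simp add: epowr_mult mult_ac)
    also have "\<dots> \<le> M epowr r * a j epowr r" by (rule mult_right_mono[OF M]) simp
    finally show "(a j * ennreal (A.level j)) epowr r * T j \<le> M epowr r * a j epowr r" .
  qed
  also have "\<dots> \<le> M epowr r * (\<Sum>j. a j epowr p1) epowr (r / p1)"
    using assms by (simp add: mult_left_mono suminf_epowr_mono_exponent)
  finally have "(\<Sum>j. (a j * ennreal (A.level j)) epowr r * T j) epowr (q / r) \<le>
      (M epowr r * (\<Sum>j. a j epowr p1) epowr (r / p1)) epowr (q / r)"
    using assms by (intro epowr_mono) auto
  then show ?thesis using assms by (simp add: epowr_mult epowr_epowr)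
qed

text \<open>
  The case 1/q > 1/p1 + 1/p2: Hoelder's inequality with exponents p1/r and \<kappa>/r.
\<close>

lemma row_coefficients_int:
  assumes r: "0 < r" "r < p1" "1 / \<kappa> = 1 / r - 1 / p1" "0 < \<kappa>" "0 < q"
  shows "(\<Sum>j. (a j * ennreal (A.level j)) epowr r * T j) epowr (q / r) \<le>
    (\<Sum>j. ennreal (A.level j powr \<kappa>) * T j epowr (\<kappa> / r)) epowr (q / \<kappa>) * (\<Sum>j. a j epowr p1) epowr (q / p1)"
proof -
  have "1 / \<kappa> < 1 / r" using r by simp
  then have rk: "r < \<kappa>" using r frac_le[of 1 1 \<kappa> r] by (cases "r < \<kappa>") auto
  have dual: "1 < p1 / r" "1 < \<kappa> / r" "1 / (p1 / r) + 1 / (\<kappa> / r) = 1"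
    using r rk by (auto simp: field_simps)
  have "(\<Sum>j. (a j * ennreal (A.level j)) epowr r * T j) = (\<Sum>j. a j epowr r * (ennreal (A.level j) epowr r * T j))"
    using r by (simp add: epowr_mult mult_ac)
  also have "\<dots> \<le> (\<Sum>j. (a j epowr r) epowr (p1 / r)) epowr (1 / (p1 / r)) *
      (\<Sum>j. (ennreal (A.level j) epowr r * T j) epowr (\<kappa> / r)) epowr (1 / (\<kappa> / r))"
    by (rule suminf_Hoelder[OF dual])
  also have "\<dots> = (\<Sum>j. a j epowr p1) epowr (r / p1) * (\<Sum>j. ennreal (A.level j powr \<kappa>) * T j epowr (\<kappa> / r)) epowr (r / \<kappa>)"
    using r by (simp add: epowr_mult epowr_epowr epowr_ennreal powr_powr)
  finally have "(\<Sum>j. (a j * ennreal (A.level j)) epowr r * T j) epowr (q / r) \<le>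
    ((\<Sum>j. a j epowr p1) epowr (r / p1) * (\<Sum>j. ennreal (A.level j powr \<kappa>) * T j epowr (\<kappa> / r)) epowr (r / \<kappa>)) epowr (q / r)"
    using r by (intro epowr_mono) auto
  then show ?thesis using r by (simp add: epowr_mult epowr_epowr mult.commute)
qed

lemma nn_integral_cell_step_product:
  assumes q: "0 < q"
  shows "(\<integral>\<^sup>+t. A.cell_step a t epowr q * B.cell_step b t epowr q \<partial>\<nu>) =
    (\<Sum>j. \<Sum>k. (a j * ennreal (A.level j)) epowr q * ((b k * ennreal (B.level k)) epowr q * emeasure \<nu> (A.cell j \<inter> B.cell k)))"
proof -
  define \<nu>' where "\<nu>' = density \<nu> (\<lambda>t. B.cell_step b t epowr q)"
  have [simp, measurable_cong]: "sets \<nu>' = sets borel" by (simp add: \<nu>'_def)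
  have cell: "emeasure \<nu>' (A.cell j) = (\<Sum>k. (b k * ennreal (B.level k)) epowr q * emeasure \<nu> (A.cell j \<inter> B.cell k))" for j
  proof -
    have "emeasure \<nu>' (A.cell j) = (\<integral>\<^sup>+t. B.cell_step b t epowr q * indicator (A.cell j) t \<partial>\<nu>)"
      by (simp add: \<nu>'_def emeasure_density)
    also have "\<dots> = (\<integral>\<^sup>+t. (\<Sum>k. (b k * ennreal (B.level k)) epowr q * indicator (A.cell j \<inter> B.cell k) t) \<partial>\<nu>)"
      unfolding B.cell_step_epowr[OF q] ennreal_suminf_multc[symmetric]
      by (intro nn_integral_cong suminf_cong) (auto simp: indicator_def)
    also have "\<dots> = (\<Sum>k. \<integral>\<^sup>+t. (b k * ennreal (B.level k)) epowr q * indicator (A.cell j \<inter> B.cell k) t \<partial>\<nu>)"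
      by (intro nn_integral_suminf) measurable
    also have "\<dots> = (\<Sum>k. (b k * ennreal (B.level k)) epowr q * emeasure \<nu> (A.cell j \<inter> B.cell k))"
      by (subst nn_integral_cmult_indicator) auto
    finally show ?thesis .
  qed
  have "(\<integral>\<^sup>+t. A.cell_step a t epowr q * B.cell_step b t epowr q \<partial>\<nu>) = (\<integral>\<^sup>+t. A.cell_step a t epowr q \<partial>\<nu>')"
    by (simp add: \<nu>'_def nn_integral_density mult.commute)
  also have "\<dots> = (\<Sum>j. (a j * ennreal (A.level j)) epowr q * emeasure \<nu>' (A.cell j))"
    by (rule A.nn_integral_cell_step[OF q]) simp
  finally show ?thesis by (simp add: cell)
qed

definition tail_mu' :: "real \<Rightarrow> real \<Rightarrow> real set \<Rightarrow> ennreal" where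
  "tail_mu' q r S = (\<integral>\<^sup>+t. tail t epowr (r / q) * indicator S t \<partial>A.mu r)"

text \<open>
  The pairs of cells that meet are divided according to which scale reaches its next level
  first.  Ties are put into the first class, which therefore has closed half-lines, while the
  second one has open half-lines.
\<close>

lemma staircase:
  assumes q: "0 < q" "q < p1" "q < p2"
    and r1: "1 / r1 = 1 / q - 1 / p1" "0 < r1" and r2: "1 / r2 = 1 / q - 1 / p2" "0 < r2"
  shows "(\<integral>\<^sup>+t. A.cell_step a t epowr q * B.cell_step b t epowr q \<partial>\<nu>) \<le>
    ennreal ((1 / (1 - (1/2) powr r2)) powr (q / r2) * 2 powr (q / p2)) *
    (\<Sum>j. (a j * ennreal (A.level j)) epowr r2 * tail_mu q r2 {A.level_pt (Suc j)..}) epowr (q / r2) *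
    (\<Sum>k. b k epowr p2) epowr (q / p2) +
    ennreal ((1 / (1 - (1/2) powr r1)) powr (q / r1) * 2 powr (q / p1)) *
    (\<Sum>k. (b k * ennreal (B.level k)) epowr r1 * tail_mu' q r1 {B.level_pt (Suc k)<..}) epowr (q / r1) *
    (\<Sum>j. a j epowr p1) epowr (q / p1)"
proof -
  interpret sw: two_scales G2 G1 c d \<nu> by (rule swap)
  let ?x = "\<lambda>j k. (a j * ennreal (A.level j)) epowr q * ((b k * ennreal (B.level k)) epowr q * emeasure \<nu> (A.cell j \<inter> B.cell k))"
  define R1 where "R1 j k \<longleftrightarrow> A.cell j \<inter> B.cell k \<noteq> {} \<and> A.level_pt (Suc j) \<le> B.level_pt (Suc k)" for j k
  define R2 where "R2 k j \<longleftrightarrow> A.cell j \<inter> B.cell k \<noteq> {} \<and> B.level_pt (Suc k) < A.level_pt (Suc j)" for j k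
  have tm: "sw.tail_mu q r S = tail_mu' q r S" for q r S
    by (simp add: sw.tail_mu_def tail_mu'_def tail_def sw.tail_def)
  have "(\<integral>\<^sup>+t. A.cell_step a t epowr q * B.cell_step b t epowr q \<partial>\<nu>) =
      (\<Sum>j. \<Sum>k. (if R1 j k then ?x j k else 0) + (if R2 k j then ?x j k else 0))"
    unfolding nn_integral_cell_step_product[OF q(1)]
    by (intro suminf_cong) (auto simp: R1_def R2_def)
  also have "\<dots> = (\<Sum>j. (\<Sum>k. if R1 j k then ?x j k else 0) + (\<Sum>k. if R2 k j then ?x j k else 0))"
    by (intro suminf_cong suminf_add[symmetric]) auto
  also have "\<dots> = (\<Sum>j. \<Sum>k. if R1 j k then ?x j k else 0) + (\<Sum>j. \<Sum>k. if R2 k j then ?x j k else 0)"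
    by (intro suminf_add[symmetric]) auto
  also have "(\<Sum>j. \<Sum>k. if R2 k j then ?x j k else 0) =
      (\<Sum>k. \<Sum>j. if R2 k j then (b k * ennreal (B.level k)) epowr q *
        ((a j * ennreal (A.level j)) epowr q * emeasure \<nu> (B.cell k \<inter> A.cell j)) else 0)"
    by (subst suminf_swap_ennreal) (intro suminf_cong, auto simp: mult_ac Int_commute)
  also have "(\<Sum>j. \<Sum>k. if R1 j k then ?x j k else 0) + \<dots> \<le>
    ennreal ((1 / (1 - (1/2) powr r2)) powr (q / r2) * 2 powr (q / p2)) *
    (\<Sum>j. (a j * ennreal (A.level j)) epowr r2 * tail_mu q r2 {A.level_pt (Suc j)..}) epowr (q / r2) *
    (\<Sum>k. b k epowr p2) epowr (q / p2) +
    ennreal ((1 / (1 - (1/2) powr r1)) powr (q / r1) * 2 powr (q / p1)) *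
    (\<Sum>k. (b k * ennreal (B.level k)) epowr r1 * sw.tail_mu q r1 {B.level_pt (Suc k)<..}) epowr (q / r1) *
    (\<Sum>j. a j epowr p1) epowr (q / p1)"
    by (intro add_mono rows_upper[OF q(1,3) r2] sw.rows_upper[OF q(1,2) r1])
      (auto simp: R1_def R2_def)
  finally show ?thesis by (simp only: tm)
qed

end

section \<open>Lebesgue measure on subsets of the line\<close>

lemma id_measurable_lebesgue_on: "(\<lambda>x::real. x) \<in> borel_measurable (lebesgue_on S)"
  by (intro measurable_restrict_space1 measurable_completion) simp

lemma borel_measurable_lebesgue_onI:
  "g \<in> borel_measurable borel \<Longrightarrow> g \<in> borel_measurable (lebesgue_on (S :: real set))"
  by (rule measurable_compose[OF id_measurable_lebesgue_on])

lemma nn_integral_lebesgue_on: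
  "E \<in> sets lebesgue \<Longrightarrow> (\<integral>\<^sup>+t. h t \<partial>lebesgue_on E) = (\<integral>\<^sup>+t. h t * indicator E t \<partial>lebesgue)"
  by (rule nn_integral_restrict_space) simp

lemma set_nn_integral_eq_lebesgue_on:
  assumes "S \<subseteq> E" "E \<in> sets lebesgue"
  shows "(\<integral>\<^sup>+t\<in>S. h t \<partial>lebesgue) = (\<integral>\<^sup>+t. h t * indicator S t \<partial>lebesgue_on E)"
  unfolding nn_integral_lebesgue_on[OF assms(2)] using assms(1)
  by (intro nn_integral_cong) (auto simp: indicator_def)

lemma hardy_eq:
  assumes "E \<in> sets lebesgue"
  shows "hardy E f x = (\<integral>\<^sup>+t. f t * indicator {..x} t \<partial>lebesgue_on E)"
  unfolding hardy_def nn_integral_lebesgue_on[OF assms]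
  by (intro nn_integral_cong) (simp add: indicator_def)

lemma wfunctional_eq:
  assumes "E \<in> sets lebesgue" "s \<noteq> top"
  shows "wfunctional s w E h = (\<integral>\<^sup>+t. h t epowr enn2real s * w t \<partial>lebesgue_on E) epowr (1 / enn2real s)"
  unfolding wfunctional_def nn_integral_lebesgue_on[OF assms(1)] using assms(2) by simp

lemma Icc_sets_lebesgue [simp]: "{c..d::real} \<in> sets lebesgue"
  by simp

lemma mono_right_contI:
  fixes G :: "real \<Rightarrow> real"
  assumes "\<And>x y. x \<le> y \<Longrightarrow> G x \<le> G y" and "\<And>e. G a < e \<Longrightarrow> \<exists>y>a. G y < e"
  shows "continuous (at_right a) G"
  unfolding continuous_within
proof (rule order_tendstoI)
  fix e assume "e < G a"
  then have "e < G t" if "a < t" for t using assms(1)[of a t] that by simp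
  then show "\<forall>\<^sub>F t in at_right a. e < G t" by (auto simp: eventually_at_filter)
next
  fix e assume "G a < e"
  then obtain y where "a < y" "G y < e" using assms(2) by blast
  then have "G t < e" if "t < y" for t using assms(1)[of t y] that by simp
  then show "\<forall>\<^sub>F t in at_right a. G t < e"
    using \<open>a < y\<close> by (auto simp: eventually_at_right)
qed

section \<open>From functions to sequences\<close>

context scale
begin

text \<open>
  On the i-th cell Hoelder's inequality bounds the integral of f by 2 * level i times the local
  norm b i, since G < 2 * level i there.  Where G vanishes, the integral vanishes.  The Hardy
  transform at a point of the n-th cell collects the cells of index i \<ge> n, whose levels
  decay geometrically, so a is a geometrically weighted sum of the b i; the factor 4 is 2 from
  the cells times 2 = 1 / (1 - 1/2) from the sum.  The hypothesis is stated with a bound \<phi>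
  for G strictly to the left of y, so that it can be used up to a point where G jumps.
\<close>

lemma hardy_le_cell_step:
  fixes v f :: "real \<Rightarrow> ennreal"
  assumes p: "1 \<le> p" and f [measurable]: "f \<in> borel_measurable (lebesgue_on {c..d})"
    and v [measurable]: "v \<in> borel_measurable (lebesgue_on {c..d})"
    and fin: "(\<integral>\<^sup>+t. f t epowr p * v t \<partial>lebesgue_on {c..d}) < top"
    and Hoelder: "\<And>g y \<phi>. g \<in> borel_measurable (lebesgue_on {c..d}) \<Longrightarrow>
      (\<integral>\<^sup>+t. g t epowr p * v t \<partial>lebesgue_on {c..d}) < top \<Longrightarrow> c \<le> y \<Longrightarrow> y \<le> d \<Longrightarrow> 0 \<le> \<phi> \<Longrightarrow> (\<And>t. t < y \<Longrightarrow> G t \<le> \<phi>) \<Longrightarrow>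
      (\<integral>\<^sup>+t. g t * indicator {..y} t \<partial>lebesgue_on {c..d})
        \<le> ennreal \<phi> * (\<integral>\<^sup>+t. g t epowr p * v t \<partial>lebesgue_on {c..d}) epowr (1 / p)"
  shows "\<exists>a. (\<Sum>n. a n epowr p) epowr (1 / p) \<le> 4 * (\<integral>\<^sup>+t. f t epowr p * v t \<partial>lebesgue_on {c..d}) epowr (1 / p) \<and>
    (\<forall>t\<in>{c..d}. hardy {c..d} f t \<le> cell_step a t)"
proof -
  let ?M = "lebesgue_on {c..d}"
  have p0: "0 < p" using p by simp
  have [measurable]: "cell n \<inter> {c..d} \<in> sets ?M" "{x. G x = 0} \<inter> {c..d} \<in> sets ?M" for n
    by (auto simp: sets_restrict_space_iff)
  have cellM [measurable]: "(\<lambda>t. indicator (cell i) t :: ennreal) \<in> borel_measurable ?M" for i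
    by (rule borel_measurable_lebesgue_onI) measurable
  define b where "b i = (\<integral>\<^sup>+t. (f t * indicator (cell i) t) epowr p * v t \<partial>?M) epowr (1 / p)" for i
  define a where "a n = (\<Sum>i. (if n \<le> i then ennreal ((1/2) ^ (i - n)) else 0) * (2 * b i))" for n
  have bfin: "(\<integral>\<^sup>+t. (f t * indicator (cell i) t) epowr p * v t \<partial>?M) < top" for i
    by (rule le_less_trans[OF nn_integral_mono fin]) (use p0 in \<open>auto simp: indicator_def\<close>)
  have cell_int: "(\<integral>\<^sup>+t. f t * indicator (cell i) t \<partial>?M) \<le> ennreal (2 * level i) * b i" for i
  proof (cases "0 < G d")
    case True
    \<comment> \<open>The right end of the i-th cell is the point where G reaches the level
    above; for i = 0 it is d.\<close>
    obtain y where y: "c \<le> y" "y \<le> d" "\<And>t. t < y \<Longrightarrow> G t \<le> 2 * level i" "\<And>t. t \<in> cell i \<Longrightarrow> t \<le> d \<Longrightarrow> t \<le> y"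
    proof (cases i)
      case 0
      have "G t \<le> 2 * level i" for t using le_total[of t] True 0 by simp
      then show ?thesis using that[of d] cd by auto
    next
      case (Suc k)
      have lt: "t < level_pt k \<longleftrightarrow> G t < 2 * level i" for t
        using level_pt_le_iff[OF True, of k t] level_Suc[of k] Suc by (auto simp: not_le[symmetric])
      show ?thesis
        using level_pt_bounds[OF True, of k] lt by (intro that[of "level_pt k"]) (auto simp: cell_def intro: less_imp_le)
    qed
    have "(\<integral>\<^sup>+t. f t * indicator (cell i) t \<partial>?M) = (\<integral>\<^sup>+t. (f t * indicator (cell i) t) * indicator {..y} t \<partial>?M)"
      using y(4) by (intro nn_integral_cong) (auto simp: indicator_def)
    also have "\<dots> \<le> ennreal (2 * level i) * b i"
      unfolding b_def by (rule Hoelder) (use y bfin in auto)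
    finally show ?thesis .
  qed (simp add: cell_empty)
  have zero_int: "(\<integral>\<^sup>+t. f t * indicator {t. G t = 0} t \<partial>?M) = 0"
  proof -
    let ?Z = "{t \<in> {c..d}. G t = 0}"
    show ?thesis
    proof (cases "?Z = {}")
      case True
      then have "(\<integral>\<^sup>+t. f t * indicator {t. G t = 0} t \<partial>?M) = (\<integral>\<^sup>+t. 0 \<partial>?M)"
        by (intro nn_integral_cong) (auto simp: indicator_def)
      then show ?thesis by simp
    next
      case False
      have bdd: "bdd_above ?Z" unfolding bdd_above_def by auto
      define y where "y = Sup ?Z"
      have up: "t \<le> y" if "t \<in> ?Z" for t unfolding y_def by (rule cSup_upper[OF that bdd])
      have yb: "c \<le> y" "y \<le> d"
      proof -
        obtain t where "t \<in> ?Z" using False by blast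
        with up show "c \<le> y" by force
        show "y \<le> d" unfolding y_def by (rule cSup_least[OF False]) auto
      qed
      have yz: "G t \<le> 0" if "t < y" for t
      proof -
        have "\<exists>s\<in>?Z. t < s" by (rule less_cSupD[OF False]) (use that in \<open>simp add: y_def\<close>)
        then obtain s where "s \<in> ?Z" "t < s" by (rule bexE)
        then show ?thesis using mono[of t s] by auto
      qed
      have "(\<integral>\<^sup>+t. f t * indicator {t. G t = 0} t \<partial>?M) \<le> (\<integral>\<^sup>+t. f t * indicator {..y} t \<partial>?M)"
        using up by (intro nn_integral_mono) (auto simp: indicator_def)
      also have "\<dots> \<le> ennreal 0 * (\<integral>\<^sup>+t. f t epowr p * v t \<partial>?M) epowr (1 / p)"
        by (rule Hoelder) (use yb yz fin in auto)
      finally show ?thesis by simp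
    qed
  qed
  have "hardy {c..d} f t \<le> cell_step a t" if t: "t \<in> {c..d}" for t
  proof (cases "G t = 0")
    case True
    have Gs: "G s = 0" if "s \<le> t" for s using mono[OF that] True nonneg[of s] by linarith
    have "hardy {c..d} f t \<le> (\<integral>\<^sup>+t. f t * indicator {t. G t = 0} t \<partial>?M)"
      unfolding hardy_eq[OF Icc_sets_lebesgue] using Gs by (intro nn_integral_mono) (auto simp: indicator_def)
    then show ?thesis by (simp add: zero_int)
  next
    case False
    then have "0 < G t" using nonneg[of t] by linarith
    then obtain n where n: "t \<in> cell n" by (rule ex_cell)
    have "hardy {c..d} f t \<le> (\<integral>\<^sup>+s. f s * indicator {t. G t = 0} s + (\<Sum>i. f s * indicator (cell i) s * (if n \<le> i then 1 else 0)) \<partial>?M)"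
      unfolding hardy_eq[OF Icc_sets_lebesgue]
    proof (rule nn_integral_mono)
      fix s
      show "f s * indicator {..t} s \<le> f s * indicator {t. G t = 0} s + (\<Sum>i. f s * indicator (cell i) s * (if n \<le> i then 1 else 0))"
      proof (cases "s \<le> t \<and> G s \<noteq> 0")
        case True
        then have "0 < G s" using nonneg[of s] by linarith
        then obtain i where i: "s \<in> cell i" by (rule ex_cell)
        have "n \<le> i"
        proof (rule ccontr)
          assume "\<not> n \<le> i"
          then have "level n \<le> level (Suc i)" "level n < level i" using level_antimono[of "Suc i" n] level_Suc[of i] i
            by (auto simp: cell_def)
          then show False using i n True mono[of s t] level_Suc[of i] by (auto simp: cell_def)
        qed
        have "(\<Sum>i. (f s * (if n \<le> i then 1 else 0)) * indicator (cell i) s) = f s * (if n \<le> i then 1 else 0)"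
          by (rule suminf_cell[OF i])
        then have "(\<Sum>i. f s * indicator (cell i) s * (if n \<le> i then 1 else 0)) = f s"
          using \<open>n \<le> i\<close> by (simp add: mult_ac)
        then show ?thesis using True by simp
      qed (auto simp: indicator_def)
    qed
    also have "\<dots> = 0 + (\<Sum>i. (\<integral>\<^sup>+s. f s * indicator (cell i) s \<partial>?M) * (if n \<le> i then 1 else 0))"
    proof -
      have [measurable]: "(\<lambda>t. indicator {t. G t = 0} t :: ennreal) \<in> borel_measurable ?M"
        by (rule borel_measurable_lebesgue_onI) measurable
      show ?thesis
        by (subst nn_integral_add) (auto simp: zero_int nn_integral_suminf nn_integral_multc)
    qed
    also have "\<dots> \<le> (\<Sum>i. ennreal (level n) * ((if n \<le> i then ennreal ((1/2) ^ (i - n)) else 0) * (2 * b i)))"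
    proof (unfold add_0, rule suminf_le_ennreal)
      fix i
      have "ennreal (2 * level i) * b i = ennreal (level n) * (ennreal ((1/2) ^ (i - n)) * (2 * b i))" if "n \<le> i"
        using level_shift[OF that] by (simp add: ennreal_mult mult_ac)
      then show "(\<integral>\<^sup>+s. f s * indicator (cell i) s \<partial>?M) * (if n \<le> i then 1 else 0) \<le>
          ennreal (level n) * ((if n \<le> i then ennreal ((1/2) ^ (i - n)) else 0) * (2 * b i))"
        using cell_int[of i] by auto
    qed
    also have "\<dots> = ennreal (level n) * a n" unfolding a_def by (rule ennreal_suminf_cmult)
    also have "\<dots> = cell_step a t" by (simp add: cell_step_eq[OF n] mult.commute)
    finally show ?thesis .
  qed
  moreover have "(\<Sum>n. a n epowr p) epowr (1 / p) \<le> 4 * (\<integral>\<^sup>+t. f t epowr p * v t \<partial>?M) epowr (1 / p)"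
  proof -
    have "(\<Sum>n. a n epowr p) \<le> ennreal (1 / (1 - 1/2)) epowr p * (\<Sum>i. (2 * b i) epowr p)"
      unfolding a_def by (rule suminf_geometric_tail_le) (use p in auto)
    also have "(\<Sum>i. (2 * b i) epowr p) = 2 epowr p * (\<Sum>i. b i epowr p)"
      using p0 by (simp add: epowr_mult)
    also have "(\<Sum>i. b i epowr p) = (\<integral>\<^sup>+t. (\<Sum>i. (f t * indicator (cell i) t) epowr p * v t) \<partial>?M)"
      unfolding b_def using p0 by (subst nn_integral_suminf) auto
    also have "\<dots> \<le> (\<integral>\<^sup>+t. f t epowr p * v t \<partial>?M)"
    proof (rule nn_integral_mono)
      fix t
      have "(\<Sum>i. (f t * indicator (cell i) t) epowr p * v t) = f t epowr p * (\<Sum>i. indicator (cell i) t) * v t"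
        using p0 by simp
      also have "\<dots> \<le> f t epowr p * 1 * v t"
        by (intro mult_mono mult_left_mono suminf_cell_indicator_le) auto
      finally show "(\<Sum>i. (f t * indicator (cell i) t) epowr p * v t) \<le> f t epowr p * v t" by simp
    qed
    finally have "(\<Sum>n. a n epowr p) \<le> ennreal (1 / (1 - 1/2)) epowr p * (2 epowr p * (\<integral>\<^sup>+t. f t epowr p * v t \<partial>?M))"
      by (simp add: mult_left_mono)
    then have "(\<Sum>n. a n epowr p) epowr (1 / p) \<le> (ennreal (1 / (1 - 1/2)) epowr p * (2 epowr p * (\<integral>\<^sup>+t. f t epowr p * v t \<partial>?M))) epowr (1 / p)"
      using p0 by (intro epowr_mono) auto
    also have "\<dots> = 4 * (\<integral>\<^sup>+t. f t epowr p * v t \<partial>?M) epowr (1 / p)"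
      using p0 by (simp add: epowr_mult)
    finally show ?thesis .
  qed
  ultimately show ?thesis by blast
qed

end

section \<open>Profiles as scales\<close>

text \<open>
  What the sequence model needs to know about a weight: the profile is a scale, Hardy transforms
  are dominated by functions with one value per cell, and cumulative step functions are
  dominated by Hardy transforms.  The last domination is up to a shift by an arbitrary e > 0,
  which the exponent 1 requires.
\<close>

definition profile_scale :: "real \<Rightarrow> (real \<Rightarrow> ennreal) \<Rightarrow> real \<Rightarrow> real \<Rightarrow> (real \<Rightarrow> real) \<Rightarrow> bool" where
  "profile_scale p v c d G \<longleftrightarrow> scale G c d \<and> (\<forall>x\<in>{c..d}. profile (ennreal p) v c d x = ennreal (G x)) \<and>
    (\<forall>f\<in>borel_measurable (lebesgue_on {c..d}). wfunctional (ennreal p) v {c..d} f < top \<longrightarrow>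
      (\<exists>a. (\<Sum>n. a n epowr p) epowr (1 / p) \<le> 4 * wfunctional (ennreal p) v {c..d} f \<and>
        (\<forall>t\<in>{c..d}. hardy {c..d} f t \<le> scale.cell_step G d a t))) \<and>
    (\<forall>a. \<forall>e>0. \<exists>f\<in>borel_measurable (lebesgue_on {c..d}).
      wfunctional (ennreal p) v {c..d} f \<le> (\<Sum>n. a n epowr p) epowr (1 / p) \<and>
      (\<forall>t\<in>{c..d}. ennreal (1/2) * scale.cumul_step G d a (t - e) \<le> hardy {c..d} f t))"

text \<open>
  A weight bounded below, as adding 1/m produces it; this makes the profile finite.
\<close>

locale local_weight =
  fixes v :: "real \<Rightarrow> ennreal" and c d \<delta> :: real
  assumes c_less_d: "c < d" and v_measurable [measurable]: "v \<in> borel_measurable (lebesgue_on {c..d})"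
    and \<delta>_pos: "0 < \<delta>" and v_ge: "\<And>t. t \<in> {c..d} \<Longrightarrow> ennreal \<delta> \<le> v t"
begin

abbreviation "M \<equiv> lebesgue_on {c..d}"

lemma space_M [simp]: "space M = {c..d}" by simp

lemma v_cases:
  assumes "t \<in> {c..d}"
  obtains "v t = top" | r where "v t = ennreal r" "\<delta> \<le> r" "0 < r"
proof (cases "v t")
  case (real r)
  then have "\<delta> \<le> r" using v_ge[OF assms] by (simp add: ennreal_le_iff)
  with real show ?thesis using that(2)[of r] \<delta>_pos by simp
qed (rule that(1))

lemma emeasure_M_finite: "emeasure M {c..d} < top"
  using c_less_d by (simp add: emeasure_restrict_space)

lemma borel_M [measurable (raw)]: "g \<in> borel_measurable borel \<Longrightarrow> g \<in> borel_measurable M"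
  by (rule borel_measurable_lebesgue_onI)

lemma borel_sets_M [measurable]: "A \<in> sets borel \<Longrightarrow> (\<lambda>t. indicator A t :: ennreal) \<in> borel_measurable M"
  by (intro borel_measurable_lebesgue_onI borel_measurable_indicator)

lemma AE_M_neq: "AE t in M. t \<noteq> y"
proof -
  have "AE t in lebesgue. t \<noteq> y" by (rule AE_completion) (rule AE_lborel_singleton)
  then show ?thesis by (subst AE_restrict_space_iff) auto
qed

lemma AE_finite_weight:
  assumes [measurable]: "g \<in> borel_measurable M" and p: "0 < p" and fin: "(\<integral>\<^sup>+t. g t epowr p * v t \<partial>M) < top"
  shows "AE t in M. v t = top \<longrightarrow> g t = 0"
proof -
  have "AE t in M. g t epowr p * v t \<noteq> \<infinity>"
    using fin by (intro nn_integral_PInf_AE) auto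
  then show ?thesis
    by (rule AE_mp) (use p in \<open>auto simp: ennreal_mult_eq_top_iff intro!: AE_I2\<close>)
qed

subsection \<open>Exponents greater than one\<close>

text \<open>
  Here \<Phi>^p' is the distribution function of the measure \<rho> with density \<sigma> =
  v^(1-p'), and \<sigma>^p * v = \<sigma>.  The function attached to a sequence a is \<sigma>
  times a constant on every cell.  A term of index i lives on the cell i + 1, which ends where
  \<Phi> reaches level i, and its \<rho>-measure is between level(i)^p' / 2 and level(i)^p'; the
  constant a i * level(i)^(1-p') then gives mass at least a i * level i / 2 and norm at most a
  i.
\<close>

lemma profile_scale_gt_1:
  assumes p: "1 < p" shows "\<exists>G. profile_scale p v c d G"
proof -
  define p' where "p' = p / (p - 1)"
  have p': "1 < p'" "1 / p + 1 / p' = 1" "0 < p" "0 < p'" "1 - p' < 0"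
    using p by (auto simp: p'_def field_simps)
  have pp: "(1 - p') * p = - p'" "1 / p + (1 - p') * (1 / p') = 0" "1 + (1 - p') * p = 1 - p'"
    using p by (auto simp: p'_def field_simps)
  define \<sigma> where "\<sigma> t = v t epowr (1 - p')" for t
  have [measurable]: "\<sigma> \<in> borel_measurable M" unfolding \<sigma>_def[abs_def] by measurable
  define \<rho> where "\<rho> = distr (density M \<sigma>) borel (\<lambda>x. x)"
  have [simp, measurable_cong]: "sets \<rho> = sets borel" by (simp add: \<rho>_def)
  have em: "emeasure \<rho> A = (\<integral>\<^sup>+t. \<sigma> t * indicator A t \<partial>M)" if [measurable]: "A \<in> sets borel" for A
  proof -
    have "emeasure \<rho> A = emeasure (density M \<sigma>) (A \<inter> {c..d})"
      unfolding \<rho>_def by (subst emeasure_distr) (auto simp: id_measurable_lebesgue_on)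
    also have "\<dots> = (\<integral>\<^sup>+t. \<sigma> t * indicator (A \<inter> {c..d}) t \<partial>M)"
      by (rule emeasure_density) (auto simp: sets_restrict_space_iff)
    also have "\<dots> = (\<integral>\<^sup>+t. \<sigma> t * indicator A t \<partial>M)"
      by (intro nn_integral_cong) (auto simp: indicator_def)
    finally show ?thesis .
  qed
  have \<sigma>_le: "\<sigma> t \<le> ennreal (\<delta> powr (1 - p'))" if "t \<in> {c..d}" for t
  proof (rule v_cases[OF that])
    fix r assume "v t = ennreal r" "\<delta> \<le> r" "0 < r"
    then show ?thesis using p' \<delta>_pos by (simp add: \<sigma>_def epowr_ennreal' powr_mono2')
  qed (use p' in \<open>simp add: \<sigma>_def epowr_def\<close>)
  have fin: "emeasure \<rho> (space \<rho>) \<noteq> top"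
  proof -
    have "emeasure \<rho> (space \<rho>) = (\<integral>\<^sup>+t. \<sigma> t \<partial>M)"
      using em[of UNIV] by (simp add: \<rho>_def)
    also have "\<dots> \<le> (\<integral>\<^sup>+t. ennreal (\<delta> powr (1 - p')) \<partial>M)"
      by (intro nn_integral_mono \<sigma>_le) simp
    also have "\<dots> < top" using emeasure_M_finite by (simp add: ennreal_mult_less_top)
    finally show ?thesis by simp
  qed
  interpret \<rho>: finite_borel_measure \<rho>
  proof (intro finite_borel_measure.intro finite_borel_measure_axioms.intro)
    show "finite_measure \<rho>" by (rule finite_measureI) (use fin in simp)
  qed simp
  define G where "G x = measure \<rho> {..x} powr (1 / p')" for x
  have Gp: "measure \<rho> {..x} = G x powr p'" for x using p' by (simp add: G_def powr_powr)
  have Gp': "emeasure \<rho> {..x} = ennreal (G x powr p')" for x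
    using Gp \<rho>.emeasure_eq_measure[of "{..x}"] by simp
  have atom: "emeasure \<rho> {y} = 0" for y
  proof -
    have "emeasure \<rho> {y} = (\<integral>\<^sup>+t. 0 \<partial>M)" unfolding em[of "{y}", simplified]
      by (rule nn_integral_cong_AE) (use AE_M_neq[of y] in auto)
    then show ?thesis by simp
  qed
  have left: "emeasure \<rho> {..y} = emeasure \<rho> {..<y}" for y
  proof -
    have "{..y} = {..<y} \<union> {y}" by auto
    then have "emeasure \<rho> {..y} = emeasure \<rho> {..<y} + emeasure \<rho> {y}"
      using plus_emeasure[of "{..<y}" \<rho> "{y}"] by simp
    then show ?thesis by (simp add: atom)
  qed
  have lessle: "emeasure \<rho> {..<y} \<le> ennreal (\<phi> powr p')" if "\<And>t. t < y \<Longrightarrow> G t \<le> \<phi>" for y \<phi>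
  proof -
    have "(cdf \<rho> \<longlongrightarrow> measure \<rho> {..<y}) (at_left y)" by (rule \<rho>.cdf_at_left)
    moreover have "cdf \<rho> t \<le> \<phi> powr p'" if "t < y" for t
      unfolding cdf_def Gp using p' \<open>\<And>t. t < y \<Longrightarrow> G t \<le> \<phi>\<close>[OF that] by (intro powr_mono2) (auto simp: G_def)
    then have "\<forall>\<^sub>F t in at_left y. cdf \<rho> t \<le> \<phi> powr p'" by (auto simp: eventually_at_filter)
    ultimately have "measure \<rho> {..<y} \<le> \<phi> powr p'" by (rule tendsto_upperbound) simp
    then show ?thesis by (simp add: \<rho>.emeasure_eq_measure)
  qed
  interpret scale G c d
  proof
    show "c \<le> d" using c_less_d by simp
    show "G x \<le> G y" if "x \<le> y" for x y
      using \<rho>.cdf_nondecreasing[OF that] p' unfolding G_def cdf_def by (intro powr_mono2) auto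
    show "continuous (at_right a) G" for a
    proof -
      have "(cdf \<rho> \<longlongrightarrow> cdf \<rho> a) (at_right a)" using \<rho>.cdf_is_right_cont[of a] by (simp add: continuous_within)
      then show ?thesis unfolding continuous_within G_def cdf_def using p' by (intro tendsto_powr') auto
    qed
    show "G x = 0" if "x < c" for x
    proof -
      have "emeasure \<rho> {..x} = (\<integral>\<^sup>+t. 0 \<partial>M)"
        unfolding em[of "{..x}", simplified] using that by (intro nn_integral_cong) (auto simp: indicator_def)
      then show ?thesis using p' by (simp add: G_def measure_def)
    qed
    show "G x = G d" if "d \<le> x" for x
    proof -
      have "emeasure \<rho> {..x} = emeasure \<rho> {..d}"
        unfolding em[of "{..x}", simplified] em[of "{..d}", simplified] using that
        by (intro nn_integral_cong) (auto simp: indicator_def)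
      then show ?thesis by (simp add: G_def measure_def)
    qed
  qed
  have enn: "enn2real (ennreal p) = p" "ennreal p \<noteq> top" using p by auto
  have wf: "wfunctional (ennreal p) v {c..d} f = (\<integral>\<^sup>+t. f t epowr p * v t \<partial>M) epowr (1 / p)" for f
    by (simp add: wfunctional_eq enn p'(3) less_imp_le)
  have prof: "profile (ennreal p) v c d x = ennreal (G x)" if "x \<in> {c..d}" for x
  proof -
    have "ennreal p \<noteq> 1" using p by (simp flip: ennreal_1)
    then have "profile (ennreal p) v c d x = (\<integral>\<^sup>+t\<in>{c..x}. \<sigma> t \<partial>lebesgue) epowr (1 / p')"
      using p by (simp add: profile_def p'_def \<sigma>_def)
    also have "(\<integral>\<^sup>+t\<in>{c..x}. \<sigma> t \<partial>lebesgue) = (\<integral>\<^sup>+t. \<sigma> t * indicator {c..x} t \<partial>M)"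
      using that by (intro set_nn_integral_eq_lebesgue_on) auto
    also have "\<dots> = emeasure \<rho> {..x}"
      unfolding em[of "{..x}", simplified] by (intro nn_integral_cong) (auto simp: indicator_def)
    also have "\<dots> epowr (1 / p') = ennreal (G x)"
      unfolding Gp' using p' by (simp add: epowr_ennreal powr_powr)
    finally show ?thesis .
  qed
  have Hoelder: "(\<integral>\<^sup>+t. g t * indicator {..y} t \<partial>M) \<le> ennreal \<phi> * (\<integral>\<^sup>+t. g t epowr p * v t \<partial>M) epowr (1 / p)"
    if [measurable]: "g \<in> borel_measurable M" and gfin: "(\<integral>\<^sup>+t. g t epowr p * v t \<partial>M) < top"
      and y: "0 \<le> \<phi>" "\<And>t. t < y \<Longrightarrow> G t \<le> \<phi>" for g y \<phi>
  proof -
    have "(\<integral>\<^sup>+t. g t * indicator {..y} t \<partial>M) \<le> (\<integral>\<^sup>+t. (g t * v t epowr (1/p)) * (\<sigma> t epowr (1/p') * indicator {..y} t) \<partial>M)"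
    proof (rule nn_integral_mono_AE, rule AE_mp[OF AE_finite_weight[OF _ p'(3) gfin]], simp, rule AE_I2, rule impI)
      fix t assume "t \<in> space M" and top: "v t = top \<longrightarrow> g t = 0"
      then have "t \<in> {c..d}" by simp
      then show "g t * indicator {..y} t \<le> (g t * v t epowr (1/p)) * (\<sigma> t epowr (1/p') * indicator {..y} t)"
      proof (cases rule: v_cases)
        case (2 r)
        have "v t epowr (1/p) * \<sigma> t epowr (1/p') = ennreal (r powr (1 / p + (1 - p') * (1 / p')))"
          using 2 p' by (simp add: \<sigma>_def epowr_ennreal' epowr_ennreal powr_powr powr_add ennreal_mult)
        then have one: "v t epowr (1/p) * \<sigma> t epowr (1/p') = 1" using 2 by (simp only: pp(2)) simp
        have "(g t * v t epowr (1/p)) * (\<sigma> t epowr (1/p') * indicator {..y} t) =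
            (v t epowr (1/p) * \<sigma> t epowr (1/p')) * (g t * indicator {..y} t)" by (simp only: mult_ac)
        then show ?thesis by (simp add: one)
      qed (use top in simp)
    qed
    also have "\<dots> \<le> (\<integral>\<^sup>+t. (g t * v t epowr (1/p)) epowr p \<partial>M) epowr (1/p) *
        (\<integral>\<^sup>+t. (\<sigma> t epowr (1/p') * indicator {..y} t) epowr p' \<partial>M) epowr (1/p')"
      by (rule nn_integral_Hoelder) (use p p' in auto)
    also have "(\<integral>\<^sup>+t. (g t * v t epowr (1/p)) epowr p \<partial>M) = (\<integral>\<^sup>+t. g t epowr p * v t \<partial>M)"
      using p' by (simp add: epowr_mult)
    also have "(\<integral>\<^sup>+t. (\<sigma> t epowr (1/p') * indicator {..y} t) epowr p' \<partial>M) = emeasure \<rho> {..y}"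
      using p' by (simp add: em)
    also have "(\<integral>\<^sup>+t. g t epowr p * v t \<partial>M) epowr (1/p) * emeasure \<rho> {..y} epowr (1/p') \<le>
        (\<integral>\<^sup>+t. g t epowr p * v t \<partial>M) epowr (1/p) * ennreal \<phi>"
      using lessle[OF y(2)] p' y(1) by (intro mult_left_mono) (simp_all add: left epowr_le_iff' epowr_ennreal)
    finally show ?thesis by (simp only: mult_ac)
  qed
  have upper: "\<exists>a. (\<Sum>n. a n epowr p) epowr (1 / p) \<le> 4 * wfunctional (ennreal p) v {c..d} f \<and>
        (\<forall>t\<in>{c..d}. hardy {c..d} f t \<le> cell_step a t)"
    if "f \<in> borel_measurable M" "wfunctional (ennreal p) v {c..d} f < top" for f
    unfolding wf
  proof (rule hardy_le_cell_step)
    show "1 \<le> p" using p by simp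
    show "(\<integral>\<^sup>+t. f t epowr p * v t \<partial>M) < top" using that p' by (simp add: wf)
  qed (auto intro: that Hoelder)
  have lower: "\<exists>f\<in>borel_measurable M. wfunctional (ennreal p) v {c..d} f \<le> (\<Sum>n. a n epowr p) epowr (1 / p) \<and>
      (\<forall>t\<in>{c..d}. ennreal (1/2) * cumul_step a (t - e) \<le> hardy {c..d} f t)" if e: "0 < e" for a e
  proof (cases "0 < G d")
    case False
    then have "G d = 0" using nonneg[of d] by linarith
    then have "cumul_step a t = 0" for t by (simp add: cumul_step_def level_def)
    then show ?thesis using p' by (intro bexI[of _ "\<lambda>_. 0"]) (auto simp: wf)
  next
    case True
    have lt: "t < level_pt n \<longleftrightarrow> G t < level n" for t n using level_pt_le_iff[OF True, of n t] by linarith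
    define f where "f t = (\<Sum>i. a i * ennreal (level i powr (1 - p')) * \<sigma> t * indicator (cell (Suc i)) t)" for t
    have f_meas [measurable]: "f \<in> borel_measurable M" unfolding f_def[abs_def] by measurable
    have cell_le: "emeasure \<rho> (cell (Suc i)) \<le> ennreal (level i powr p')" for i
    proof -
      have "emeasure \<rho> (cell (Suc i)) \<le> emeasure \<rho> {..<level_pt i}"
        using level_Suc[of i] by (intro emeasure_mono) (auto simp: cell_def lt)
      also have "\<dots> \<le> ennreal (level i powr p')"
        by (intro lessle) (simp add: lt less_imp_le)
      finally show ?thesis .
    qed
    \<comment> \<open>Half of the mass below level i lies above level i + 1, because p' > 1 and
    \<rho> has no atoms.\<close>
    have cell_ge: "ennreal (1/2 * level i powr p') \<le> emeasure \<rho> (cell (Suc i))" for i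
    proof -
      have "emeasure \<rho> {..level_pt i} \<le> emeasure \<rho> ({..<level_pt (Suc i)} \<union> cell (Suc i) \<union> {level_pt i})"
      proof (rule emeasure_mono)
        have "x < level_pt (Suc i) \<or> x \<in> cell (Suc i) \<or> x = level_pt i" if "x \<le> level_pt i" for x
          using that level_pt_le_iff[OF True, of i x] level_pt_le_iff[OF True, of "Suc i" x] level_Suc[of i]
          by (auto simp: cell_def)
        then show "{..level_pt i} \<subseteq> {..<level_pt (Suc i)} \<union> cell (Suc i) \<union> {level_pt i}" by auto
      qed simp
      also have "\<dots> \<le> emeasure \<rho> {..<level_pt (Suc i)} + emeasure \<rho> (cell (Suc i)) + emeasure \<rho> {level_pt i}"
        by (intro order_trans[OF emeasure_subadditive] add_mono) auto
      also have "\<dots> = emeasure \<rho> {..<level_pt (Suc i)} + emeasure \<rho> (cell (Suc i))" by (simp add: atom)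
      finally have "measure \<rho> {..level_pt i} \<le> measure \<rho> {..<level_pt (Suc i)} + measure \<rho> (cell (Suc i))"
        by (simp add: \<rho>.emeasure_eq_measure flip: ennreal_plus)
      moreover have "emeasure \<rho> {..<level_pt (Suc i)} \<le> ennreal (level (Suc i) powr p')"
        by (intro lessle) (simp add: lt less_imp_le)
      then have "measure \<rho> {..<level_pt (Suc i)} \<le> level (Suc i) powr p'" by (simp add: \<rho>.emeasure_eq_measure)
      moreover have "level (Suc i) powr p' \<le> 1/2 * level i powr p'"
      proof -
        have "(2::real) powr 1 \<le> 2 powr p'" using p' by (intro powr_mono) auto
        then have "2 * level (Suc i) powr p' \<le> 2 powr p' * level (Suc i) powr p'" by (intro mult_right_mono) auto
        then show ?thesis by (subst (2) level_powr_Suc) simp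
      qed
      moreover have "level i powr p' \<le> measure \<rho> {..level_pt i}"
        unfolding Gp using p' level_pt_le_iff[OF True, of i "level_pt i"] by (intro powr_mono2) auto
      ultimately have "1/2 * level i powr p' \<le> measure \<rho> (cell (Suc i))" by linarith
      then show ?thesis by (simp add: \<rho>.emeasure_eq_measure ennreal_leI del: ennreal_half)
    qed
    have \<sigma>pv: "\<sigma> t epowr p * v t = \<sigma> t" if "t \<in> {c..d}" for t
      using that
    proof (cases rule: v_cases)
      case 1 then show ?thesis using p' by (simp add: \<sigma>_def epowr_def)
    next
      case (2 r)
      have "\<sigma> t epowr p * v t = ennreal (r powr ((1 - p') * p) * r powr 1)"
        using 2 p' by (simp add: \<sigma>_def epowr_ennreal' epowr_ennreal powr_powr ennreal_mult)
      also have "r powr ((1 - p') * p) * r powr 1 = r powr (1 - p')"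
        unfolding powr_add[symmetric] using pp(3) by (simp add: add.commute)
      finally show ?thesis using 2 p' by (simp add: \<sigma>_def epowr_ennreal')
    qed
    have fp: "f t epowr p * v t = (\<Sum>i. a i epowr p * ennreal (level i powr - p') * (\<sigma> t * indicator (cell (Suc i)) t))"
      if t: "t \<in> {c..d}" for t
    proof (cases "\<exists>i. t \<in> cell (Suc i)")
      case ex: True
      then obtain i where i: "t \<in> cell (Suc i)" by auto
      then have iff: "t \<in> cell (Suc k) \<longleftrightarrow> k = i" for k using cell_unique by blast
      have fi: "f t = a i * ennreal (level i powr (1 - p')) * \<sigma> t"
        unfolding f_def by (rule trans[OF suminf_single[of i]]) (auto simp: iff)
      have "f t epowr p * v t = a i epowr p * ennreal (level i powr (1 - p')) epowr p * (\<sigma> t epowr p * v t)"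
        unfolding fi using p' by (simp add: epowr_mult mult.assoc)
      also have "ennreal (level i powr (1 - p')) epowr p = ennreal (level i powr - p')"
        using p' level_pos[OF True, of i] pp(1) by (simp add: epowr_ennreal powr_powr)
      also have "\<sigma> t epowr p * v t = \<sigma> t" by (rule \<sigma>pv[OF t])
      also have "a i epowr p * ennreal (level i powr - p') * \<sigma> t =
          (\<Sum>k. a k epowr p * ennreal (level k powr - p') * (\<sigma> t * indicator (cell (Suc k)) t))"
        by (rule trans[OF _ suminf_single[of i, symmetric]]) (auto simp: iff)
      finally show ?thesis .
    qed (use p' in \<open>simp add: f_def\<close>)
    have "(\<integral>\<^sup>+t. f t epowr p * v t \<partial>M) =
        (\<integral>\<^sup>+t. (\<Sum>i. a i epowr p * ennreal (level i powr - p') * (\<sigma> t * indicator (cell (Suc i)) t)) \<partial>M)"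
      using fp by (intro nn_integral_cong) simp
    also have "\<dots> = (\<Sum>i. a i epowr p * ennreal (level i powr - p') * emeasure \<rho> (cell (Suc i)))"
      by (subst nn_integral_suminf) (auto simp: nn_integral_cmult em)
    also have "\<dots> \<le> (\<Sum>i. a i epowr p)"
    proof (rule suminf_le_ennreal)
      fix i
      have "ennreal (level i powr - p') * emeasure \<rho> (cell (Suc i)) \<le> ennreal (level i powr - p') * ennreal (level i powr p')"
        by (intro mult_left_mono cell_le) simp
      also have "\<dots> = 1" using level_pos[OF True, of i] by (simp add: powr_minus flip: ennreal_mult)
      finally show "a i epowr p * ennreal (level i powr - p') * emeasure \<rho> (cell (Suc i)) \<le> a i epowr p"
        using mult_left_mono[of "ennreal (level i powr - p') * emeasure \<rho> (cell (Suc i))" 1 "a i epowr p"]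
        by (simp add: mult.assoc)
    qed
    finally have norm: "wfunctional (ennreal p) v {c..d} f \<le> (\<Sum>n. a n epowr p) epowr (1 / p)"
      unfolding wf using p' by (intro epowr_mono) auto
    have low: "ennreal (1/2) * cumul_step a (t - e) \<le> hardy {c..d} f t" if "t \<in> {c..d}" for t
    proof -
      have "ennreal (1/2) * cumul_step a (t - e) = (\<Sum>i. ennreal (1/2) * (a i * ennreal (level i) * indicator {t. level i \<le> G t} (t - e)))"
        unfolding cumul_step_def by (rule ennreal_suminf_cmult[symmetric])
      also have "\<dots> \<le> (\<Sum>i. \<integral>\<^sup>+s. a i * ennreal (level i powr (1 - p')) * \<sigma> s * indicator (cell (Suc i)) s * indicator {..t} s \<partial>M)"
      proof (rule suminf_le_ennreal)
        fix i
        show "ennreal (1/2) * (a i * ennreal (level i) * indicator {t. level i \<le> G t} (t - e)) \<le>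
          (\<integral>\<^sup>+s. a i * ennreal (level i powr (1 - p')) * \<sigma> s * indicator (cell (Suc i)) s * indicator {..t} s \<partial>M)"
        proof (cases "level i \<le> G (t - e)")
          case le: True
          have sub: "s \<le> t" if "s \<in> cell (Suc i)" for s
          proof (rule ccontr)
            assume "\<not> s \<le> t"
            then have "G (t - e) \<le> G s" using e by (intro mono) auto
            then show False using that le level_Suc[of i] by (auto simp: cell_def)
          qed
          have "ennreal (1/2) * (a i * ennreal (level i)) = a i * ennreal (level i powr (1 - p')) * ennreal (1/2 * level i powr p')"
          proof -
            have "level i = level i powr (1 - p') * level i powr p'"
              using level_pos[OF True, of i] by (simp flip: powr_add)
            then have "ennreal (level i) = ennreal (level i powr (1 - p')) * ennreal (level i powr p')"
              by (metis ennreal_mult powr_ge_zero)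
            moreover have "ennreal (1/2 * level i powr p') = ennreal (1/2) * ennreal (level i powr p')"
              by (rule ennreal_mult) auto
            ultimately show ?thesis by (simp only: mult_ac)
          qed
          also have "\<dots> \<le> a i * ennreal (level i powr (1 - p')) * emeasure \<rho> (cell (Suc i))"
            by (intro mult_left_mono cell_ge) simp
          also have "\<dots> = (\<integral>\<^sup>+s. a i * ennreal (level i powr (1 - p')) * (\<sigma> s * indicator (cell (Suc i)) s) \<partial>M)"
            by (subst nn_integral_cmult) (auto simp: em)
          also have "\<dots> = (\<integral>\<^sup>+s. a i * ennreal (level i powr (1 - p')) * \<sigma> s * indicator (cell (Suc i)) s * indicator {..t} s \<partial>M)"
            using sub by (intro nn_integral_cong) (auto simp: indicator_def mult_ac)
          finally show ?thesis using le by simp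
        qed simp
      qed
      also have "\<dots> = (\<integral>\<^sup>+s. (\<Sum>i. a i * ennreal (level i powr (1 - p')) * \<sigma> s * indicator (cell (Suc i)) s * indicator {..t} s) \<partial>M)"
        by (subst nn_integral_suminf) auto
      also have "\<dots> = hardy {c..d} f t"
        unfolding hardy_eq[OF Icc_sets_lebesgue] f_def by simp
      finally show ?thesis .
    qed
    show ?thesis using f_meas norm low by blast
  qed
  show ?thesis
    unfolding profile_scale_def
    using prof upper lower scale_axioms by (intro exI[of _ G]) blast
qed

end

context local_weight
begin

subsection \<open>The exponent one\<close>

lemma inv_esssup_le_iff:
  assumes "x \<le> d"
  shows "inv_esssup v c x \<le> \<phi> \<longleftrightarrow> (AE t in M. c < t \<and> t < x \<longrightarrow> 1 / v t \<le> \<phi>)"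
proof -
  have sub: "{c<..<x} \<subseteq> {c..d}" using assms by auto
  have rs: "lebesgue_on {c<..<x} = restrict_space M {c<..<x}"
    using sub by (simp add: restrict_restrict_space Int_absorb1)
  have meas: "(\<lambda>t. 1 / v t) \<in> borel_measurable (lebesgue_on {c<..<x})"
    unfolding rs by (rule measurable_restrict_space1) measurable
  have AE: "(AE t in lebesgue_on {c<..<x}. P t) \<longleftrightarrow> (AE t in M. c < t \<and> t < x \<longrightarrow> P t)" for P
    unfolding rs by (subst AE_restrict_space_iff) (use sub in \<open>auto simp: sets_restrict_space_iff\<close>)
  show ?thesis
  proof
    assume le: "inv_esssup v c x \<le> \<phi>"
    have "AE t in lebesgue_on {c<..<x}. 1 / v t \<le> inv_esssup v c x"
      unfolding inv_esssup_def by (rule esssup_AE)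
    then have "AE t in lebesgue_on {c<..<x}. 1 / v t \<le> \<phi>"
      by (rule AE_mp) (use le in \<open>auto intro!: AE_I2\<close>)
    then show "AE t in M. c < t \<and> t < x \<longrightarrow> 1 / v t \<le> \<phi>" unfolding AE .
  next
    assume "AE t in M. c < t \<and> t < x \<longrightarrow> 1 / v t \<le> \<phi>"
    then have "AE t in lebesgue_on {c<..<x}. 1 / v t \<le> \<phi>" unfolding AE .
    then show "inv_esssup v c x \<le> \<phi>"
      unfolding inv_esssup_def by (intro esssup_I meas)
  qed
qed

lemma inv_esssup_AE: "x \<le> d \<Longrightarrow> AE t in M. c < t \<and> t < x \<longrightarrow> 1 / v t \<le> inv_esssup v c x"
  using inv_esssup_le_iff[of x "inv_esssup v c x"] by simp

lemma inv_esssup_mono: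
  assumes "x \<le> y" "y \<le> d" shows "inv_esssup v c x \<le> inv_esssup v c y"
proof -
  have "AE t in M. c < t \<and> t < x \<longrightarrow> 1 / v t \<le> inv_esssup v c y"
    by (rule AE_mp[OF inv_esssup_AE[OF assms(2)]]) (use assms in \<open>auto intro!: AE_I2\<close>)
  then show ?thesis using assms by (subst inv_esssup_le_iff) auto
qed

lemma inv_esssup_finite: assumes "x \<le> d" shows "inv_esssup v c x \<le> ennreal (1 / \<delta>)"
proof -
  have "1 / v t \<le> ennreal (1 / \<delta>)" if "t \<in> {c..d}" for t
    using that
  proof (cases rule: v_cases)
    case (2 r)
    then show ?thesis using \<delta>_pos by (simp add: divide_ennreal[of 1 r, simplified] frac_le)
  qed simp
  then show ?thesis using assms by (subst inv_esssup_le_iff) (auto intro!: AE_I2)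
qed

lemma profile_1_eq_INF:
  assumes "c \<le> x" "x < d" shows "profile 1 v c d x = (INF y\<in>{x<..d}. inv_esssup v c y)"
proof -
  let ?L = "INF y\<in>{x<..d}. inv_esssup v c y"
  have "(inv_esssup v c \<longlongrightarrow> ?L) (at_right x)"
  proof (rule order_tendstoI)
    fix a assume a: "a < ?L"
    have "a < inv_esssup v c y" if "x < y" "y < d" for y
      using a that by (meson INF_lower greaterThanAtMost_iff less_imp_le less_le_trans)
    then show "\<forall>\<^sub>F y in at_right x. a < inv_esssup v c y"
      using assms by (auto simp: eventually_at_right)
  next
    fix a assume "?L < a"
    then obtain y0 where y0: "x < y0" "y0 \<le> d" "inv_esssup v c y0 < a" by (auto simp: INF_less_iff)
    have "inv_esssup v c y < a" if "y < y0" for y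
      using inv_esssup_mono[of y y0] that y0 by auto
    then show "\<forall>\<^sub>F y in at_right x. inv_esssup v c y < a"
      using y0 by (auto simp: eventually_at_right)
  qed
  then have "Lim (at_right x) (inv_esssup v c) = ?L" by (intro tendsto_Lim) auto
  then show ?thesis using assms by (simp add: profile_def)
qed

lemma profile_1_end: "profile 1 v c d d = inv_esssup v c d"
  by (simp add: profile_def)

text \<open>
  The normalised indicator of the set where 1 / v exceeds l, which has positive measure left of
  x.
\<close>

lemma test_function:
  assumes x: "x \<le> d" and l: "0 < l" "ennreal l < inv_esssup v c x"
  shows "\<exists>h\<in>borel_measurable M. (\<integral>\<^sup>+t. h t * v t \<partial>M) \<le> 1 \<and>
    (\<forall>t\<ge>x. ennreal l \<le> (\<integral>\<^sup>+s. h s * indicator {..t} s \<partial>M))"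
proof -
  define S where "S = {t \<in> space M. c < t \<and> t < x \<and> ennreal l < 1 / v t}"
  have [measurable]: "(\<lambda>t. t) \<in> borel_measurable M" by (rule id_measurable_lebesgue_on)
  have S [measurable]: "S \<in> sets M" unfolding S_def by measurable
  have "emeasure M S \<noteq> 0"
  proof
    assume "emeasure M S = 0"
    then have "AE t in M. t \<notin> S" by (intro AE_not_in) (auto simp: null_sets_def)
    then have "AE t in M. c < t \<and> t < x \<longrightarrow> 1 / v t \<le> ennreal l"
      by (rule AE_mp) (auto simp: S_def not_less intro!: AE_I2)
    then have "inv_esssup v c x \<le> ennreal l" using x by (simp add: inv_esssup_le_iff)
    with l show False by simp
  qed
  moreover have "emeasure M S \<le> emeasure M {c..d}"
    by (rule emeasure_mono) (auto simp: S_def sets_restrict_space_iff)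
  then have "emeasure M S < top" using emeasure_M_finite by (rule le_less_trans)
  ultimately obtain m where m: "emeasure M S = ennreal m" "0 < m"
    by (cases "emeasure M S") auto
  define h where "h t = ennreal (l / m) * indicator S t" for t
  have hm: "h \<in> borel_measurable M" unfolding h_def[abs_def] by measurable
  have "(\<integral>\<^sup>+t. h t * v t \<partial>M) \<le> (\<integral>\<^sup>+t. ennreal (1 / m) * indicator S t \<partial>M)"
  proof (rule nn_integral_mono)
    fix t assume t: "t \<in> space M"
    show "h t * v t \<le> ennreal (1 / m) * indicator S t"
    proof (cases "t \<in> S")
      case True
      from t have "t \<in> {c..d}" by simp
      then have "ennreal l * v t \<le> 1"
      proof (cases rule: v_cases)
        case 1
        then show ?thesis using True l by (simp add: S_def)
      next
        case (2 r)
        then have "ennreal l < ennreal (1 / r)" using True by (simp add: S_def divide_ennreal[of 1 r, simplified])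
        then have "l * r \<le> 1" using 2 l by (simp add: ennreal_less_iff field_simps)
        then show ?thesis using 2 l by (simp add: ennreal_le_1 flip: ennreal_mult)
      qed
      then have "ennreal (1 / m) * (ennreal l * v t) \<le> ennreal (1 / m) * 1" by (rule mult_left_mono) simp
      moreover have "ennreal (l / m) = ennreal (1 / m) * ennreal l" using m l by (simp flip: ennreal_mult)
      ultimately show ?thesis using True by (simp add: h_def mult.assoc)
    qed (simp add: h_def)
  qed
  also have "\<dots> = ennreal (1 / m) * emeasure M S" by (rule nn_integral_cmult_indicator) (rule S)
  also have "\<dots> = 1" using m by (simp flip: ennreal_mult)
  finally have norm: "(\<integral>\<^sup>+t. h t * v t \<partial>M) \<le> 1" .
  have "ennreal l \<le> (\<integral>\<^sup>+s. h s * indicator {..t} s \<partial>M)" if "x \<le> t" for t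
  proof -
    have "(\<integral>\<^sup>+s. h s * indicator {..t} s \<partial>M) = (\<integral>\<^sup>+s. ennreal (l / m) * indicator S s \<partial>M)"
      using that by (intro nn_integral_cong) (auto simp: h_def S_def indicator_def)
    also have "\<dots> = ennreal (l / m) * emeasure M S" by (rule nn_integral_cmult_indicator) (rule S)
    also have "\<dots> = ennreal l" using m l by (simp flip: ennreal_mult)
    finally show ?thesis by simp
  qed
  with hm norm show ?thesis by blast
qed

text \<open>
  The profile is the right-continuous version of the essential supremum of 1 / v over (c,x), so
  near a jump the set where 1 / v is large may lie entirely to the right of the jump.  The test
  function for level n is therefore only supported left of the n-th level point plus e, and f is
  the combination of these test functions with coefficients a n.
\<close>

lemma profile_scale_1: "\<exists>G. profile_scale 1 v c d G"
proof -
  define P where "P = profile 1 v c d"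
  have F_le_P: "inv_esssup v c x \<le> P x" if "c \<le> x" "x \<le> d" for x
  proof (cases "x = d")
    case False
    then show ?thesis unfolding P_def using that
      by (subst profile_1_eq_INF) (auto intro!: INF_greatest inv_esssup_mono)
  qed (simp add: P_def profile_1_end)
  have P_le_F: "P x \<le> inv_esssup v c y" if "c \<le> x" "x < y" "y \<le> d" for x y
    unfolding P_def using that by (subst profile_1_eq_INF) (auto intro!: INF_lower)
  have P_end: "P d = inv_esssup v c d" by (simp add: P_def profile_1_end)
  have P_fin: "P x \<le> ennreal (1 / \<delta>)" if "c \<le> x" "x \<le> d" for x
    using that P_le_F[of x d] inv_esssup_finite[of d] P_end by (cases "x = d") auto
  have P_mono: "P x \<le> P y" if "c \<le> x" "x \<le> y" "y \<le> d" for x y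
    using that P_le_F[of x y] F_le_P[of y] by (cases "x = y") auto
  define G where "G x = (if x < c then 0 else enn2real (P (min x d)))" for x
  have GP: "P x = ennreal (G x)" if "c \<le> x" "x \<le> d" for x
  proof -
    have "P x < top" using P_fin[OF that] by (rule le_less_trans) simp
    then show ?thesis using that by (simp add: G_def less_top)
  qed
  interpret scale G c d
  proof
    show "c \<le> d" using c_less_d by simp
    show G_mono: "G x \<le> G y" if "x \<le> y" for x y
    proof (cases "x < c")
      case False
      have "P (min y d) < top" using P_fin[of "min y d"] False that c_less_d by (auto intro: le_less_trans)
      then show ?thesis using False that c_less_d P_mono[of "min x d" "min y d"]
        by (auto simp: G_def intro!: enn2real_mono)
    qed (simp add: G_def)
    show "G x = 0" if "x < c" for x using that by (simp add: G_def)
    show "G x = G d" if "d \<le> x" for x using that c_less_d by (simp add: G_def)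
    show "continuous (at_right a) G" for a
    proof (rule mono_right_contI[OF G_mono])
      fix e assume e: "G a < e"
      consider "a < c" | "c \<le> a" "a < d" | "d \<le> a" by linarith
      then show "\<exists>y>a. G y < e"
      proof cases
        case 1
        then obtain y where "a < y" "y < c" using dense by blast
        then show ?thesis using e 1 by (intro exI[of _ y]) (simp add: G_def)
      next
        case 2
        have "0 \<le> G a" by (simp add: G_def)
        then have "P a < ennreal e" unfolding GP[OF 2(1) less_imp_le[OF 2(2)]] using e by (simp add: ennreal_less_iff)
        then obtain y0 where y0: "a < y0" "y0 \<le> d" "inv_esssup v c y0 < ennreal e"
          using 2 by (auto simp: P_def profile_1_eq_INF INF_less_iff)
        obtain y where y: "a < y" "y < y0" using dense y0(1) by blast
        have "P y < ennreal e" using P_le_F[of y y0] y y0 2 by auto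
        then have "ennreal (G y) < ennreal e" using GP[of y] y y0 2 by simp
        then have "G y < e" by (metis ennreal_leI not_less)
        then show ?thesis using y by blast
      next
        case 3
        then show ?thesis using e c_less_d by (intro exI[of _ "a + 1"]) (simp add: G_def)
      qed
    qed
  qed
  have wf: "wfunctional (ennreal 1) v {c..d} f = (\<integral>\<^sup>+t. f t * v t \<partial>M)" for f
    by (simp add: wfunctional_eq)
  have Hoelder: "(\<integral>\<^sup>+t. g t * indicator {..y} t \<partial>M) \<le> ennreal \<phi> * (\<integral>\<^sup>+t. g t * v t \<partial>M)"
    if [measurable]: "g \<in> borel_measurable M" and gfin: "(\<integral>\<^sup>+t. g t * v t \<partial>M) < top"
      and y: "c \<le> y" "y \<le> d" "0 \<le> \<phi>" "\<And>t. t < y \<Longrightarrow> G t \<le> \<phi>" for g y \<phi>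
  proof -
    \<comment> \<open>Approach y from the left: G is bounded by \<phi> only at points strictly
    before y.\<close>
    have "AE t in M. c < t \<and> t < y - 1 / Suc n \<longrightarrow> 1 / v t \<le> ennreal \<phi>" for n
    proof (cases "c \<le> y - 1 / Suc n")
      case True
      have le: "y - 1 / Suc n < y" "y - 1 / Suc n \<le> d" using y(2) by (auto intro: order_trans[of _ y])
      have "inv_esssup v c (y - 1 / Suc n) \<le> ennreal \<phi>"
        using F_le_P[OF True le(2)] GP[OF True le(2)] ennreal_leI[OF y(4)[OF le(1)]] by simp
      then show ?thesis using le by (simp add: inv_esssup_le_iff)
    qed (auto intro!: AE_I2)
    then have "AE t in M. \<forall>n. c < t \<and> t < y - 1 / Suc n \<longrightarrow> 1 / v t \<le> ennreal \<phi>"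
      unfolding AE_all_countable by blast
    moreover have "AE t in M. v t = top \<longrightarrow> g t = 0"
      using AE_finite_weight[of g 1] gfin by simp
    ultimately have "AE t in M. g t * indicator {..y} t \<le> ennreal \<phi> * (g t * v t)"
      using AE_M_neq[of c] AE_M_neq[of y] AE_space
    proof eventually_elim
      case (elim t)
      show ?case
      proof (cases "t \<in> {c..d} \<and> t \<le> y")
        case True
        then have t: "c < t" "t < y" "t \<in> {c..d}" using elim by auto
        then obtain n where "1 / Suc n < y - t" using nat_approx_posE[of "y - t"] by auto
        then have le: "1 / v t \<le> ennreal \<phi>" using elim(1) t by (auto simp: algebra_simps)
        from t(3) have "g t \<le> ennreal \<phi> * (g t * v t)"
        proof (cases rule: v_cases)
          case 1 then show ?thesis using elim(2) by simp
        next
          case (2 r)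
          then have "ennreal (1 / r) \<le> ennreal \<phi>" using le by (simp add: divide_ennreal[of 1 r, simplified])
          then have "1 \<le> \<phi> * r" using 2 y(3) by (simp add: ennreal_le_iff field_simps)
          then have "g t * 1 \<le> g t * ennreal (\<phi> * r)" by (intro mult_left_mono) auto
          then show ?thesis using 2 y(3) by (simp add: ennreal_mult mult_ac)
        qed
        then show ?thesis using True by simp
      next
        case False
        then show ?thesis
          using elim by (cases "t \<le> y") (auto simp: indicator_def)
      qed
    qed
    then have "(\<integral>\<^sup>+t. g t * indicator {..y} t \<partial>M) \<le> (\<integral>\<^sup>+t. ennreal \<phi> * (g t * v t) \<partial>M)"
      by (rule nn_integral_mono_AE)
    also have "\<dots> = ennreal \<phi> * (\<integral>\<^sup>+t. g t * v t \<partial>M)" by (rule nn_integral_cmult) measurable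
    finally show ?thesis .
  qed
  have upper: "\<exists>a. (\<Sum>n. a n epowr 1) epowr (1 / 1) \<le> 4 * wfunctional (ennreal 1) v {c..d} f \<and>
        (\<forall>t\<in>{c..d}. hardy {c..d} f t \<le> cell_step a t)"
    if "f \<in> borel_measurable M" "wfunctional (ennreal 1) v {c..d} f < top" for f
    using hardy_le_cell_step[of 1 f v] that Hoelder unfolding wf by simp
  have lower: "\<exists>f\<in>borel_measurable M. wfunctional (ennreal 1) v {c..d} f \<le> (\<Sum>n. a n epowr 1) epowr (1 / 1) \<and>
      (\<forall>t\<in>{c..d}. ennreal (1/2) * cumul_step a (t - e) \<le> hardy {c..d} f t)" if e: "0 < e" for a e
  proof (cases "0 < G d")
    case False
    then have "G d = 0" using nonneg[of d] by linarith
    then have "cumul_step a t = 0" for t by (simp add: cumul_step_def level_def)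
    then show ?thesis by (intro bexI[of _ "\<lambda>_. 0"]) (auto simp: wf[simplified])
  next
    case True
    have "\<exists>h\<in>borel_measurable M. (\<integral>\<^sup>+t. h t * v t \<partial>M) \<le> 1 \<and>
      (\<forall>t\<in>{c..d}. level_pt n + e \<le> t \<longrightarrow> ennreal (level n / 2) \<le> (\<integral>\<^sup>+s. h s * indicator {..t} s \<partial>M))" for n
    proof (cases "level_pt n + e \<le> d")
      case le: True
      have b: "c \<le> level_pt n" "level_pt n \<le> d" using level_pt_bounds[OF True, of n] by auto
      have "ennreal (level n / 2) < ennreal (level n)" using level_pos[OF True, of n] by (intro ennreal_lessI) auto
      also have "\<dots> \<le> ennreal (G (level_pt n))" using level_pt_le_iff[OF True, of n "level_pt n"] by (intro ennreal_leI) simp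
      also have "\<dots> = P (level_pt n)" using GP[OF b] by simp
      also have "\<dots> \<le> inv_esssup v c (level_pt n + e)" using b le e by (intro P_le_F) auto
      finally obtain h where "h \<in> borel_measurable M" "(\<integral>\<^sup>+t. h t * v t \<partial>M) \<le> 1"
          "\<forall>t\<ge>level_pt n + e. ennreal (level n / 2) \<le> (\<integral>\<^sup>+s. h s * indicator {..t} s \<partial>M)"
        using test_function[OF le, of "level n / 2"] level_pos[OF True, of n] by auto
      then show ?thesis by blast
    next
      case False
      then show ?thesis by (intro bexI[of _ "\<lambda>_. 0"]) auto
    qed
    then obtain h where h [measurable]: "\<And>n. h n \<in> borel_measurable M" and h1: "\<And>n. (\<integral>\<^sup>+t. h n t * v t \<partial>M) \<le> 1"
      and h2: "\<And>n t. t \<in> {c..d} \<Longrightarrow> level_pt n + e \<le> t \<Longrightarrow> ennreal (level n / 2) \<le> (\<integral>\<^sup>+s. h n s * indicator {..t} s \<partial>M)"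
      by metis
    define f where "f t = (\<Sum>n. a n * h n t)" for t
    have f_meas [measurable]: "f \<in> borel_measurable M" unfolding f_def[abs_def] by measurable
    have "(\<integral>\<^sup>+t. f t * v t \<partial>M) = (\<integral>\<^sup>+t. (\<Sum>n. a n * (h n t * v t)) \<partial>M)"
      by (simp add: f_def mult.assoc flip: ennreal_suminf_multc)
    also have "\<dots> = (\<Sum>n. a n * (\<integral>\<^sup>+t. h n t * v t \<partial>M))"
      by (subst nn_integral_suminf) (auto simp: nn_integral_cmult)
    also have "\<dots> \<le> (\<Sum>n. a n * 1)" by (intro suminf_le_ennreal mult_left_mono h1) simp
    finally have norm: "wfunctional (ennreal 1) v {c..d} f \<le> (\<Sum>n. a n epowr 1) epowr (1 / 1)"
      unfolding wf by simp
    have "ennreal (1/2) * cumul_step a (t - e) \<le> hardy {c..d} f t" if t: "t \<in> {c..d}" for t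
    proof -
      have "ennreal (1/2) * cumul_step a (t - e) = (\<Sum>n. ennreal (1/2) * (a n * ennreal (level n) * indicator {t. level n \<le> G t} (t - e)))"
        unfolding cumul_step_def by (rule ennreal_suminf_cmult[symmetric])
      also have "\<dots> \<le> (\<Sum>n. a n * (\<integral>\<^sup>+s. h n s * indicator {..t} s \<partial>M))"
      proof (rule suminf_le_ennreal)
        fix n
        show "ennreal (1/2) * (a n * ennreal (level n) * indicator {t. level n \<le> G t} (t - e)) \<le>
            a n * (\<integral>\<^sup>+s. h n s * indicator {..t} s \<partial>M)"
        proof (cases "level n \<le> G (t - e)")
          case le: True
          then have "level_pt n + e \<le> t" using level_pt_le_iff[OF True, of n "t - e"] by simp
          then have "a n * ennreal (level n / 2) \<le> a n * (\<integral>\<^sup>+s. h n s * indicator {..t} s \<partial>M)"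
            by (intro mult_left_mono h2 t) auto
          moreover have "ennreal (level n / 2) = ennreal (1/2) * ennreal (level n)"
            by (subst ennreal_mult[symmetric]) auto
          ultimately show ?thesis using le by (simp add: mult_ac)
        qed simp
      qed
      also have "\<dots> = (\<integral>\<^sup>+s. (\<Sum>n. a n * (h n s * indicator {..t} s)) \<partial>M)"
        by (subst nn_integral_suminf) (auto simp: nn_integral_cmult)
      also have "\<dots> = hardy {c..d} f t"
        unfolding hardy_eq[OF Icc_sets_lebesgue] f_def by (simp add: mult.assoc flip: ennreal_suminf_multc)
      finally show ?thesis .
    qed
    with f_meas norm show ?thesis by blast
  qed
  show ?thesis
    unfolding profile_scale_def
    using GP upper lower scale_axioms by (intro exI[of _ G]) (auto simp: P_def)
qed

subsection \<open>The exponent infinity\<close>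

lemma wfunctional_top: "wfunctional top v {c..d} f = esssup M (\<lambda>t. f t * v t)"
  by (simp add: wfunctional_def)

lemma profile_top: "x \<in> {c..d} \<Longrightarrow> profile top v c d x = hardy {c..d} (\<lambda>t. 1 / v t) x"
proof -
  assume "x \<in> {c..d}"
  then have eq: "{c..d} \<inter> {..x} = {c..x}" by auto
  show ?thesis unfolding profile_def hardy_def eq by simp
qed

lemma inverse_weight_norm: "wfunctional top v {c..d} (\<lambda>t. 1 / v t) \<le> 1"
  unfolding wfunctional_top
proof (rule esssup_I)
  show "AE t in M. 1 / v t * v t \<le> 1"
  proof (rule AE_I2)
    fix t assume "t \<in> space M"
    then have "t \<in> {c..d}" by simp
    then show "1 / v t * v t \<le> 1"
    proof (cases rule: v_cases)
      case (2 r)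
      then show ?thesis by (simp add: divide_ennreal[of 1 r, simplified] flip: ennreal_mult)
    qed simp
  qed
qed measurable

text \<open>
  Pointwise f \<le> N / v with the norm N of f, so 1 / v is extremal and no constant is lost.
\<close>

lemma hardy_le_profile_top:
  assumes [measurable]: "f \<in> borel_measurable M" and fin: "wfunctional top v {c..d} f < top" and x: "x \<in> {c..d}"
  shows "hardy {c..d} f x \<le> profile top v c d x * wfunctional top v {c..d} f"
proof -
  let ?N = "wfunctional top v {c..d} f"
  have "AE t in M. f t * v t \<le> ?N" unfolding wfunctional_top by (rule esssup_AE)
  then have "AE t in M. f t * indicator {..x} t \<le> (1 / v t) * indicator {..x} t * ?N"
  proof (rule AE_mp, intro AE_I2 impI)
    fix t assume "t \<in> space M" and le: "f t * v t \<le> ?N"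
    then have "t \<in> {c..d}" by simp
    then have "f t \<le> (1 / v t) * ?N"
    proof (cases rule: v_cases)
      case 1
      then have "f t * top < top" using le_less_trans[OF le fin] by simp
      then have "f t = 0" by (simp add: ennreal_mult_top split: if_splits)
      then show ?thesis by simp
    next
      case (2 r)
      have "f t = ennreal (1 / r) * (f t * v t)" using 2 by (simp add: mult.left_commute flip: ennreal_mult)
      also have "\<dots> \<le> ennreal (1 / r) * ?N" by (rule mult_left_mono[OF le]) simp
      finally show ?thesis using 2 by (simp add: divide_ennreal[of 1 r, simplified])
    qed
    then show "f t * indicator {..x} t \<le> (1 / v t) * indicator {..x} t * ?N"
      by (auto simp: indicator_def)
  qed
  then have "(\<integral>\<^sup>+t. f t * indicator {..x} t \<partial>M) \<le> (\<integral>\<^sup>+t. (1 / v t) * indicator {..x} t * ?N \<partial>M)"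
    by (rule nn_integral_mono_AE)
  also have "\<dots> = (\<integral>\<^sup>+t. (1 / v t) * indicator {..x} t \<partial>M) * ?N" by (rule nn_integral_multc) measurable
  finally show ?thesis unfolding profile_top[OF x] hardy_eq[OF Icc_sets_lebesgue] .
qed

theorem ex_profile_scale:
  assumes "1 \<le> p" shows "\<exists>G. profile_scale p v c d G"
  using profile_scale_1 profile_scale_gt_1[of p] assms by (cases "p = 1") auto

end

section \<open>Necessary and sufficient conditions in the sequence model\<close>

lemma epowr_root_le:
  assumes "0 < s" "0 \<le> k" "x \<le> ennreal k * C epowr s" shows "x epowr (1 / s) \<le> ennreal (k powr (1 / s)) * C"
proof -
  have "x epowr (1 / s) \<le> (ennreal k * C epowr s) epowr (1 / s)" using assms by (intro epowr_mono) auto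
  then show ?thesis using assms by (simp add: epowr_mult epowr_ennreal)
qed

text \<open>
  The constants below are the roots of those in the linear and bilinear estimates, so that the
  conditions become homogeneous of degree one in C.
\<close>

definition hat_const :: "real \<Rightarrow> real \<Rightarrow> real" where
  "hat_const q r = (2 powr r * (1 / (1 - (1/2) powr q)) powr (r / q) * 2 powr r) powr (1 / r)"

definition int_const :: "real \<Rightarrow> real \<Rightarrow> real \<Rightarrow> real" where
  "int_const q r \<kappa> = (2 powr \<kappa> * (1 / (1 - (1/2) powr r)) powr (\<kappa> / r) *
      (2 powr r * (1 / (1 - (1/2) powr q)) powr (r / q)) powr (\<kappa> / r)) powr (1 / \<kappa>)"

definition suf_const :: "real \<Rightarrow> real" where
  "suf_const r = (1 / (1 - (1/2) powr r)) powr (1 / r)"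

definition stair_const :: "real \<Rightarrow> real \<Rightarrow> real \<Rightarrow> real" where
  "stair_const q r p = suf_const r * 2 powr (1 / p)"

definition rows_const :: "real \<Rightarrow> real" where
  "rows_const \<kappa> = (2 powr \<kappa> / (1 - (1/2) powr \<kappa>)) powr (1 / \<kappa>)"

lemma suf_const: "0 < r \<Longrightarrow> 0 < suf_const r"
  using powr_half_less_1[of r] by (simp add: suf_const_def)

lemma suf_const_epowr: "0 < q \<Longrightarrow> 0 < r \<Longrightarrow> ennreal (suf_const r) epowr q = ennreal ((1 / (1 - (1/2) powr r)) powr (q / r))"
  using powr_half_less_1[of r] by (simp add: suf_const_def epowr_ennreal powr_powr)

lemma stair_const_epowr:
  assumes "0 < q" "0 < r" "0 < p"
  shows "ennreal (stair_const q r p) epowr q = ennreal ((1 / (1 - (1/2) powr r)) powr (q / r) * 2 powr (q / p))"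
  using assms powr_half_less_1[of r]
  by (simp add: stair_const_def suf_const_def epowr_ennreal powr_powr powr_mult)

lemma add_epowr_le:
  assumes "0 < q" shows "x epowr q + y epowr q \<le> (ennreal (2 powr (1 / q)) * (x + y)) epowr q"
proof -
  have "x epowr q + y epowr q \<le> (x + y) epowr q + (x + y) epowr q"
    using assms by (intro add_mono epowr_mono) auto
  also have "\<dots> = ennreal 2 * (x + y) epowr q" by (simp add: mult_2[symmetric])
  also have "ennreal 2 = ennreal (2 powr (1 / q)) epowr q" using assms by (simp add: epowr_ennreal powr_powr)
  finally show ?thesis using assms by (simp add: epowr_mult)
qed

context two_scales
begin

lemma necessary_char1:
  assumes q: "0 < q" "0 < p1" "0 < p2" and bd: "bilinear_bound q p1 p2 (C epowr q)"
  shows "tail x epowr (1 / q) * ennreal (G1 x) * ennreal (G2 x) \<le> 4 * C"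
proof -
  have "((ennreal (G1 x) * ennreal (G2 x)) epowr q * tail x) epowr (1 / q) \<le> ennreal ((2 powr q * 2 powr q) powr (1 / q)) * C"
    by (rule epowr_root_le[OF q(1) _ necessary_sup[OF q bd]]) simp
  also have "(2 powr q * 2 powr q) powr (1 / q) = (4::real)"
    using q by (simp add: powr_powr powr_mult)
  finally show ?thesis using q by (simp add: epowr_mult mult_ac)
qed

lemma necessary_char_hat:
  assumes q: "0 < q" "0 < p1" "q < p2" "1 / r = 1 / q - 1 / p2" and r: "0 < r"
    and bd: "bilinear_bound q p1 p2 (C epowr q)" and C: "C < top"
  shows "ennreal (G1 x) * (\<integral>\<^sup>+t. tail (max x t) epowr (r / q) \<partial>B.mu r) epowr (1 / r) \<le> ennreal (hat_const q r) * C"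
proof -
  have "ennreal (G1 x) epowr r * (\<integral>\<^sup>+t. tail (max x t) epowr (r / q) \<partial>B.mu r) \<le>
    ennreal (2 powr r * (1 / (1 - (1/2) powr q)) powr (r / q) * 2 powr r) * (C epowr q) epowr (r / q)"
    using C q by (intro necessary_hat[OF q r bd]) simp
  also have "(C epowr q) epowr (r / q) = C epowr r" using q r by (simp add: epowr_epowr)
  finally have "(ennreal (G1 x) epowr r * (\<integral>\<^sup>+t. tail (max x t) epowr (r / q) \<partial>B.mu r)) epowr (1 / r) \<le>
      ennreal (hat_const q r) * C"
    unfolding hat_const_def by (intro epowr_root_le r) auto
  then show ?thesis using r by (simp add: epowr_mult)
qed

text \<open>
  The half-lines of the two staircase characteristics are closed and open; both are contained in
  the closed one.
\<close>

lemma necessary_char_tail: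
  assumes q: "0 < q" "0 < p1" "q < p2" "1 / r = 1 / q - 1 / p2" and r: "0 < r"
    and bd: "bilinear_bound q p1 p2 (C epowr q)" and C: "C < top" and S: "S \<subseteq> {x..}"
  shows "ennreal (G1 x) * tail_mu q r S epowr (1 / r) \<le> ennreal (hat_const q r) * C"
proof -
  have "tail_mu q r S \<le> (\<integral>\<^sup>+t. tail (max x t) epowr (r / q) \<partial>B.mu r)"
    using tail_mu_mono[OF S] tail_mu_le_hat[OF q(1) r] by (rule order_trans)
  then have "ennreal (G1 x) * tail_mu q r S epowr (1 / r) \<le>
      ennreal (G1 x) * (\<integral>\<^sup>+t. tail (max x t) epowr (r / q) \<partial>B.mu r) epowr (1 / r)"
    using r by (intro mult_left_mono epowr_mono) auto
  also have "\<dots> \<le> ennreal (hat_const q r) * C" by (rule necessary_char_hat[OF q r bd C])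
  finally show ?thesis .
qed

lemma necessary_char_int:
  assumes q: "0 < q" "q < p1" "q < p2" and r: "1 / r = 1 / q - 1 / p2" "0 < r" "r < p1"
    and \<kappa>: "1 / \<kappa> = 1 / r - 1 / p1" "0 < \<kappa>"
    and bd: "bilinear_bound q p1 p2 (C epowr q)" and C: "C < top"
    and S: "\<And>x. S x \<subseteq> {x..}"
  shows "(\<integral>\<^sup>+x. tail_mu q r (S x) epowr (\<kappa> / r) \<partial>A.mu \<kappa>) epowr (1 / \<kappa>) \<le> ennreal (int_const q r \<kappa>) * C"
proof -
  have "(\<integral>\<^sup>+x. tail_mu q r (S x) epowr (\<kappa> / r) \<partial>A.mu \<kappa>) \<le> (\<integral>\<^sup>+x. tail_mu q r {x..} epowr (\<kappa> / r) \<partial>A.mu \<kappa>)"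
    using r \<kappa> by (intro nn_integral_mono epowr_mono tail_mu_mono S) auto
  also have "\<dots> \<le> ennreal (2 powr \<kappa> * (1 / (1 - (1/2) powr r)) powr (\<kappa> / r) *
      (2 powr r * (1 / (1 - (1/2) powr q)) powr (r / q)) powr (\<kappa> / r)) * (C epowr q) epowr (\<kappa> / q)"
    using C q by (intro necessary_int[OF q r \<kappa> bd]) simp
  also have "(C epowr q) epowr (\<kappa> / q) = C epowr \<kappa>" using q \<kappa> by (simp add: epowr_epowr)
  finally show ?thesis unfolding int_const_def by (intro epowr_root_le \<kappa>) auto
qed

text \<open>
  The counterpart of bilinear_bound for functions with one value per cell, required for all
  sequences and homogeneous of degree one in K.
\<close>

definition upper_bound :: "real \<Rightarrow> real \<Rightarrow> real \<Rightarrow> ennreal \<Rightarrow> bool" where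
  "upper_bound q p1 p2 K \<longleftrightarrow> (\<forall>a b. (\<integral>\<^sup>+t. A.cell_step a t epowr q * B.cell_step b t epowr q \<partial>\<nu>) \<le>
    K epowr q * (\<Sum>n. a n epowr p1) epowr (q / p1) * (\<Sum>n. b n epowr p2) epowr (q / p2))"

lemma upper_bound_swap:
  assumes "two_scales.upper_bound G2 G1 d \<nu> q p2 p1 K" shows "upper_bound q p1 p2 K"
  unfolding upper_bound_def
proof (intro allI)
  fix a b :: "nat \<Rightarrow> ennreal"
  have "(\<integral>\<^sup>+t. B.cell_step b t epowr q * A.cell_step a t epowr q \<partial>\<nu>) \<le>
    K epowr q * (\<Sum>n. b n epowr p2) epowr (q / p2) * (\<Sum>n. a n epowr p1) epowr (q / p1)"
    using assms unfolding two_scales.upper_bound_def[OF swap] by blast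
  then show "(\<integral>\<^sup>+t. A.cell_step a t epowr q * B.cell_step b t epowr q \<partial>\<nu>) \<le>
    K epowr q * (\<Sum>n. a n epowr p1) epowr (q / p1) * (\<Sum>n. b n epowr p2) epowr (q / p2)"
    by (simp only: mult_ac)
qed

lemma sufficient_char1:
  assumes q: "0 < q" "0 < p1" "p1 \<le> q" "0 < p2" "p2 \<le> q"
    and K: "\<And>x. x \<in> {c..d} \<Longrightarrow> tail x epowr (1 / q) * ennreal (G1 x) * ennreal (G2 x) \<le> K"
  shows "upper_bound q p1 p2 K"
  unfolding upper_bound_def
proof (intro allI sufficient_sup[OF q])
  fix x assume "x \<in> {c..d}"
  then have "(tail x epowr (1 / q) * ennreal (G1 x) * ennreal (G2 x)) epowr q \<le> K epowr q"
    using q K by (intro epowr_mono) auto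
  then show "(ennreal (G1 x) * ennreal (G2 x)) epowr q * tail x \<le> K epowr q"
    using q by (simp add: epowr_mult mult_ac)
qed

lemma sufficient_char_hat:
  assumes q: "0 < q" "q < p1" "1 / r = 1 / q - 1 / p1" "0 < p2" "p2 \<le> q" and r: "0 < r"
    and K: "\<And>x. x \<in> {c..d} \<Longrightarrow> ennreal (G2 x) * (\<integral>\<^sup>+t. tail (max x t) epowr (r / q) \<partial>A.mu r) epowr (1 / r) \<le> K"
  shows "upper_bound q p1 p2 (ennreal (suf_const r) * K)"
  unfolding upper_bound_def using sufficient_hat[OF q r K] q r
  by (simp add: epowr_mult suf_const_epowr)

text \<open>
  The two summands of the staircase estimate are bounded separately, and the q-th root of their
  sum costs 2^(1/q).
\<close>

lemma upper_bound_staircase: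
  assumes q: "0 < q" "q < p1" "q < p2"
    and r1: "1 / r1 = 1 / q - 1 / p1" "0 < r1" and r2: "1 / r2 = 1 / q - 1 / p2" "0 < r2"
    and rowsA: "\<And>a. (\<Sum>j. (a j * ennreal (A.level j)) epowr r2 * tail_mu q r2 {A.level_pt (Suc j)..}) epowr (q / r2)
        \<le> K1 epowr q * (\<Sum>j. a j epowr p1) epowr (q / p1)"
    and rowsB: "\<And>b. (\<Sum>k. (b k * ennreal (B.level k)) epowr r1 * tail_mu' q r1 {B.level_pt (Suc k)<..}) epowr (q / r1)
        \<le> K2 epowr q * (\<Sum>k. b k epowr p2) epowr (q / p2)"
  shows "upper_bound q p1 p2 (ennreal (2 powr (1 / q)) * (ennreal (stair_const q r2 p2) * K1 + ennreal (stair_const q r1 p1) * K2))"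
  unfolding upper_bound_def
proof (intro allI)
  fix a b :: "nat \<Rightarrow> ennreal"
  let ?Sa = "(\<Sum>j. a j epowr p1) epowr (q / p1)" and ?Sb = "(\<Sum>k. b k epowr p2) epowr (q / p2)"
  let ?k2 = "ennreal (stair_const q r2 p2)" and ?k1 = "ennreal (stair_const q r1 p1)"
  have p0: "0 < p1" "0 < p2" using q by auto
  have "(\<integral>\<^sup>+t. A.cell_step a t epowr q * B.cell_step b t epowr q \<partial>\<nu>) \<le>
    ?k2 epowr q * (\<Sum>j. (a j * ennreal (A.level j)) epowr r2 * tail_mu q r2 {A.level_pt (Suc j)..}) epowr (q / r2) * ?Sb +
    ?k1 epowr q * (\<Sum>k. (b k * ennreal (B.level k)) epowr r1 * tail_mu' q r1 {B.level_pt (Suc k)<..}) epowr (q / r1) * ?Sa"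
    unfolding stair_const_epowr[OF q(1) r2(2) p0(2)] stair_const_epowr[OF q(1) r1(2) p0(1)]
    by (rule staircase[OF q r1 r2])
  also have "\<dots> \<le> ?k2 epowr q * (K1 epowr q * ?Sa) * ?Sb + ?k1 epowr q * (K2 epowr q * ?Sb) * ?Sa"
    by (intro add_mono mult_right_mono mult_left_mono rowsA rowsB) auto
  also have "\<dots> = ((?k2 * K1) epowr q + (?k1 * K2) epowr q) * ?Sa * ?Sb"
    using q by (simp add: epowr_mult distrib_left distrib_right mult_ac)
  also have "\<dots> \<le> (ennreal (2 powr (1 / q)) * (?k2 * K1 + ?k1 * K2)) epowr q * ?Sa * ?Sb"
    by (intro mult_right_mono add_epowr_le q) auto
  finally show "(\<integral>\<^sup>+t. A.cell_step a t epowr q * B.cell_step b t epowr q \<partial>\<nu>) \<le>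
    (ennreal (2 powr (1 / q)) * (?k2 * K1 + ?k1 * K2)) epowr q * ?Sa * ?Sb" .
qed

text \<open>
  The factor 2 compares level j with the value of G1 at the level point j + 1.
\<close>

lemma sup_rows:
  assumes q: "0 < q" "0 < r" "0 < p1" "p1 \<le> r"
    and K: "\<And>x. x \<in> {c..d} \<Longrightarrow> ennreal (G1 x) * T x epowr (1 / r) \<le> K"
  shows "(\<Sum>j. (a j * ennreal (A.level j)) epowr r * T (A.level_pt (Suc j))) epowr (q / r)
      \<le> (2 * K) epowr q * (\<Sum>j. a j epowr p1) epowr (q / p1)"
proof (rule row_coefficients_sup[OF q(3,4,1)])
  fix j
  show "ennreal (A.level j) epowr r * T (A.level_pt (Suc j)) \<le> (2 * K) epowr r"
  proof (cases "0 < G1 d")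
    case True
    have "ennreal (A.level j) = 2 * ennreal (A.level (Suc j))" by (subst A.level_Suc) (simp add: ennreal_mult)
    then have "ennreal (A.level j) * T (A.level_pt (Suc j)) epowr (1 / r) = 2 * (ennreal (A.level (Suc j)) * T (A.level_pt (Suc j)) epowr (1 / r))"
      by (simp add: mult.assoc)
    also have "\<dots> \<le> 2 * (ennreal (G1 (A.level_pt (Suc j))) * T (A.level_pt (Suc j)) epowr (1 / r))"
      using A.level_pt_le_iff[OF True, of "Suc j" "A.level_pt (Suc j)"] by (intro mult_left_mono mult_right_mono ennreal_leI) auto
    also have "\<dots> \<le> 2 * K"
      using A.level_pt_bounds[OF True, of "Suc j"] by (intro mult_left_mono K) auto
    finally have "(ennreal (A.level j) * T (A.level_pt (Suc j)) epowr (1 / r)) epowr r \<le> (2 * K) epowr r"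
      using q by (intro epowr_mono) auto
    then show ?thesis using q by (simp add: epowr_mult)
  next
    case False
    then have "G1 d = 0" using A.nonneg[of d] by linarith
    then show ?thesis using q by (simp add: A.level_def)
  qed
qed

lemma int_rows:
  assumes r: "0 < q" "0 < r" "r < p1" "1 / \<kappa> = 1 / r - 1 / p1" "0 < \<kappa>"
    and T: "\<And>x y. x \<le> y \<Longrightarrow> T y \<le> T x"
  shows "(\<Sum>j. (a j * ennreal (A.level j)) epowr r * T (A.level_pt (Suc j))) epowr (q / r) \<le>
    (ennreal (rows_const \<kappa>) * (\<integral>\<^sup>+x. T x epowr (\<kappa> / r) \<partial>A.mu \<kappa>) epowr (1 / \<kappa>)) epowr q * (\<Sum>j. a j epowr p1) epowr (q / p1)"
proof -
  have c: "0 < 2 powr \<kappa> / (1 - (1/2::real) powr \<kappa>)" using powr_half_less_1[OF r(5)] by simp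
  have "(\<Sum>j. (a j * ennreal (A.level j)) epowr r * T (A.level_pt (Suc j))) epowr (q / r) \<le>
    (\<Sum>j. ennreal (A.level j powr \<kappa>) * T (A.level_pt (Suc j)) epowr (\<kappa> / r)) epowr (q / \<kappa>) * (\<Sum>j. a j epowr p1) epowr (q / p1)"
    by (rule row_coefficients_int[OF r(2,3,4,5,1)])
  also have "\<dots> \<le> (ennreal (2 powr \<kappa> / (1 - (1/2) powr \<kappa>)) * (\<integral>\<^sup>+x. T x epowr (\<kappa> / r) \<partial>A.mu \<kappa>)) epowr (q / \<kappa>) * (\<Sum>j. a j epowr p1) epowr (q / p1)"
    using r T by (intro mult_right_mono epowr_mono A.suminf_level_shift_le) auto
  also have "(ennreal (2 powr \<kappa> / (1 - (1/2) powr \<kappa>)) * (\<integral>\<^sup>+x. T x epowr (\<kappa> / r) \<partial>A.mu \<kappa>)) epowr (q / \<kappa>) =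
     (ennreal (rows_const \<kappa>) * (\<integral>\<^sup>+x. T x epowr (\<kappa> / r) \<partial>A.mu \<kappa>) epowr (1 / \<kappa>)) epowr q"
    using r(1,5) c by (simp add: rows_const_def epowr_mult epowr_epowr epowr_ennreal powr_powr)
  finally show ?thesis .
qed

end

section \<open>The characteristics of a scale\<close>

context scale
begin

text \<open>
  The generalised inverse takes values in [c,d].
\<close>

lemma nn_integral_mu_Icc:
  assumes r: "0 < r" and h [measurable]: "h \<in> borel_measurable borel"
  shows "(\<integral>\<^sup>+t. h t \<partial>mu r) = (\<integral>\<^sup>+t. h t * indicator {c..d} t \<partial>mu r)"
proof -
  have "gen_inv_powr r s \<in> {c..d}" if s: "0 < s" "s \<le> G d powr r" for s
  proof -
    have "s \<le> G (gen_inv_powr r s) powr r" using gen_inv_powr_le_iff[OF r s, of "gen_inv_powr r s"] by simp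
    then have "G (gen_inv_powr r s) \<noteq> 0" using s by auto
    then have "c \<le> gen_inv_powr r s" using below[of "gen_inv_powr r s"] by force
    moreover have "gen_inv_powr r s \<le> d" using gen_inv_powr_le_iff[OF r s, of d] s by simp
    ultimately show ?thesis by simp
  qed
  then show ?thesis
    unfolding nn_integral_mu[OF r h] using r
    by (subst nn_integral_mu) (auto intro!: nn_integral_cong simp: indicator_def)
qed

lemma stieltjes_eq_mu:
  assumes "0 < r" and P: "\<And>x. x \<in> {c..d} \<Longrightarrow> P x = ennreal (G x)"
  shows "stieltjes c d (\<lambda>y. P y epowr r) = mu r"
proof -
  have "(\<lambda>x. if x < c then 0 else enn2real (P (min x d) epowr r)) = (\<lambda>x. G x powr r)"
  proof
    fix x
    show "(if x < c then 0 else enn2real (P (min x d) epowr r)) = G x powr r"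
    proof (cases "x < c")
      case False
      then have "P (min x d) = ennreal (G (min x d))" using cd by (intro P) auto
      moreover have "G (min x d) = G x" using above[of x] by (auto simp: min_def)
      ultimately show ?thesis using False assms(1) by (simp add: epowr_ennreal)
    qed (simp add: below)
  qed
  then show ?thesis by (simp add: stieltjes_def mu_def)
qed

text \<open>
  Finitely many jumps, none of them at t.
\<close>

lemma cumul_step_left:
  assumes fin: "finite {n. a n \<noteq> 0}" and t: "t \<notin> range level_pt"
  shows "\<exists>m. cumul_step a t \<le> cumul_step a (t - 1 / Suc m)"
proof (cases "0 < G d")
  case False
  then have "G d = 0" using nonneg[of d] by linarith
  then show ?thesis by (simp add: cumul_step_def level_def)
next
  case True
  have "\<forall>\<^sub>F m in sequentially. level n \<le> G t \<longrightarrow> level n \<le> G (t - 1 / Suc m)" for n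
  proof (cases "level_pt n \<le> t")
    case le: True
    with t have "level_pt n < t" by (metis order_le_less rangeI)
    have "(\<lambda>m. 1 / Suc m) \<longlonglongrightarrow> (0::real)"
      using LIMSEQ_inverse_real_of_nat by (simp add: inverse_eq_divide)
    then have "\<forall>\<^sub>F m in sequentially. 1 / Suc m < t - level_pt n"
      using \<open>level_pt n < t\<close> by (intro order_tendstoD) auto
    then show ?thesis
      by (rule eventually_mono) (auto simp flip: level_pt_le_iff[OF True])
  qed (use True in \<open>simp add: level_pt_le_iff\<close>)
  then have "\<forall>\<^sub>F m in sequentially. \<forall>n\<in>{n. a n \<noteq> 0}. level n \<le> G t \<longrightarrow> level n \<le> G (t - 1 / Suc m)"
    by (intro eventually_ball_finite[OF fin] ballI)
  then obtain m where m: "\<And>n. a n \<noteq> 0 \<Longrightarrow> level n \<le> G t \<Longrightarrow> level n \<le> G (t - 1 / Suc m)"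
    by (auto simp: eventually_sequentially)
  have "cumul_step a t \<le> cumul_step a (t - 1 / Suc m)"
    unfolding cumul_step_def
  proof (rule suminf_le_ennreal)
    fix n
    show "a n * ennreal (level n) * indicator {t. level n \<le> G t} t \<le> a n * ennreal (level n) * indicator {t. level n \<le> G t} (t - 1 / Suc m)"
      using m[of n] by (cases "a n = 0") (auto simp: indicator_def)
  qed
  then show ?thesis ..
qed

end

context two_scales
begin

context
  fixes U P1 P2 :: "real \<Rightarrow> ennreal"
  assumes U: "\<And>x. x \<in> {c..d} \<Longrightarrow> U x = tail x"
    and P1: "\<And>x. x \<in> {c..d} \<Longrightarrow> P1 x = ennreal (G1 x)"
    and P2: "\<And>x. x \<in> {c..d} \<Longrightarrow> P2 x = ennreal (G2 x)"
begin

lemma stieltjes_1: "0 < r \<Longrightarrow> stieltjes c d (\<lambda>y. P1 y epowr r) = A.mu r"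
  by (rule A.stieltjes_eq_mu) (simp_all add: P1)

lemma stieltjes_2: "0 < r \<Longrightarrow> stieltjes c d (\<lambda>y. P2 y epowr r) = B.mu r"
  by (rule B.stieltjes_eq_mu) (simp_all add: P2)

lemma char1_eq: "char1 q c d U P1 P2 = (SUP x\<in>{c..d}. tail x epowr (1 / q) * ennreal (G1 x) * ennreal (G2 x))"
  unfolding char1_def by (intro SUP_cong) (simp_all add: U P1 P2)

lemma char_hat_eq:
  assumes r: "0 < q" "0 < r"
  shows "char_hat q r c d U P1 P2 =
    (SUP x\<in>{c..d}. ennreal (G1 x) * (\<integral>\<^sup>+t. tail (max x t) epowr (r / q) \<partial>B.mu r) epowr (1 / r))"
  unfolding char_hat_def stieltjes_2[OF r(2)]
proof (intro SUP_cong refl)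
  fix x assume x: "x \<in> {c..d}"
  have meas: "(\<lambda>t. tail (max x t) epowr (r / q)) \<in> borel_measurable borel" by measurable
  have "(\<integral>\<^sup>+t\<in>{c..d}. U (max x t) epowr (r / q) \<partial>B.mu r) = (\<integral>\<^sup>+t\<in>{c..d}. tail (max x t) epowr (r / q) \<partial>B.mu r)"
    using x by (intro nn_integral_cong) (auto simp: indicator_def U)
  then show "P1 x * (\<integral>\<^sup>+t\<in>{c..d}. U (max x t) epowr (r / q) \<partial>B.mu r) epowr (1 / r) =
      ennreal (G1 x) * (\<integral>\<^sup>+t. tail (max x t) epowr (r / q) \<partial>B.mu r) epowr (1 / r)"
    using P1[OF x] B.nn_integral_mu_Icc[OF r(2) meas] by simp
qed

lemma tail_int_eq:
  assumes r: "0 < r" and S: "S' \<subseteq> {c..d}" "S \<inter> {c..d} = S'" and [measurable]: "S \<in> sets borel"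
  shows "tail_int q r c d U P2 S' = tail_mu q r S"
proof -
  have meas: "(\<lambda>t. tail t epowr (r / q) * indicator S t) \<in> borel_measurable borel" by measurable
  have "tail_int q r c d U P2 S' = (\<integral>\<^sup>+t. tail t epowr (r / q) * indicator S t * indicator {c..d} t \<partial>B.mu r)"
    unfolding tail_int_def stieltjes_2[OF r] using S
    by (intro nn_integral_cong) (auto simp: indicator_def U)
  then show ?thesis unfolding tail_mu_def using B.nn_integral_mu_Icc[OF r meas] by simp
qed

lemma char4_eq:
  assumes r: "0 < r"
  shows "char4 q r c d U P1 P2 = (SUP x\<in>{c..d}. ennreal (G1 x) * tail_mu q r {x..} epowr (1 / r))"
  unfolding char4_def
proof (intro SUP_cong refl)
  fix x assume x: "x \<in> {c..d}"
  then have "tail_int q r c d U P2 {x..d} = tail_mu q r {x..}" by (intro tail_int_eq r) auto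
  then show "P1 x * tail_int q r c d U P2 {x..d} epowr (1 / r) = ennreal (G1 x) * tail_mu q r {x..} epowr (1 / r)"
    by (simp add: P1[OF x])
qed

lemma char5_eq:
  assumes r: "0 < r"
  shows "char5 q r c d U P2 P1 = (SUP x\<in>{c..d}. ennreal (G1 x) * tail_mu q r {x<..} epowr (1 / r))"
  unfolding char5_def
proof (intro SUP_cong refl)
  fix x assume x: "x \<in> {c..d}"
  then have "tail_int q r c d U P2 {x<..d} = tail_mu q r {x<..}" by (intro tail_int_eq r) auto
  then show "P1 x * tail_int q r c d U P2 {x<..d} epowr (1 / r) = ennreal (G1 x) * tail_mu q r {x<..} epowr (1 / r)"
    by (simp add: P1[OF x])
qed

lemma char6_eq:
  assumes r: "0 < r" "0 < \<kappa>"
  shows "char6 q r \<kappa> c d U P1 P2 = (\<integral>\<^sup>+x. tail_mu q r {x..} epowr (\<kappa> / r) \<partial>A.mu \<kappa>) epowr (1 / \<kappa>)"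
proof -
  have meas: "(\<lambda>x. tail_mu q r {x..} epowr (\<kappa> / r)) \<in> borel_measurable borel"
    using r by (intro borel_measurable_antimono_ennreal epowr_mono tail_mu_mono) auto
  have "(\<integral>\<^sup>+x\<in>{c..d}. tail_int q r c d U P2 {x..d} epowr (\<kappa> / r) \<partial>A.mu \<kappa>) =
      (\<integral>\<^sup>+x\<in>{c..d}. tail_mu q r {x..} epowr (\<kappa> / r) \<partial>A.mu \<kappa>)"
  proof (rule nn_integral_cong)
    fix x
    have "tail_int q r c d U P2 {x..d} = tail_mu q r {x..}" if "x \<in> {c..d}"
      using that by (intro tail_int_eq r) auto
    then show "tail_int q r c d U P2 {x..d} epowr (\<kappa> / r) * indicator {c..d} x =
      tail_mu q r {x..} epowr (\<kappa> / r) * indicator {c..d} x" by (auto simp: indicator_def)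
  qed
  then show ?thesis unfolding char6_def stieltjes_1[OF r(2)] using A.nn_integral_mu_Icc[OF r(2) meas] by simp
qed

lemma char7_eq:
  assumes r: "0 < r" "0 < \<kappa>"
  shows "char7 q r \<kappa> c d U P2 P1 = (\<integral>\<^sup>+x. tail_mu q r {x<..} epowr (\<kappa> / r) \<partial>A.mu \<kappa>) epowr (1 / \<kappa>)"
proof -
  have meas: "(\<lambda>x. tail_mu q r {x<..} epowr (\<kappa> / r)) \<in> borel_measurable borel"
    using r by (intro borel_measurable_antimono_ennreal epowr_mono tail_mu_mono) auto
  have "(\<integral>\<^sup>+x\<in>{c..d}. tail_int q r c d U P2 {x<..d} epowr (\<kappa> / r) \<partial>A.mu \<kappa>) =
      (\<integral>\<^sup>+x\<in>{c..d}. tail_mu q r {x<..} epowr (\<kappa> / r) \<partial>A.mu \<kappa>)"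
  proof (rule nn_integral_cong)
    fix x
    have "tail_int q r c d U P2 {x<..d} = tail_mu q r {x<..}" if "x \<in> {c..d}"
      using that by (intro tail_int_eq r) auto
    then show "tail_int q r c d U P2 {x<..d} epowr (\<kappa> / r) * indicator {c..d} x =
      tail_mu q r {x<..} epowr (\<kappa> / r) * indicator {c..d} x" by (auto simp: indicator_def)
  qed
  then show ?thesis unfolding char7_def stieltjes_1[OF r(2)] using A.nn_integral_mu_Icc[OF r(2) meas] by simp
qed

end

end

section \<open>From the Hardy inequality to step functions and back\<close>

text \<open>
  C is one of the constants over which the infimum in hardy_const is taken, except that C =
  \<infinity> is permitted.
\<close>

definition admissible ::
    "real \<Rightarrow> ennreal \<Rightarrow> ennreal \<Rightarrow> real set \<Rightarrow> (real \<Rightarrow> ennreal) \<Rightarrow> (real \<Rightarrow> ennreal) \<Rightarrow> (real \<Rightarrow> ennreal)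
      \<Rightarrow> ennreal \<Rightarrow> bool" where
  "admissible q p1 p2 I u v1 v2 C \<longleftrightarrow>
        (\<forall>f g. f \<in> borel_measurable (lebesgue_on I) \<longrightarrow> g \<in> borel_measurable (lebesgue_on I) \<longrightarrow>
           wfunctional p1 v1 I f < top \<longrightarrow> wfunctional p2 v2 I g < top \<longrightarrow>
           wfunctional (ennreal q) u I (bihardy I f g)
             \<le> C * wfunctional p1 v1 I f * wfunctional p2 v2 I g)"

lemma admissibleD:
  assumes "admissible q p1 p2 I u v1 v2 C" "f \<in> borel_measurable (lebesgue_on I)" "g \<in> borel_measurable (lebesgue_on I)"
    "wfunctional p1 v1 I f < top" "wfunctional p2 v2 I g < top"
  shows "wfunctional (ennreal q) u I (bihardy I f g) \<le> C * wfunctional p1 v1 I f * wfunctional p2 v2 I g"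
  using assms unfolding admissible_def by blast

lemma admissible_mono:
  assumes "admissible q p1 p2 I u v1 v2 C" "C \<le> C'" shows "admissible q p1 p2 I u v1 v2 C'"
  unfolding admissible_def
proof (intro allI impI)
  fix f g assume *: "f \<in> borel_measurable (lebesgue_on I)" "g \<in> borel_measurable (lebesgue_on I)"
    "wfunctional p1 v1 I f < top" "wfunctional p2 v2 I g < top"
  have "C * wfunctional p1 v1 I f * wfunctional p2 v2 I g \<le> C' * wfunctional p1 v1 I f * wfunctional p2 v2 I g"
    by (intro mult_right_mono assms(2)) auto
  with admissibleD[OF assms(1) *]
  show "wfunctional (ennreal q) u I (bihardy I f g) \<le> C' * wfunctional p1 v1 I f * wfunctional p2 v2 I g"
    by (rule order_trans)
qed

lemma admissible_swap:
  assumes "admissible q p1 p2 I u v1 v2 C" shows "admissible q p2 p1 I u v2 v1 C"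
  unfolding admissible_def
proof (intro allI impI)
  fix f g assume *: "f \<in> borel_measurable (lebesgue_on I)" "g \<in> borel_measurable (lebesgue_on I)"
    "wfunctional p2 v2 I f < top" "wfunctional p1 v1 I g < top"
  have "bihardy I f g = bihardy I g f" by (simp add: bihardy_def fun_eq_iff mult.commute)
  then show "wfunctional (ennreal q) u I (bihardy I f g) \<le> C * wfunctional p2 v2 I f * wfunctional p1 v1 I g"
    using admissibleD[OF assms *(2,1,4,3)] by (simp add: mult_ac)
qed

lemma hardy_mono: "x \<le> y \<Longrightarrow> hardy I f x \<le> hardy I f y"
  unfolding hardy_def by (intro nn_integral_mono mult_left_mono) (auto simp: indicator_def)

lemma borel_measurable_mono_ennreal:
  fixes h :: "real \<Rightarrow> ennreal"
  assumes "\<And>x y. x \<le> y \<Longrightarrow> h x \<le> h y"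
  shows "h \<in> borel_measurable borel"
proof (rule borel_measurableI_ge)
  fix y
  have "is_interval {x. y \<le> h x}"
    unfolding is_interval_1 using assms by (auto intro: order_trans)
  then show "{x \<in> space borel. y \<le> h x} \<in> sets borel"
    by (simp add: real_interval_borel_measurable)
qed

lemma hardy_measurable [measurable]: "hardy I f \<in> borel_measurable borel"
  by (intro borel_measurable_mono_ennreal hardy_mono)

context local_weight
begin

lemma hardy_measurable_M [measurable]: "hardy I f \<in> borel_measurable M"
  by (intro borel_measurable_lebesgue_onI hardy_measurable)

lemma AE_M_countable: assumes "countable Z" shows "AE t in M. t \<notin> Z"
proof -
  have "AE t in M. \<forall>z\<in>Z. t \<noteq> z" using assms by (subst AE_ball_countable) (auto intro: AE_M_neq)
  then show ?thesis by (rule AE_mp) (auto intro!: AE_I2)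
qed

text \<open>
  The step function of b shifted by 1 / (m + 1) is dominated by twice a Hardy transform.  As m
  grows the shifted functions increase to the unshifted one except at the countably many level
  points, which form a null set.
\<close>

lemma cumul_step_bound_of_hardy_bound:
  assumes ps: "profile_scale p v c d G" and q: "0 < q" "0 < p" and w [measurable]: "w \<in> borel_measurable M"
    and hb: "\<And>g. g \<in> borel_measurable M \<Longrightarrow> wfunctional (ennreal p) v {c..d} g < top \<Longrightarrow>
      (\<integral>\<^sup>+t. hardy {c..d} g t epowr q * w t \<partial>M) \<le> (C * wfunctional (ennreal p) v {c..d} g) epowr q"
    and b: "\<And>n. b n < top" "finite {n. b n \<noteq> 0}"
  shows "(\<integral>\<^sup>+t. scale.cumul_step G d b t epowr q * w t \<partial>M) \<le> (2 * C * (\<Sum>n. b n epowr p) epowr (1 / p)) epowr q"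
proof -
  interpret scale G c d using ps by (simp add: profile_scale_def)
  let ?S = "(\<Sum>n. b n epowr p) epowr (1 / p)"
  have S: "?S < top"
  proof -
    have "(\<Sum>n. b n epowr p) = (\<Sum>n\<in>{n. b n \<noteq> 0}. b n epowr p)" using q b by (intro suminf_finite) auto
    also have "\<dots> < top" using b q by (auto simp: less_top)
    finally show ?thesis using q by simp
  qed
  let ?h = "\<lambda>m t. cumul_step b (t - 1 / Suc m) epowr q * w t"
  have step: "(\<integral>\<^sup>+t. ?h m t \<partial>M) \<le> (2 * C * ?S) epowr q" for m
  proof -
    obtain g where g: "g \<in> borel_measurable M" "wfunctional (ennreal p) v {c..d} g \<le> ?S"
      "\<And>t. t \<in> {c..d} \<Longrightarrow> ennreal (1/2) * cumul_step b (t - 1 / Suc m) \<le> hardy {c..d} g t"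
    proof -
      have "0 < 1 / real (Suc m)" by simp
      then show ?thesis using ps that unfolding profile_scale_def by blast
    qed
    have le: "cumul_step b (t - 1 / Suc m) \<le> 2 * hardy {c..d} g t" if "t \<in> {c..d}" for t
    proof -
      have "cumul_step b (t - 1 / Suc m) = 2 * (ennreal (1/2) * cumul_step b (t - 1 / Suc m))"
        by (simp add: mult.assoc[symmetric] flip: ennreal_numeral ennreal_mult del: ennreal_half)
      also have "\<dots> \<le> 2 * hardy {c..d} g t" by (intro mult_left_mono g(3) that) simp
      finally show ?thesis .
    qed
    have "(\<integral>\<^sup>+t. ?h m t \<partial>M) \<le> (\<integral>\<^sup>+t. 2 epowr q * (hardy {c..d} g t epowr q * w t) \<partial>M)"
    proof (rule nn_integral_mono)
      fix t assume "t \<in> space M"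
      then have "cumul_step b (t - 1 / Suc m) epowr q \<le> (2 * hardy {c..d} g t) epowr q"
        using q by (intro epowr_mono le) auto
      then have "cumul_step b (t - 1 / Suc m) epowr q * w t \<le> (2 * hardy {c..d} g t) epowr q * w t"
        by (rule mult_right_mono) simp
      then show "?h m t \<le> 2 epowr q * (hardy {c..d} g t epowr q * w t)"
        using q by (simp add: epowr_mult mult.assoc)
    qed
    also have "\<dots> = 2 epowr q * (\<integral>\<^sup>+t. hardy {c..d} g t epowr q * w t \<partial>M)"
      by (rule nn_integral_cmult) measurable
    also have "\<dots> \<le> 2 epowr q * (C * ?S) epowr q"
    proof (intro mult_left_mono)
      have "(\<integral>\<^sup>+t. hardy {c..d} g t epowr q * w t \<partial>M) \<le> (C * wfunctional (ennreal p) v {c..d} g) epowr q"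
        using g S by (intro hb) auto
      also have "\<dots> \<le> (C * ?S) epowr q" using q by (intro epowr_mono mult_left_mono g) auto
      finally show "(\<integral>\<^sup>+t. hardy {c..d} g t epowr q * w t \<partial>M) \<le> (C * ?S) epowr q" .
    qed simp
    finally show ?thesis using q by (simp add: epowr_mult mult.assoc)
  qed
  have "(\<integral>\<^sup>+t. cumul_step b t epowr q * w t \<partial>M) \<le> (\<integral>\<^sup>+t. (SUP m. ?h m t) \<partial>M)"
  proof (rule nn_integral_mono_AE, rule AE_mp[OF AE_M_countable[of "range level_pt"]], simp, rule AE_I2, rule impI)
    fix t assume "t \<notin> range level_pt"
    then obtain m where "cumul_step b t \<le> cumul_step b (t - 1 / Suc m)" using cumul_step_left b(2) by blast
    then have "cumul_step b t epowr q * w t \<le> ?h m t" using q by (intro mult_right_mono epowr_mono) auto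
    also have "\<dots> \<le> (SUP m. ?h m t)" by (rule SUP_upper) simp
    finally show "cumul_step b t epowr q * w t \<le> (SUP m. ?h m t)" .
  qed
  also have "\<dots> = (SUP m. \<integral>\<^sup>+t. ?h m t \<partial>M)"
  proof (rule nn_integral_monotone_convergence_SUP)
    show "incseq ?h"
    proof (rule incseq_SucI, rule le_funI)
      fix m t
      have "1 / real (Suc (Suc m)) \<le> 1 / real (Suc m)" by (intro divide_left_mono) auto
      then show "?h m t \<le> ?h (Suc m) t" using q by (intro mult_right_mono epowr_mono cumul_step_mono) auto
    qed
    fix m
    have "(\<lambda>t. cumul_step b (t - 1 / Suc m)) \<in> borel_measurable M"
      by (intro borel_measurable_lebesgue_onI) measurable
    then show "?h m \<in> borel_measurable M" by measurable
  qed
  also have "\<dots> \<le> (2 * C * ?S) epowr q" by (intro SUP_least step)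
  finally show ?thesis .
qed

end

section \<open>The local problem on a compact interval\<close>

text \<open>
  The output weight on [c,d] as a Borel measure on the line; the sequence model needs Borel
  sets, while weights are Lebesgue measurable.
\<close>

definition line_measure :: "real \<Rightarrow> real \<Rightarrow> (real \<Rightarrow> ennreal) \<Rightarrow> real measure" where
  "line_measure c d w = distr (density (lebesgue_on {c..d}) w) borel (\<lambda>x. x)"

lemma sets_line_measure [simp, measurable_cong]: "sets (line_measure c d w) = sets borel"
  by (simp add: line_measure_def)

lemma nn_integral_line_measure:
  assumes [measurable]: "w \<in> borel_measurable (lebesgue_on {c..d})" "h \<in> borel_measurable borel"
  shows "(\<integral>\<^sup>+t. h t \<partial>line_measure c d w) = (\<integral>\<^sup>+t. h t * w t \<partial>lebesgue_on {c..d})"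
proof -
  have [measurable]: "(\<lambda>x. x) \<in> borel_measurable (lebesgue_on {c..d})" "h \<in> borel_measurable (lebesgue_on {c..d})"
    by (auto intro: id_measurable_lebesgue_on borel_measurable_lebesgue_onI)
  show ?thesis
    unfolding line_measure_def
    by (subst nn_integral_distr) (auto simp: nn_integral_density mult.commute)
qed

lemma emeasure_line_measure_tail:
  assumes w [measurable]: "w \<in> borel_measurable (lebesgue_on {c..d})" and x: "x \<in> {c..d}"
  shows "emeasure (line_measure c d w) {x..} = (\<integral>\<^sup>+t\<in>{x..d}. w t \<partial>lebesgue)"
proof -
  have "emeasure (line_measure c d w) {x..} = (\<integral>\<^sup>+t. indicator {x..} t \<partial>line_measure c d w)" by simp
  also have "\<dots> = (\<integral>\<^sup>+t. indicator {x..} t * w t \<partial>lebesgue_on {c..d})"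
    by (rule nn_integral_line_measure[OF w]) simp
  also have "\<dots> = (\<integral>\<^sup>+t. w t * indicator {x..d} t \<partial>lebesgue_on {c..d})"
    by (intro nn_integral_cong) (auto simp: indicator_def)
  also have "\<dots> = (\<integral>\<^sup>+t\<in>{x..d}. w t \<partial>lebesgue)"
    using x by (intro set_nn_integral_eq_lebesgue_on[symmetric]) auto
  finally show ?thesis .
qed

text \<open>
  The characteristic of arbitrary weights on [c,d]; the regularised one is its value at the
  regularised weights.
\<close>

definition local_char ::
    "real \<Rightarrow> ennreal \<Rightarrow> ennreal \<Rightarrow> (real \<Rightarrow> ennreal) \<Rightarrow> (real \<Rightarrow> ennreal) \<Rightarrow> (real \<Rightarrow> ennreal)
      \<Rightarrow> real \<Rightarrow> real \<Rightarrow> ennreal" where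
  "local_char q p1 p2 u v1 v2 c d =
    (let P1 = profile p1 v1 c d;
         P2 = profile p2 v2 c d;
         U = (\<lambda>x. \<integral>\<^sup>+t\<in>{x..d}. u t \<partial>lebesgue);
         W1 = (\<lambda>x. \<integral>\<^sup>+t\<in>{x..d}. (P1 t epowr q * u t) \<partial>lebesgue);
         W2 = (\<lambda>x. \<integral>\<^sup>+t\<in>{x..d}. (P2 t epowr q * u t) \<partial>lebesgue);
         r1 = 1 / (1 / q - 1 / enn2real p1);
         r2 = 1 / (1 / q - 1 / enn2real p2);
         \<kappa> = 1 / (1 / q - 1 / enn2real p1 - 1 / enn2real p2)
     in if p1 = top \<and> p2 = top then char_inf_inf q c d u P1 P2
        else if p1 = top then char_inf q p2 r2 c d W1 P2
        else if p2 = top then char_inf q p1 r1 c d W2 P1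
        else if p1 \<le> ennreal q \<and> p2 \<le> ennreal q then char1 q c d U P1 P2
        else if p1 \<le> ennreal q then char_hat q r2 c d U P1 P2
        else if p2 \<le> ennreal q then char_hat q r1 c d U P2 P1
        else if 1 / q \<le> 1 / enn2real p1 + 1 / enn2real p2
          then char4 q r2 c d U P1 P2 + char5 q r1 c d U P1 P2
        else char6 q r2 \<kappa> c d U P1 P2 + char7 q r1 \<kappa> c d U P1 P2)"

lemma reg_char_eq_local_char:
  "reg_char q p1 p2 u v1 v2 c d m =
    local_char q p1 p2 (\<lambda>t. min (u t) (of_nat m)) (\<lambda>t. v1 t + 1 / of_nat m) (\<lambda>t. v2 t + 1 / of_nat m) c d"
  unfolding reg_char_def local_char_def Let_def ..

text \<open>
  The quantity A is the best constant up to the factor K.  The second part says nothing for A =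
  \<infinity>, where the right-hand side of the inequality would be 0 for functions of norm 0.
\<close>

definition two_sided ::
    "real \<Rightarrow> ennreal \<Rightarrow> ennreal \<Rightarrow> real \<Rightarrow> real \<Rightarrow> (real \<Rightarrow> ennreal) \<Rightarrow> (real \<Rightarrow> ennreal) \<Rightarrow> (real \<Rightarrow> ennreal)
      \<Rightarrow> ennreal \<Rightarrow> real \<Rightarrow> bool" where
  "two_sided q p1 p2 c d u v1 v2 A K \<longleftrightarrow>
    (\<forall>C. C < top \<longrightarrow> admissible q p1 p2 {c..d} u v1 v2 C \<longrightarrow> A \<le> ennreal K * C) \<and>
    (A < top \<longrightarrow> admissible q p1 p2 {c..d} u v1 v2 (ennreal K * A))"

text \<open>
  The maximum with 1 keeps 1 / K \<le> K.
\<close>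

lemma two_sidedI:
  assumes "\<And>C. C < top \<Longrightarrow> admissible q p1 p2 {c..d} u v1 v2 C \<Longrightarrow> A \<le> ennreal K1 * C"
    and "A < top \<Longrightarrow> admissible q p1 p2 {c..d} u v1 v2 (ennreal K2 * A)"
  shows "two_sided q p1 p2 c d u v1 v2 A (max 1 (max K1 K2))"
  unfolding two_sided_def
proof (intro conjI allI impI)
  fix C assume C: "C < top" "admissible q p1 p2 {c..d} u v1 v2 C"
  have "ennreal K1 * C \<le> ennreal (max 1 (max K1 K2)) * C" by (intro mult_right_mono ennreal_leI) auto
  with assms(1)[OF C] show "A \<le> ennreal (max 1 (max K1 K2)) * C" by (rule order_trans)
next
  assume "A < top"
  then have "admissible q p1 p2 {c..d} u v1 v2 (ennreal K2 * A)" by (rule assms(2))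
  then show "admissible q p1 p2 {c..d} u v1 v2 (ennreal (max 1 (max K1 K2)) * A)"
    by (rule admissible_mono) (intro mult_right_mono ennreal_leI, auto)
qed

lemma two_sided_swap:
  "two_sided q p1 p2 c d u v1 v2 A K \<Longrightarrow> two_sided q p2 p1 c d u v2 v1 A K"
  unfolding two_sided_def using admissible_swap by blast

locale local_problem = V1: local_weight v1 c d \<delta> + V2: local_weight v2 c d \<delta>
  for v1 v2 :: "real \<Rightarrow> ennreal" and c d \<delta> :: real +
  fixes u :: "real \<Rightarrow> ennreal"
  assumes u_measurable [measurable]: "u \<in> borel_measurable (lebesgue_on {c..d})"
begin

abbreviation "M \<equiv> lebesgue_on {c..d}"

abbreviation "\<nu> \<equiv> line_measure c d u"

lemma swap: "local_problem v2 v1 c d \<delta> u"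
  by unfold_locales (rule u_measurable)

lemma output_norm:
  assumes "0 < q"
  shows "wfunctional (ennreal q) u {c..d} (bihardy {c..d} f g) =
    (\<integral>\<^sup>+t. hardy {c..d} f t epowr q * hardy {c..d} g t epowr q * u t \<partial>M) epowr (1 / q)"
  using assms by (simp add: wfunctional_eq bihardy_def epowr_mult)

lemma admissible_iff:
  assumes "0 < q"
  shows "admissible q p1 p2 {c..d} u v1 v2 C \<longleftrightarrow>
    (\<forall>f\<in>borel_measurable M. \<forall>g\<in>borel_measurable M. wfunctional p1 v1 {c..d} f < top \<longrightarrow> wfunctional p2 v2 {c..d} g < top \<longrightarrow>
      (\<integral>\<^sup>+t. hardy {c..d} f t epowr q * hardy {c..d} g t epowr q * u t \<partial>M) \<le>
        (C * wfunctional p1 v1 {c..d} f * wfunctional p2 v2 {c..d} g) epowr q)"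
  unfolding admissible_def output_norm[OF assms] epowr_le_iff'[OF assms] by blast

text \<open>
  One function is replaced by a step function, with the other one kept as part of the weight,
  and then the other one is replaced; each replacement costs the factor 2.
\<close>

lemma bilinear_bound_of_admissible:
  assumes q: "0 < q" "0 < p1" "0 < p2"
    and ps: "profile_scale p1 v1 c d G1" "profile_scale p2 v2 c d G2"
    and adm: "admissible q (ennreal p1) (ennreal p2) {c..d} u v1 v2 C"
  shows "two_scales.bilinear_bound G1 G2 d \<nu> q p1 p2 ((4 * C) epowr q)"
proof -
  interpret A: scale G1 c d using ps by (simp add: profile_scale_def)
  interpret B: scale G2 c d using ps by (simp add: profile_scale_def)
  interpret two_scales G1 G2 c d \<nu> by unfold_locales simp
  have one: "(\<integral>\<^sup>+t. B.cumul_step b t epowr q * (hardy {c..d} f t epowr q * u t) \<partial>M) \<le>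
      (2 * (C * wfunctional (ennreal p1) v1 {c..d} f) * (\<Sum>n. b n epowr p2) epowr (1 / p2)) epowr q"
    if f: "f \<in> borel_measurable M" "wfunctional (ennreal p1) v1 {c..d} f < top"
      and b: "\<And>n. b n < top" "finite {n. b n \<noteq> 0}" for f b
  proof (rule V2.cumul_step_bound_of_hardy_bound[OF ps(2) q(1,3) _ _ b])
    show "(\<lambda>t. hardy {c..d} f t epowr q * u t) \<in> borel_measurable M" by measurable
    fix g assume "g \<in> borel_measurable M" "wfunctional (ennreal p2) v2 {c..d} g < top"
    then show "(\<integral>\<^sup>+t. hardy {c..d} g t epowr q * (hardy {c..d} f t epowr q * u t) \<partial>M) \<le>
      (C * wfunctional (ennreal p1) v1 {c..d} f * wfunctional (ennreal p2) v2 {c..d} g) epowr q"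
      using adm f unfolding admissible_iff[OF q(1)] by (simp add: mult_ac)
  qed
  show ?thesis
    unfolding bilinear_bound_def
  proof (intro allI impI)
    fix a b :: "nat \<Rightarrow> ennreal"
    assume a: "\<forall>n. a n < top" "finite {n. a n \<noteq> 0}" and b: "\<forall>n. b n < top" "finite {n. b n \<noteq> 0}"
    have [measurable]: "A.cumul_step a \<in> borel_measurable M" "B.cumul_step b \<in> borel_measurable M"
      by (auto intro: borel_measurable_lebesgue_onI)
    have "(\<integral>\<^sup>+t. A.cumul_step a t epowr q * (B.cumul_step b t epowr q * u t) \<partial>M) \<le>
        (2 * (2 * C * (\<Sum>n. b n epowr p2) epowr (1 / p2)) * (\<Sum>n. a n epowr p1) epowr (1 / p1)) epowr q"
    proof (rule V1.cumul_step_bound_of_hardy_bound[OF ps(1) q(1,2)])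
      fix f assume "f \<in> borel_measurable M" "wfunctional (ennreal p1) v1 {c..d} f < top"
      then show "(\<integral>\<^sup>+t. hardy {c..d} f t epowr q * (B.cumul_step b t epowr q * u t) \<partial>M) \<le>
        (2 * C * (\<Sum>n. b n epowr p2) epowr (1 / p2) * wfunctional (ennreal p1) v1 {c..d} f) epowr q"
        using one[of f b] b by (simp add: mult_ac)
    qed (use a in auto)
    also have "2 * (2 * C * (\<Sum>n. b n epowr p2) epowr (1 / p2)) * (\<Sum>n. a n epowr p1) epowr (1 / p1) =
        (4 * C) * (\<Sum>n. a n epowr p1) epowr (1 / p1) * (\<Sum>n. b n epowr p2) epowr (1 / p2)"
      by (simp add: mult_ac)
    also have "\<dots> epowr q = (4 * C) epowr q * (\<Sum>n. a n epowr p1) epowr (q / p1) * (\<Sum>n. b n epowr p2) epowr (q / p2)"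
      using q by (simp add: epowr_mult epowr_epowr)
    finally show "(\<integral>\<^sup>+t. A.cumul_step a t epowr q * B.cumul_step b t epowr q \<partial>\<nu>) \<le>
        (4 * C) epowr q * (\<Sum>n. a n epowr p1) epowr (q / p1) * (\<Sum>n. b n epowr p2) epowr (q / p2)"
      by (simp add: nn_integral_line_measure mult.assoc)
  qed
qed

text \<open>
  Both Hardy transforms are dominated by step functions, each at the cost of the factor 4.
\<close>

lemma admissible_of_upper_bound:
  assumes q: "0 < q" "0 < p1" "0 < p2"
    and ps: "profile_scale p1 v1 c d G1" "profile_scale p2 v2 c d G2"
    and ub: "two_scales.upper_bound G1 G2 d \<nu> q p1 p2 K"
  shows "admissible q (ennreal p1) (ennreal p2) {c..d} u v1 v2 (16 * K)"
proof -
  interpret A: scale G1 c d using ps by (simp add: profile_scale_def)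
  interpret B: scale G2 c d using ps by (simp add: profile_scale_def)
  interpret two_scales G1 G2 c d \<nu> by unfold_locales simp
  show ?thesis
    unfolding admissible_iff[OF q(1)]
  proof (intro ballI impI)
    fix f g assume f: "f \<in> borel_measurable M" "wfunctional (ennreal p1) v1 {c..d} f < top"
      and g: "g \<in> borel_measurable M" "wfunctional (ennreal p2) v2 {c..d} g < top"
    let ?Nf = "wfunctional (ennreal p1) v1 {c..d} f" and ?Ng = "wfunctional (ennreal p2) v2 {c..d} g"
    obtain a where a: "(\<Sum>n. a n epowr p1) epowr (1 / p1) \<le> 4 * ?Nf" "\<And>t. t \<in> {c..d} \<Longrightarrow> hardy {c..d} f t \<le> A.cell_step a t"
      using ps(1) f unfolding profile_scale_def by blast
    obtain b where b: "(\<Sum>n. b n epowr p2) epowr (1 / p2) \<le> 4 * ?Ng" "\<And>t. t \<in> {c..d} \<Longrightarrow> hardy {c..d} g t \<le> B.cell_step b t"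
      using ps(2) g unfolding profile_scale_def by blast
    have "(\<integral>\<^sup>+t. hardy {c..d} f t epowr q * hardy {c..d} g t epowr q * u t \<partial>M) \<le>
        (\<integral>\<^sup>+t. A.cell_step a t epowr q * B.cell_step b t epowr q * u t \<partial>M)"
      using q by (intro nn_integral_mono mult_right_mono mult_mono epowr_mono a b) auto
    also have "\<dots> = (\<integral>\<^sup>+t. A.cell_step a t epowr q * B.cell_step b t epowr q \<partial>\<nu>)"
      by (rule nn_integral_line_measure[symmetric]) measurable
    also have "\<dots> \<le> K epowr q * (\<Sum>n. a n epowr p1) epowr (q / p1) * (\<Sum>n. b n epowr p2) epowr (q / p2)"
      using ub unfolding upper_bound_def by blast
    also have "\<dots> = (K * (\<Sum>n. a n epowr p1) epowr (1 / p1) * (\<Sum>n. b n epowr p2) epowr (1 / p2)) epowr q"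
      using q by (simp add: epowr_mult epowr_epowr)
    also have "\<dots> \<le> (K * (4 * ?Nf) * (4 * ?Ng)) epowr q"
      using q by (intro epowr_mono mult_mono mult_left_mono a b) auto
    also have "K * (4 * ?Nf) * (4 * ?Ng) = 16 * K * ?Nf * ?Ng"
      by (simp add: mult_ac)
    finally show "(\<integral>\<^sup>+t. hardy {c..d} f t epowr q * hardy {c..d} g t epowr q * u t \<partial>M) \<le> (16 * K * ?Nf * ?Ng) epowr q" .
  qed
qed

subsection \<open>One infinite exponent\<close>

definition H1 :: "real \<Rightarrow> ennreal" where "H1 = hardy {c..d} (\<lambda>t. 1 / v1 t)"

lemma H1_measurable [measurable]: "H1 \<in> borel_measurable M"
  unfolding H1_def by measurable

lemma profile_top_1: "t \<in> {c..d} \<Longrightarrow> profile top v1 c d t = H1 t"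
  by (simp add: V1.profile_top H1_def)

lemma H1_norm: "(\<lambda>t. 1 / v1 t) \<in> borel_measurable M" "wfunctional top v1 {c..d} (\<lambda>t. 1 / v1 t) \<le> 1"
  by (measurable, rule V1.inverse_weight_norm)

lemma H1_upper:
  "f \<in> borel_measurable M \<Longrightarrow> wfunctional top v1 {c..d} f < top \<Longrightarrow> t \<in> {c..d} \<Longrightarrow>
    hardy {c..d} f t \<le> H1 t * wfunctional top v1 {c..d} f"
  using V1.hardy_le_profile_top[of f t] by (simp add: profile_top_1)

text \<open>
  Testing with f = 1 / v1 and dominating every other f by it shows that the bilinear inequality
  is the linear one for g with the output weight \<Phi>1^q * u, with the same constant.
\<close>

lemma admissible_top_iff:
  assumes q: "0 < q" and C: "C < top"
  shows "admissible q top p2 {c..d} u v1 v2 C \<longleftrightarrow>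
    (\<forall>g\<in>borel_measurable M. wfunctional p2 v2 {c..d} g < top \<longrightarrow>
      (\<integral>\<^sup>+t. hardy {c..d} g t epowr q * (H1 t epowr q * u t) \<partial>M) \<le> (C * wfunctional p2 v2 {c..d} g) epowr q)"
  (is "_ \<longleftrightarrow> ?R")
proof
  assume adm: "admissible q top p2 {c..d} u v1 v2 C"
  show ?R
  proof (intro ballI impI)
    fix g assume g: "g \<in> borel_measurable M" "wfunctional p2 v2 {c..d} g < top"
    let ?N = "wfunctional top v1 {c..d} (\<lambda>t. 1 / v1 t)"
    have "?N < top" using H1_norm(2) by (rule le_less_trans) simp
    then have "(\<integral>\<^sup>+t. H1 t epowr q * hardy {c..d} g t epowr q * u t \<partial>M) \<le> (C * ?N * wfunctional p2 v2 {c..d} g) epowr q"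
      using adm g H1_norm(1) unfolding admissible_iff[OF q] H1_def by blast
    also have "\<dots> \<le> (C * 1 * wfunctional p2 v2 {c..d} g) epowr q"
      using q by (intro epowr_mono mult_right_mono mult_left_mono H1_norm) auto
    finally show "(\<integral>\<^sup>+t. hardy {c..d} g t epowr q * (H1 t epowr q * u t) \<partial>M) \<le> (C * wfunctional p2 v2 {c..d} g) epowr q"
      by (simp add: mult_ac)
  qed
next
  assume R: ?R
  show "admissible q top p2 {c..d} u v1 v2 C"
    unfolding admissible_iff[OF q]
  proof (intro ballI impI)
    fix f g assume f: "f \<in> borel_measurable M" "wfunctional top v1 {c..d} f < top"
      and g: "g \<in> borel_measurable M" "wfunctional p2 v2 {c..d} g < top"
    let ?N = "wfunctional top v1 {c..d} f"
    have "(\<integral>\<^sup>+t. hardy {c..d} f t epowr q * hardy {c..d} g t epowr q * u t \<partial>M) \<le>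
        (\<integral>\<^sup>+t. (H1 t * ?N) epowr q * hardy {c..d} g t epowr q * u t \<partial>M)"
      using q f by (intro nn_integral_mono mult_right_mono epowr_mono H1_upper) auto
    also have "\<dots> = (\<integral>\<^sup>+t. ?N epowr q * (hardy {c..d} g t epowr q * (H1 t epowr q * u t)) \<partial>M)"
      using q by (simp add: epowr_mult mult_ac)
    also have "\<dots> = ?N epowr q * (\<integral>\<^sup>+t. hardy {c..d} g t epowr q * (H1 t epowr q * u t) \<partial>M)"
      by (rule nn_integral_cmult) measurable
    also have "\<dots> \<le> ?N epowr q * (C * wfunctional p2 v2 {c..d} g) epowr q"
      using R g by (intro mult_left_mono) auto
    also have "\<dots> = (C * ?N * wfunctional p2 v2 {c..d} g) epowr q"
      using q by (simp add: epowr_mult mult_ac)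
    finally show "(\<integral>\<^sup>+t. hardy {c..d} f t epowr q * hardy {c..d} g t epowr q * u t \<partial>M) \<le>
        (C * ?N * wfunctional p2 v2 {c..d} g) epowr q" .
  qed
qed

end

lemma ennreal_add_mult_le:
  assumes "0 \<le> k1" "0 \<le> k2" shows "ennreal k1 * x + ennreal k2 * y \<le> ennreal (k1 + k2) * (x + y)"
proof -
  have "ennreal k1 * x + ennreal k2 * y \<le> ennreal (k1 + k2) * x + ennreal (k1 + k2) * y"
    using assms by (intro add_mono mult_right_mono ennreal_leI) auto
  then show ?thesis by (simp add: distrib_left)
qed

lemma add_le_ennreal_mult:
  assumes "0 \<le> k1" "0 \<le> k2" "x \<le> ennreal k1 * C" "y \<le> ennreal k2 * C" shows "x + y \<le> ennreal (k1 + k2) * C"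
  using add_mono[OF assms(3,4)] assms(1,2) by (simp add: distrib_right)

definition inf_const :: "real \<Rightarrow> real \<Rightarrow> real" where
  "inf_const q r = (2 powr r * (1 / (1 - (1/2) powr q)) powr (r / q)) powr (1 / r)"

context local_problem
begin

abbreviation "U \<equiv> \<lambda>x. \<integral>\<^sup>+t\<in>{x..d}. u t \<partial>lebesgue"

text \<open>
  Now 1 / v2 is extremal for the remaining linear inequality as well, so the constant is exactly
  the norm of \<Phi>1 * \<Phi>2.
\<close>

lemma two_sided_top_top:
  assumes q: "0 < q"
  shows "two_sided q top top c d u v1 v2 (char_inf_inf q c d u (profile top v1 c d) (profile top v2 c d)) 1"
    (is "two_sided _ _ _ _ _ _ _ _ ?A _")
proof -
  interpret sw: local_problem v2 v1 c d \<delta> u by (rule swap)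
  have A: "?A = (\<integral>\<^sup>+t. sw.H1 t epowr q * (H1 t epowr q * u t) \<partial>M) epowr (1 / q)"
  proof -
    have "(\<integral>\<^sup>+x\<in>{c..d}. (profile top v1 c d x * profile top v2 c d x) epowr q * u x \<partial>lebesgue) =
        (\<integral>\<^sup>+x. (profile top v1 c d x * profile top v2 c d x) epowr q * u x \<partial>M)"
      by (rule nn_integral_lebesgue_on[symmetric]) simp
    also have "\<dots> = (\<integral>\<^sup>+t. sw.H1 t epowr q * (H1 t epowr q * u t) \<partial>M)"
      using q by (intro nn_integral_cong) (simp add: profile_top_1 sw.profile_top_1 epowr_mult mult_ac)
    finally show ?thesis by (simp add: char_inf_inf_def)
  qed
  show ?thesis
    unfolding two_sided_def
  proof (intro conjI allI impI)
    fix C assume C: "C < top" and adm: "admissible q top top {c..d} u v1 v2 C"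
    let ?N = "wfunctional top v2 {c..d} (\<lambda>t. 1 / v2 t)"
    have "?N < top" using sw.H1_norm(2) by (rule le_less_trans) simp
    then have "(\<integral>\<^sup>+t. sw.H1 t epowr q * (H1 t epowr q * u t) \<partial>M) \<le> (C * ?N) epowr q"
      using adm sw.H1_norm(1) unfolding admissible_top_iff[OF q C] sw.H1_def by blast
    also have "\<dots> \<le> (C * 1) epowr q" using q by (intro epowr_mono mult_left_mono sw.H1_norm) auto
    finally show "?A \<le> ennreal 1 * C" unfolding A using q by (simp add: epowr_le_iff')
  next
    assume fin: "?A < top"
    show "admissible q top top {c..d} u v1 v2 (ennreal 1 * ?A)"
      unfolding ennreal_1 mult_1 admissible_top_iff[OF q fin]
    proof (intro ballI impI)
      fix g assume g: "g \<in> borel_measurable M" "wfunctional top v2 {c..d} g < top"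
      let ?N = "wfunctional top v2 {c..d} g"
      have "(\<integral>\<^sup>+t. hardy {c..d} g t epowr q * (H1 t epowr q * u t) \<partial>M) \<le>
          (\<integral>\<^sup>+t. (sw.H1 t * ?N) epowr q * (H1 t epowr q * u t) \<partial>M)"
        using q g by (intro nn_integral_mono mult_right_mono epowr_mono sw.H1_upper) auto
      also have "\<dots> = (\<integral>\<^sup>+t. ?N epowr q * (sw.H1 t epowr q * (H1 t epowr q * u t)) \<partial>M)"
        using q by (simp add: epowr_mult mult_ac)
      also have "\<dots> = ?N epowr q * (\<integral>\<^sup>+t. sw.H1 t epowr q * (H1 t epowr q * u t) \<partial>M)"
        by (rule nn_integral_cmult) measurable
      also have "\<dots> = (?A * ?N) epowr q" unfolding A using q by (simp add: epowr_mult mult.commute)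
      finally show "(\<integral>\<^sup>+t. hardy {c..d} g t epowr q * (H1 t epowr q * u t) \<partial>M) \<le> (?A * ?N) epowr q" .
    qed
  qed
qed

text \<open>
  The linear theory for the output weight \<Phi>1^q * u, whose tail is the function W1 of the
  characteristic.
\<close>

lemma two_sided_top_finite:
  assumes q: "0 < q" and p: "1 \<le> p" and r: "r = 1 / (1 / q - 1 / p)"
  shows "two_sided q top (ennreal p) c d u v1 v2
    (char_inf q (ennreal p) r c d (\<lambda>x. \<integral>\<^sup>+t\<in>{x..d}. (profile top v1 c d t epowr q * u t) \<partial>lebesgue) (profile (ennreal p) v2 c d))
    (max 1 (max (max 4 (inf_const q r * 2)) (max 4 (4 * suf_const r))))"
    (is "two_sided _ _ _ _ _ _ _ _ (char_inf _ _ _ _ _ ?W ?P) _")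
proof -
  obtain G where ps: "profile_scale p v2 c d G" using V2.ex_profile_scale[OF p] by blast
  interpret scale G c d using ps by (simp add: profile_scale_def)
  have P: "?P x = ennreal (G x)" if "x \<in> {c..d}" for x using ps that by (simp add: profile_scale_def)
  have p0: "0 < p" using p by simp
  define w where "w t = H1 t epowr q * u t" for t
  have w [measurable]: "w \<in> borel_measurable M" unfolding w_def[abs_def] by measurable
  define \<rho> where "\<rho> = line_measure c d w"
  have [simp]: "sets \<rho> = sets borel" by (simp add: \<rho>_def)
  have W: "?W x = emeasure \<rho> {x..}" if "x \<in> {c..d}" for x
  proof -
    have "?W x = (\<integral>\<^sup>+t\<in>{x..d}. w t \<partial>lebesgue)"
      using that by (intro nn_integral_cong) (auto simp: indicator_def w_def profile_top_1)
    then show ?thesis unfolding \<rho>_def by (simp add: emeasure_line_measure_tail[OF w that])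
  qed
  have low: "(\<integral>\<^sup>+t. cumul_step b t epowr q \<partial>\<rho>) \<le> (2 * C) epowr q * (\<Sum>n. b n epowr p) epowr (q / p)"
    if C: "C < top" "admissible q top (ennreal p) {c..d} u v1 v2 C" and b: "\<And>n. b n < top" "finite {n. b n \<noteq> 0}" for C b
  proof -
    have "(\<integral>\<^sup>+t. cumul_step b t epowr q \<partial>\<rho>) = (\<integral>\<^sup>+t. cumul_step b t epowr q * w t \<partial>M)"
      unfolding \<rho>_def by (rule nn_integral_line_measure) measurable
    also have "\<dots> \<le> (2 * C * (\<Sum>n. b n epowr p) epowr (1 / p)) epowr q"
      using C(2) unfolding admissible_top_iff[OF q C(1)] w_def[symmetric]
      by (intro V2.cumul_step_bound_of_hardy_bound[OF ps q p0 w _ b]) auto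
    finally show ?thesis using q p0 by (simp add: epowr_mult epowr_epowr)
  qed
  have up: "admissible q top (ennreal p) {c..d} u v1 v2 (4 * K)"
    if K: "K < top" and ub: "\<And>b. (\<integral>\<^sup>+t. cell_step b t epowr q \<partial>\<rho>) \<le> K epowr q * (\<Sum>n. b n epowr p) epowr (q / p)" for K
  proof -
    have "4 * K < top" using K by (simp add: ennreal_mult_less_top)
    then show ?thesis
      unfolding admissible_top_iff[OF q \<open>4 * K < top\<close>]
    proof (intro ballI impI)
      fix g assume g: "g \<in> borel_measurable M" "wfunctional (ennreal p) v2 {c..d} g < top"
      let ?N = "wfunctional (ennreal p) v2 {c..d} g"
      obtain b where b: "(\<Sum>n. b n epowr p) epowr (1 / p) \<le> 4 * ?N" "\<And>t. t \<in> {c..d} \<Longrightarrow> hardy {c..d} g t \<le> cell_step b t"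
        using ps g unfolding profile_scale_def by blast
      have "(\<integral>\<^sup>+t. hardy {c..d} g t epowr q * (H1 t epowr q * u t) \<partial>M) \<le> (\<integral>\<^sup>+t. cell_step b t epowr q * w t \<partial>M)"
        unfolding w_def using q by (intro nn_integral_mono mult_right_mono epowr_mono b) auto
      also have "\<dots> = (\<integral>\<^sup>+t. cell_step b t epowr q \<partial>\<rho>)"
        unfolding \<rho>_def by (rule nn_integral_line_measure[symmetric]) measurable
      also have "\<dots> \<le> K epowr q * (\<Sum>n. b n epowr p) epowr (q / p)" by (rule ub)
      also have "\<dots> = (K * (\<Sum>n. b n epowr p) epowr (1 / p)) epowr q"
        using q p0 by (simp add: epowr_mult epowr_epowr)
      also have "\<dots> \<le> (K * (4 * ?N)) epowr q" using q by (intro epowr_mono mult_left_mono b) auto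
      finally show "(\<integral>\<^sup>+t. hardy {c..d} g t epowr q * (H1 t epowr q * u t) \<partial>M) \<le> (4 * K * ?N) epowr q"
        by (simp add: mult_ac)
    qed
  qed
  show ?thesis
  proof (cases "p \<le> q")
    case True
    have ch: "char_inf q (ennreal p) r c d ?W ?P = (SUP x\<in>{c..d}. ennreal (G x) * emeasure \<rho> {x..} epowr (1 / q))"
    proof -
      have "char_inf q (ennreal p) r c d ?W ?P = (SUP x\<in>{c..d}. ?P x * ?W x epowr (1 / q))"
        using True by (simp add: char_inf_def ennreal_leI)
      also have "\<dots> = (SUP x\<in>{c..d}. ennreal (G x) * emeasure \<rho> {x..} epowr (1 / q))"
        by (intro SUP_cong refl) (simp only: P W)
      finally show ?thesis .
    qed
    show ?thesis unfolding ch
    proof (rule two_sidedI)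
      fix C assume C: "C < top" "admissible q top (ennreal p) {c..d} u v1 v2 C"
      show "(SUP x\<in>{c..d}. ennreal (G x) * emeasure \<rho> {x..} epowr (1 / q)) \<le> ennreal (max 4 (inf_const q r * 2)) * C"
      proof (rule SUP_least)
        fix x
        have "(ennreal (G x) epowr q * emeasure \<rho> {x..}) epowr (1 / q) \<le> ennreal ((2 powr q) powr (1 / q)) * (2 * C)"
          by (rule epowr_root_le[OF q]) (auto intro!: lower_sup[OF q p0] low[OF C])
        then have "ennreal (G x) * emeasure \<rho> {x..} epowr (1 / q) \<le> 4 * C"
          using q by (simp add: epowr_mult powr_powr mult.assoc[symmetric])
        also have "\<dots> \<le> ennreal (max 4 (inf_const q r * 2)) * C"
          by (intro mult_right_mono) (auto simp flip: ennreal_numeral intro: ennreal_leI)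
        finally show "ennreal (G x) * emeasure \<rho> {x..} epowr (1 / q) \<le> ennreal (max 4 (inf_const q r * 2)) * C" .
      qed
    next
      assume fin: "(SUP x\<in>{c..d}. ennreal (G x) * emeasure \<rho> {x..} epowr (1 / q)) < top" (is "?A < _")
      have "admissible q top (ennreal p) {c..d} u v1 v2 (4 * ?A)"
      proof (rule up[OF fin], rule cell_step_upper_sup[OF q p0 True])
        fix x assume "x \<in> {c..d}"
        then have "(ennreal (G x) * emeasure \<rho> {x..} epowr (1 / q)) epowr q \<le> ?A epowr q"
          using q by (intro epowr_mono SUP_upper) auto
        then show "ennreal (G x) epowr q * emeasure \<rho> {x..} \<le> ?A epowr q" using q by (simp add: epowr_mult)
      qed simp
      then show "admissible q top (ennreal p) {c..d} u v1 v2 (ennreal (max 4 (4 * suf_const r)) * ?A)"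
        by (rule admissible_mono) (intro mult_right_mono, auto simp flip: ennreal_numeral intro: ennreal_leI)
    qed
  next
    case False
    then have qp: "q < p" by simp
    have "1 / p < 1 / q" using q qp by (simp add: frac_less2)
    then have r0: "0 < r" and rr: "1 / r = 1 / q - 1 / p" by (simp_all add: r)
    have meas: "(\<lambda>x. emeasure \<rho> {x..} epowr (r / q)) \<in> borel_measurable borel"
      using q r0 by (intro borel_measurable_antimono_ennreal epowr_mono antimono_tail) auto
    have ch: "char_inf q (ennreal p) r c d ?W ?P = (\<integral>\<^sup>+x. emeasure \<rho> {x..} epowr (r / q) \<partial>mu r) epowr (1 / r)"
    proof -
      have "(\<integral>\<^sup>+x\<in>{c..d}. ?W x epowr (r / q) \<partial>mu r) = (\<integral>\<^sup>+x\<in>{c..d}. emeasure \<rho> {x..} epowr (r / q) \<partial>mu r)"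
      proof (rule nn_integral_cong)
        fix x
        have "?W x = emeasure \<rho> {x..}" if "x \<in> {c..d}" by (rule W[OF that])
        moreover have "indicator {c..d} x = (0 :: ennreal)" if "x \<notin> {c..d}" using that by (rule indicator_simps(2))
        ultimately show "?W x epowr (r / q) * indicator {c..d} x = emeasure \<rho> {x..} epowr (r / q) * indicator {c..d} x"
          by (metis mult_zero_right)
      qed
      moreover have "stieltjes c d (\<lambda>y. ?P y epowr r) = mu r" by (rule stieltjes_eq_mu[OF r0]) (rule P)
      moreover have "\<not> ennreal p \<le> ennreal q" using qp q by simp
      ultimately show ?thesis
        unfolding char_inf_def nn_integral_mu_Icc[OF r0 meas] by (simp only: if_False)
    qed
    show ?thesis unfolding ch
    proof (rule two_sidedI)
      fix C assume C: "C < top" "admissible q top (ennreal p) {c..d} u v1 v2 C"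
      have "(\<integral>\<^sup>+x. emeasure \<rho> {x..} epowr (r / q) \<partial>mu r) \<le>
          ennreal (2 powr r * (1 / (1 - (1/2) powr q)) powr (r / q)) * ((2 * C) epowr q) epowr (r / q)"
        using C(1) q by (intro lower_int[OF q qp rr] low[OF C]) (auto simp: ennreal_mult_less_top)
      also have "((2 * C) epowr q) epowr (r / q) = (2 * C) epowr r" using q r0 by (simp add: epowr_epowr)
      finally have "(\<integral>\<^sup>+x. emeasure \<rho> {x..} epowr (r / q) \<partial>mu r) epowr (1 / r) \<le> ennreal (inf_const q r) * (2 * C)"
        unfolding inf_const_def by (intro epowr_root_le r0) auto
      also have "\<dots> = ennreal (inf_const q r * 2) * C"
        by (subst ennreal_mult) (auto simp: inf_const_def mult.assoc)
      also have "\<dots> \<le> ennreal (max 4 (inf_const q r * 2)) * C" by (intro mult_right_mono ennreal_leI) auto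
      finally show "(\<integral>\<^sup>+x. emeasure \<rho> {x..} epowr (r / q) \<partial>mu r) epowr (1 / r) \<le> ennreal (max 4 (inf_const q r * 2)) * C" .
    next
      assume fin: "(\<integral>\<^sup>+x. emeasure \<rho> {x..} epowr (r / q) \<partial>mu r) epowr (1 / r) < top" (is "?A < _")
      have s0: "0 < suf_const r"
        by (rule suf_const[OF r0])
      have "admissible q top (ennreal p) {c..d} u v1 v2 (4 * (ennreal (suf_const r) * ?A))"
      proof (rule up)
        show "ennreal (suf_const r) * ?A < top" using fin by (simp add: ennreal_mult_less_top)
        fix b
        have "(\<integral>\<^sup>+t. cell_step b t epowr q \<partial>\<rho>) \<le> ennreal ((1 / (1 - (1/2) powr r)) powr (q / r)) *
            (\<integral>\<^sup>+x. emeasure \<rho> {x..} epowr (r / q) \<partial>mu r) epowr (q / r) * (\<Sum>n. b n epowr p) epowr (q / p)"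
          by (rule cell_step_upper_int[OF q qp rr]) simp
        then show "(\<integral>\<^sup>+t. cell_step b t epowr q \<partial>\<rho>) \<le> (ennreal (suf_const r) * ?A) epowr q * (\<Sum>n. b n epowr p) epowr (q / p)"
          using q r0 powr_half_less_1[OF r0]
          by (simp add: epowr_mult epowr_epowr suf_const_def epowr_ennreal powr_powr)
      qed
      also have "4 * (ennreal (suf_const r) * ?A) = ennreal (4 * suf_const r) * ?A"
        using s0 by (subst ennreal_mult) (auto simp: mult.assoc)
      finally show "admissible q top (ennreal p) {c..d} u v1 v2 (ennreal (max 4 (4 * suf_const r)) * ?A)"
        by (rule admissible_mono) (intro mult_right_mono ennreal_leI, auto)
    qed
  qed
qed

end

subsection \<open>Two finite exponents\<close>

locale finite_problem = local_problem v1 v2 c d \<delta> u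
  for v1 v2 :: "real \<Rightarrow> ennreal" and c d \<delta> :: real and u :: "real \<Rightarrow> ennreal" +
  fixes q p1 p2 :: real and G1 G2 :: "real \<Rightarrow> real"
  assumes q_pos: "0 < q" and p_ge_1: "1 \<le> p1" "1 \<le> p2"
    and ps: "profile_scale p1 v1 c d G1" "profile_scale p2 v2 c d G2"
begin

sublocale two_scales G1 G2 c d "line_measure c d u"
  using ps by (intro two_scales.intro two_scales_axioms.intro) (simp_all add: profile_scale_def)

abbreviation "P1 \<equiv> profile (ennreal p1) v1 c d"
abbreviation "P2 \<equiv> profile (ennreal p2) v2 c d"

lemma p_pos: "0 < p1" "0 < p2"
  using p_ge_1 by auto

lemma U_eq_tail: "x \<in> {c..d} \<Longrightarrow> U x = tail x"
  unfolding tail_def by (rule emeasure_line_measure_tail[symmetric, OF u_measurable])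

lemma profiles_eq: "x \<in> {c..d} \<Longrightarrow> P1 x = ennreal (G1 x)" "x \<in> {c..d} \<Longrightarrow> P2 x = ennreal (G2 x)"
  using ps by (simp_all add: profile_scale_def)

lemma bilinear_bound_of_constant:
  "admissible q (ennreal p1) (ennreal p2) {c..d} u v1 v2 C \<Longrightarrow> bilinear_bound q p1 p2 ((4 * C) epowr q)"
  by (rule bilinear_bound_of_admissible[OF q_pos p_pos ps])

lemma constant_of_upper_bound:
  "upper_bound q p1 p2 K \<Longrightarrow> admissible q (ennreal p1) (ennreal p2) {c..d} u v1 v2 (16 * K)"
  by (rule admissible_of_upper_bound[OF q_pos p_pos ps])

lemma two_sided_char1:
  assumes q: "p1 \<le> q" "p2 \<le> q"
  shows "two_sided q (ennreal p1) (ennreal p2) c d u v1 v2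
    (char1 q c d U P1 P2) (max 1 (max 16 16))"
    (is "two_sided _ _ _ _ _ _ _ _ ?A _")
proof -
  have ch: "?A = (SUP x\<in>{c..d}. tail x epowr (1 / q) * ennreal (G1 x) * ennreal (G2 x))"
    by (rule char1_eq[OF U_eq_tail profiles_eq])
  show ?thesis
  proof (rule two_sidedI)
    fix C assume "C < top" "admissible q (ennreal p1) (ennreal p2) {c..d} u v1 v2 C"
    then have bd: "bilinear_bound q p1 p2 ((4 * C) epowr q)"
      by (intro bilinear_bound_of_constant)
    show "?A \<le> ennreal 16 * C"
      unfolding ch
    proof (rule SUP_least)
      fix x
      have "tail x epowr (1 / q) * ennreal (G1 x) * ennreal (G2 x) \<le> 4 * (4 * C)"
        by (rule necessary_char1[OF q_pos p_pos bd])
      then show "tail x epowr (1 / q) * ennreal (G1 x) * ennreal (G2 x) \<le> ennreal 16 * C"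
        by (simp add: mult.assoc[symmetric])
    qed
  next
    have "upper_bound q p1 p2 ?A"
      unfolding ch by (rule sufficient_char1[OF q_pos p_pos(1) q(1) p_pos(2) q(2)]) (rule SUP_upper)
    then have "admissible q (ennreal p1) (ennreal p2) {c..d} u v1 v2 (16 * ?A)"
      by (rule constant_of_upper_bound)
    then show "admissible q (ennreal p1) (ennreal p2) {c..d} u v1 v2 (ennreal 16 * ?A)" by simp
  qed
qed

text \<open>
  Sufficiency is the iterated linear bound with the roles of the scales exchanged: the sequence
  with p1 \<le> q comes second.
\<close>

lemma two_sided_char_hat:
  assumes q: "p1 \<le> q" "q < p2" and r: "r = 1 / (1 / q - 1 / p2)"
  shows "two_sided q (ennreal p1) (ennreal p2) c d u v1 v2
    (char_hat q r c d U P1 P2)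
    (max 1 (max (hat_const q r * 4) (16 * suf_const r)))"
    (is "two_sided _ _ _ _ _ _ _ _ ?A _")
proof -
  interpret sw: two_scales G2 G1 c d \<nu> by unfold_locales simp
  have "1 / p2 < 1 / q" using q q_pos by (simp add: frac_less2)
  then have r0: "0 < r" and rr: "1 / r = 1 / q - 1 / p2" by (simp_all add: r)
  have ch: "?A = (SUP x\<in>{c..d}. ennreal (G1 x) * (\<integral>\<^sup>+t. tail (max x t) epowr (r / q) \<partial>B.mu r) epowr (1 / r))"
    by (rule char_hat_eq[OF U_eq_tail profiles_eq q_pos r0])
  have hat0: "0 \<le> hat_const q r" by (simp add: hat_const_def)
  show ?thesis
  proof (rule two_sidedI)
    fix C assume C: "C < top" "admissible q (ennreal p1) (ennreal p2) {c..d} u v1 v2 C"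
    then have bd: "bilinear_bound q p1 p2 ((4 * C) epowr q)"
      by (intro bilinear_bound_of_constant)
    have C4: "4 * C < top" using C by (simp add: ennreal_mult_less_top)
    show "?A \<le> ennreal (hat_const q r * 4) * C"
      unfolding ch
    proof (rule SUP_least)
      fix x
      have "ennreal (G1 x) * (\<integral>\<^sup>+t. tail (max x t) epowr (r / q) \<partial>B.mu r) epowr (1 / r) \<le> ennreal (hat_const q r) * (4 * C)"
        by (rule necessary_char_hat[OF q_pos p_pos(1) q(2) rr r0 bd C4])
      then show "ennreal (G1 x) * (\<integral>\<^sup>+t. tail (max x t) epowr (r / q) \<partial>B.mu r) epowr (1 / r) \<le> ennreal (hat_const q r * 4) * C"
        using hat0 by (simp add: ennreal_mult mult.assoc)
    qed
  next
    have "sw.upper_bound q p2 p1 (ennreal (suf_const r) * ?A)"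
      unfolding ch by (rule sw.sufficient_char_hat[OF q_pos q(2) rr p_pos(1) q(1) r0, unfolded sw.tail_def, folded tail_def]) (rule SUP_upper)
    then have "upper_bound q p1 p2 (ennreal (suf_const r) * ?A)" by (rule upper_bound_swap)
    then have "admissible q (ennreal p1) (ennreal p2) {c..d} u v1 v2 (16 * (ennreal (suf_const r) * ?A))"
      by (rule constant_of_upper_bound)
    then show "admissible q (ennreal p1) (ennreal p2) {c..d} u v1 v2 (ennreal (16 * suf_const r) * ?A)"
      using suf_const[OF r0] by (simp add: ennreal_mult mult.assoc)
  qed
qed

text \<open>
  The first characteristic controls one half of the staircase, the second one the other half.
  The hypothesis on the exponents amounts to p1 \<le> r2 and p2 \<le> r1.
\<close>

lemma two_sided_char4_5:
  assumes q: "q < p1" "q < p2" and le: "1 / q \<le> 1 / p1 + 1 / p2"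
    and r: "r1 = 1 / (1 / q - 1 / p1)" "r2 = 1 / (1 / q - 1 / p2)"
  shows "two_sided q (ennreal p1) (ennreal p2) c d u v1 v2
    (char4 q r2 c d U P1 P2 +
     char5 q r1 c d U P1 P2)
    (max 1 (max (hat_const q r2 * 4 + hat_const q r1 * 4)
      (16 * (2 powr (1 / q) * (stair_const q r2 p2 * 2 + stair_const q r1 p1 * 2)))))"
    (is "two_sided _ _ _ _ _ _ _ _ (?A4 + ?A5) _")
proof -
  interpret sw: two_scales G2 G1 c d \<nu> by unfold_locales simp
  have "1 / p2 < 1 / q" "1 / p1 < 1 / q" using q q_pos by (simp_all add: frac_less2)
  then have r0: "0 < r1" "0 < r2" and rr: "1 / r1 = 1 / q - 1 / p1" "1 / r2 = 1 / q - 1 / p2" by (simp_all add: r)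
  have pr: "p1 \<le> r2" "p2 \<le> r1"
  proof -
    have "1 / r2 \<le> 1 / p1" "1 / r1 \<le> 1 / p2" using le rr by auto
    then show "p1 \<le> r2" "p2 \<le> r1" using r0 p_pos by (simp_all add: field_simps)
  qed
  have Us: "U x = sw.tail x" if "x \<in> {c..d}" for x using U_eq_tail[OF that] by (simp add: tail_def sw.tail_def)
  have ch4: "?A4 = (SUP x\<in>{c..d}. ennreal (G1 x) * tail_mu q r2 {x..} epowr (1 / r2))"
    by (rule char4_eq[OF U_eq_tail profiles_eq r0(2)])
  have ch5: "?A5 = (SUP x\<in>{c..d}. ennreal (G2 x) * sw.tail_mu q r1 {x<..} epowr (1 / r1))"
    by (rule sw.char5_eq[OF Us profiles_eq(2,1) r0(1)])
  have tm: "sw.tail_mu q r S = tail_mu' q r S" for q r S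
    by (simp add: sw.tail_mu_def tail_mu'_def tail_def sw.tail_def)
  have hat0: "0 \<le> hat_const q r" for q r by (simp add: hat_const_def)
  show ?thesis
  proof (rule two_sidedI)
    fix C assume C: "C < top" "admissible q (ennreal p1) (ennreal p2) {c..d} u v1 v2 C"
    then have bd: "bilinear_bound q p1 p2 ((4 * C) epowr q)"
      by (intro bilinear_bound_of_constant)
    have C4: "4 * C < top" using C by (simp add: ennreal_mult_less_top)
    have "?A4 \<le> ennreal (hat_const q r2) * (4 * C)"
      unfolding ch4 by (intro SUP_least necessary_char_tail[OF q_pos p_pos(1) q(2) rr(2) r0(2) bd C4]) auto
    moreover have "?A5 \<le> ennreal (hat_const q r1) * (4 * C)"
      unfolding ch5
      by (intro SUP_least sw.necessary_char_tail[OF q_pos p_pos(2) q(1) rr(1) r0(1) bilinear_bound_swap[OF bd] C4]) auto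
    ultimately show "?A4 + ?A5 \<le> ennreal (hat_const q r2 * 4 + hat_const q r1 * 4) * C"
      using hat0[of q r1] hat0[of q r2] by (intro add_le_ennreal_mult) (simp_all add: ennreal_mult mult.assoc)
  next
    have s0: "0 \<le> stair_const q r2 p2" "0 \<le> stair_const q r1 p1"
      using suf_const[OF r0(1)] suf_const[OF r0(2)] by (simp_all add: stair_const_def)
    let ?K = "ennreal (2 powr (1 / q)) * (ennreal (stair_const q r2 p2) * (2 * ?A4) + ennreal (stair_const q r1 p1) * (2 * ?A5))"
    have "upper_bound q p1 p2 ?K"
    proof (rule upper_bound_staircase[OF q_pos q(1) q(2) rr(1) r0(1) rr(2) r0(2)])
      fix a
      show "(\<Sum>j. (a j * ennreal (A.level j)) epowr r2 * tail_mu q r2 {A.level_pt (Suc j)..}) epowr (q / r2)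
        \<le> (2 * ?A4) epowr q * (\<Sum>j. a j epowr p1) epowr (q / p1)"
        unfolding ch4 by (rule sup_rows[OF q_pos r0(2) p_pos(1) pr(1), of "\<lambda>x. tail_mu q r2 {x..}"]) (rule SUP_upper)
      show "(\<Sum>k. (a k * ennreal (B.level k)) epowr r1 * tail_mu' q r1 {B.level_pt (Suc k)<..}) epowr (q / r1)
        \<le> (2 * ?A5) epowr q * (\<Sum>k. a k epowr p2) epowr (q / p2)"
        unfolding ch5 tm by (rule sw.sup_rows[OF q_pos r0(1) p_pos(2) pr(2), of "\<lambda>x. tail_mu' q r1 {x<..}"]) (rule SUP_upper)
    qed
    then have "admissible q (ennreal p1) (ennreal p2) {c..d} u v1 v2 (16 * ?K)"
      by (rule constant_of_upper_bound)
    moreover have "16 * ?K \<le> ennreal (16 * (2 powr (1 / q) * (stair_const q r2 p2 * 2 + stair_const q r1 p1 * 2))) * (?A4 + ?A5)"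
    proof -
      have "ennreal (stair_const q r2 p2) * (2 * ?A4) + ennreal (stair_const q r1 p1) * (2 * ?A5) =
          ennreal (stair_const q r2 p2 * 2) * ?A4 + ennreal (stair_const q r1 p1 * 2) * ?A5"
        using s0 by (simp add: ennreal_mult mult.assoc)
      also have "\<dots> \<le> ennreal (stair_const q r2 p2 * 2 + stair_const q r1 p1 * 2) * (?A4 + ?A5)"
        using s0 by (intro ennreal_add_mult_le) auto
      finally have "16 * ?K \<le> 16 * (ennreal (2 powr (1 / q)) * (ennreal (stair_const q r2 p2 * 2 + stair_const q r1 p1 * 2) * (?A4 + ?A5)))"
        by (intro mult_left_mono) auto
      also have "\<dots> = ennreal (16 * (2 powr (1 / q) * (stair_const q r2 p2 * 2 + stair_const q r1 p1 * 2))) * (?A4 + ?A5)"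
        using s0 by (simp add: ennreal_mult mult.assoc del: ennreal_plus)
      finally show ?thesis .
    qed
    ultimately show "admissible q (ennreal p1) (ennreal p2) {c..d} u v1 v2
        (ennreal (16 * (2 powr (1 / q) * (stair_const q r2 p2 * 2 + stair_const q r1 p1 * 2))) * (?A4 + ?A5))"
      by (rule admissible_mono)
  qed
qed

text \<open>
  As in the preceding lemma, but now r2 < p1 and r1 < p2, and the exponent \<kappa> satisfies
  1/\<kappa> = 1/r2 - 1/p1 = 1/r1 - 1/p2.
\<close>

lemma two_sided_char6_7:
  assumes q: "q < p1" "q < p2" and less: "1 / p1 + 1 / p2 < 1 / q"
    and r: "r1 = 1 / (1 / q - 1 / p1)" "r2 = 1 / (1 / q - 1 / p2)" and \<kappa>: "\<kappa> = 1 / (1 / q - 1 / p1 - 1 / p2)"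
  shows "two_sided q (ennreal p1) (ennreal p2) c d u v1 v2
    (char6 q r2 \<kappa> c d U P1 P2 +
     char7 q r1 \<kappa> c d U P1 P2)
    (max 1 (max (int_const q r2 \<kappa> * 4 + int_const q r1 \<kappa> * 4)
      (16 * (2 powr (1 / q) * (stair_const q r2 p2 * rows_const \<kappa> +
         stair_const q r1 p1 * rows_const \<kappa>)))))"
    (is "two_sided _ _ _ _ _ _ _ _ (?A6 + ?A7) _")
proof -
  interpret sw: two_scales G2 G1 c d \<nu> by unfold_locales simp
  have "1 / p2 < 1 / q" "1 / p1 < 1 / q" using q q_pos by (simp_all add: frac_less2)
  then have r0: "0 < r1" "0 < r2" and rr: "1 / r1 = 1 / q - 1 / p1" "1 / r2 = 1 / q - 1 / p2" by (simp_all add: r)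
  have k0: "0 < \<kappa>" using less by (simp add: \<kappa>)
  have kk: "1 / \<kappa> = 1 / r2 - 1 / p1" "1 / \<kappa> = 1 / r1 - 1 / p2" using rr by (simp_all add: \<kappa>)
  have pr: "r2 < p1" "r1 < p2"
  proof -
    have "1 / p1 < 1 / r2" "1 / p2 < 1 / r1" using less rr by auto
    then show "r2 < p1" "r1 < p2" using r0 p_pos by (simp_all add: field_simps)
  qed
  have Us: "U x = sw.tail x" if "x \<in> {c..d}" for x using U_eq_tail[OF that] by (simp add: tail_def sw.tail_def)
  have ch6: "?A6 = (\<integral>\<^sup>+x. tail_mu q r2 {x..} epowr (\<kappa> / r2) \<partial>A.mu \<kappa>) epowr (1 / \<kappa>)"
    by (rule char6_eq[OF U_eq_tail profiles_eq r0(2) k0])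
  have ch7: "?A7 = (\<integral>\<^sup>+x. sw.tail_mu q r1 {x<..} epowr (\<kappa> / r1) \<partial>B.mu \<kappa>) epowr (1 / \<kappa>)"
    by (rule sw.char7_eq[OF Us profiles_eq(2,1) r0(1) k0])
  have tm: "sw.tail_mu q r S = tail_mu' q r S" for q r S
    by (simp add: sw.tail_mu_def tail_mu'_def tail_def sw.tail_def)
  have int0: "0 \<le> int_const q r \<kappa>" for q r \<kappa> by (simp add: int_const_def)
  have rows0: "0 \<le> rows_const \<kappa>" by (simp add: rows_const_def)
  show ?thesis
  proof (rule two_sidedI)
    fix C assume C: "C < top" "admissible q (ennreal p1) (ennreal p2) {c..d} u v1 v2 C"
    then have bd: "bilinear_bound q p1 p2 ((4 * C) epowr q)"
      by (intro bilinear_bound_of_constant)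
    have C4: "4 * C < top" using C by (simp add: ennreal_mult_less_top)
    have "?A6 \<le> ennreal (int_const q r2 \<kappa>) * (4 * C)"
      unfolding ch6 by (rule necessary_char_int[OF q_pos q(1) q(2) rr(2) r0(2) pr(1) kk(1) k0 bd C4]) simp
    moreover have "?A7 \<le> ennreal (int_const q r1 \<kappa>) * (4 * C)"
      unfolding ch7
      by (rule sw.necessary_char_int[OF q_pos q(2) q(1) rr(1) r0(1) pr(2) kk(2) k0 bilinear_bound_swap[OF bd] C4]) auto
    ultimately show "?A6 + ?A7 \<le> ennreal (int_const q r2 \<kappa> * 4 + int_const q r1 \<kappa> * 4) * C"
      using int0[of q r1 \<kappa>] int0[of q r2 \<kappa>] by (intro add_le_ennreal_mult) (simp_all add: ennreal_mult mult.assoc)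
  next
    have s0: "0 \<le> stair_const q r2 p2" "0 \<le> stair_const q r1 p1"
      using suf_const[OF r0(1)] suf_const[OF r0(2)] by (simp_all add: stair_const_def)
    let ?R = "rows_const \<kappa>"
    let ?K = "ennreal (2 powr (1 / q)) * (ennreal (stair_const q r2 p2) * (ennreal ?R * ?A6) + ennreal (stair_const q r1 p1) * (ennreal ?R * ?A7))"
    have "upper_bound q p1 p2 ?K"
    proof (rule upper_bound_staircase[OF q_pos q(1) q(2) rr(1) r0(1) rr(2) r0(2)])
      fix a
      show "(\<Sum>j. (a j * ennreal (A.level j)) epowr r2 * tail_mu q r2 {A.level_pt (Suc j)..}) epowr (q / r2)
        \<le> (ennreal ?R * ?A6) epowr q * (\<Sum>j. a j epowr p1) epowr (q / p1)"
        unfolding ch6 by (rule int_rows[OF q_pos r0(2) pr(1) kk(1) k0, of "\<lambda>x. tail_mu q r2 {x..}"]) (auto intro: tail_mu_mono)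
      show "(\<Sum>k. (a k * ennreal (B.level k)) epowr r1 * tail_mu' q r1 {B.level_pt (Suc k)<..}) epowr (q / r1)
        \<le> (ennreal ?R * ?A7) epowr q * (\<Sum>k. a k epowr p2) epowr (q / p2)"
        unfolding ch7 tm[symmetric]
        by (rule sw.int_rows[OF q_pos r0(1) pr(2) kk(2) k0, of "\<lambda>x. sw.tail_mu q r1 {x<..}"]) (auto intro: sw.tail_mu_mono)
    qed
    then have "admissible q (ennreal p1) (ennreal p2) {c..d} u v1 v2 (16 * ?K)"
      by (rule constant_of_upper_bound)
    moreover have "16 * ?K \<le> ennreal (16 * (2 powr (1 / q) * (stair_const q r2 p2 * ?R + stair_const q r1 p1 * ?R))) * (?A6 + ?A7)"
    proof -
      have "ennreal (stair_const q r2 p2) * (ennreal ?R * ?A6) + ennreal (stair_const q r1 p1) * (ennreal ?R * ?A7) =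
          ennreal (stair_const q r2 p2 * ?R) * ?A6 + ennreal (stair_const q r1 p1 * ?R) * ?A7"
        using s0 rows0 by (simp add: ennreal_mult mult.assoc)
      also have "\<dots> \<le> ennreal (stair_const q r2 p2 * ?R + stair_const q r1 p1 * ?R) * (?A6 + ?A7)"
        using s0 rows0 by (intro ennreal_add_mult_le) auto
      finally have "16 * ?K \<le> 16 * (ennreal (2 powr (1 / q)) * (ennreal (stair_const q r2 p2 * ?R + stair_const q r1 p1 * ?R) * (?A6 + ?A7)))"
        by (intro mult_left_mono) auto
      also have "\<dots> = ennreal (16 * (2 powr (1 / q) * (stair_const q r2 p2 * ?R + stair_const q r1 p1 * ?R))) * (?A6 + ?A7)"
        using s0 rows0 by (simp add: ennreal_mult mult.assoc del: ennreal_plus)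
      finally show ?thesis .
    qed
    ultimately show "admissible q (ennreal p1) (ennreal p2) {c..d} u v1 v2
        (ennreal (16 * (2 powr (1 / q) * (stair_const q r2 p2 * ?R + stair_const q r1 p1 * ?R))) * (?A6 + ?A7))"
      by (rule admissible_mono)
  qed
qed

end

lemma (in local_problem) finite_problemE:
  assumes "0 < q" "1 \<le> p1" "1 \<le> p2"
  obtains G1 G2 where "finite_problem v1 v2 c d \<delta> u q p1 p2 G1 G2"
proof -
  obtain G1 G2 where "profile_scale p1 v1 c d G1" "profile_scale p2 v2 c d G2"
    using V1.ex_profile_scale[OF assms(2)] V2.ex_profile_scale[OF assms(3)] by blast
  then have "finite_problem v1 v2 c d \<delta> u q p1 p2 G1 G2"
    using assms by (intro finite_problem.intro finite_problem_axioms.intro local_problem_axioms)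
  then show ?thesis by (rule that)
qed

text \<open>
  The case distinction on the exponents.  The constant is chosen before the weights and the
  interval, and it is 1 if both exponents are infinite.
\<close>

theorem local_two_sided:
  fixes q :: real and p1 p2 :: ennreal
  assumes q: "0 < q" "1 \<le> p1" "1 \<le> p2"
  shows "\<exists>K\<ge>1. (p1 = top \<and> p2 = top \<longrightarrow> K = 1) \<and>
    (\<forall>v1 v2 c d \<delta> u. local_problem v1 v2 c d \<delta> u \<longrightarrow> two_sided q p1 p2 c d u v1 v2 (local_char q p1 p2 u v1 v2 c d) K)"
proof -
  have fin: "\<exists>p. P = ennreal p \<and> 1 \<le> p" if "1 \<le> P" "P \<noteq> top" for P :: ennreal
    using that by (cases P) auto
  consider (tt) "p1 = top" "p2 = top" | (tf) p where "p1 = top" "p2 = ennreal p" "1 \<le> p"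
    | (ft) p where "p1 = ennreal p" "p2 = top" "1 \<le> p"
    | (ff) s1 s2 where "p1 = ennreal s1" "1 \<le> s1" "p2 = ennreal s2" "1 \<le> s2"
    using fin[OF q(2)] fin[OF q(3)] by metis
  then show ?thesis
  proof cases
    case tt
    then show ?thesis
      using local_problem.two_sided_top_top[OF _ q(1)] by (intro exI[of _ 1]) (simp add: local_char_def Let_def)
  next
    case tf
    have "\<exists>K. \<forall>v1 v2 c d \<delta> u. local_problem v1 v2 c d \<delta> u \<longrightarrow>
        two_sided q p1 p2 c d u v1 v2 (char_inf q (ennreal p) (1 / (1 / q - 1 / p)) c d
          (\<lambda>x. \<integral>\<^sup>+t\<in>{x..d}. (profile top v1 c d t epowr q * u t) \<partial>lebesgue) (profile (ennreal p) v2 c d)) (max 1 K)"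
      unfolding tf(1,2)
      by (intro exI allI impI) (rule local_problem.two_sided_top_finite[OF _ q(1) tf(3) refl])
    then obtain K where K: "\<And>v1 v2 c d \<delta> u. local_problem v1 v2 c d \<delta> u \<Longrightarrow>
        two_sided q p1 p2 c d u v1 v2 (char_inf q (ennreal p) (1 / (1 / q - 1 / p)) c d
          (\<lambda>x. \<integral>\<^sup>+t\<in>{x..d}. (profile top v1 c d t epowr q * u t) \<partial>lebesgue) (profile (ennreal p) v2 c d)) (max 1 K)" by blast
    have "local_char q p1 p2 u v1 v2 c d = char_inf q (ennreal p) (1 / (1 / q - 1 / p)) c d
          (\<lambda>x. \<integral>\<^sup>+t\<in>{x..d}. (profile top v1 c d t epowr q * u t) \<partial>lebesgue) (profile (ennreal p) v2 c d)" for u v1 v2 c d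
      using tf by (simp add: local_char_def Let_def)
    then show ?thesis using K tf by (intro exI[of _ "max 1 K"]) (simp only:, simp)
  next
    case ft
    have "\<exists>K. \<forall>v1 v2 c d \<delta> u. local_problem v1 v2 c d \<delta> u \<longrightarrow>
        two_sided q p1 p2 c d u v1 v2 (char_inf q (ennreal p) (1 / (1 / q - 1 / p)) c d
          (\<lambda>x. \<integral>\<^sup>+t\<in>{x..d}. (profile top v2 c d t epowr q * u t) \<partial>lebesgue) (profile (ennreal p) v1 c d)) (max 1 K)"
      unfolding ft(1,2)
      by (intro exI allI impI) (rule two_sided_swap[OF local_problem.two_sided_top_finite[OF local_problem.swap q(1) ft(3) refl]])
    then obtain K where K: "\<And>v1 v2 c d \<delta> u. local_problem v1 v2 c d \<delta> u \<Longrightarrow>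
        two_sided q p1 p2 c d u v1 v2 (char_inf q (ennreal p) (1 / (1 / q - 1 / p)) c d
          (\<lambda>x. \<integral>\<^sup>+t\<in>{x..d}. (profile top v2 c d t epowr q * u t) \<partial>lebesgue) (profile (ennreal p) v1 c d)) (max 1 K)" by blast
    have "local_char q p1 p2 u v1 v2 c d = char_inf q (ennreal p) (1 / (1 / q - 1 / p)) c d
          (\<lambda>x. \<integral>\<^sup>+t\<in>{x..d}. (profile top v2 c d t epowr q * u t) \<partial>lebesgue) (profile (ennreal p) v1 c d)" for u v1 v2 c d
      using ft by (simp add: local_char_def Let_def)
    then show ?thesis using K ft by (intro exI[of _ "max 1 K"]) (simp only:, simp)
  next
    case ff
    have pos: "0 \<le> s1" "0 \<le> s2" using ff by auto
    have char: "local_char q p1 p2 u v1 v2 c d =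
      (let P1 = profile (ennreal s1) v1 c d; P2 = profile (ennreal s2) v2 c d; U = (\<lambda>x. \<integral>\<^sup>+t\<in>{x..d}. u t \<partial>lebesgue);
         r1 = 1 / (1 / q - 1 / s1); r2 = 1 / (1 / q - 1 / s2); \<kappa> = 1 / (1 / q - 1 / s1 - 1 / s2)
       in if s1 \<le> q \<and> s2 \<le> q then char1 q c d U P1 P2
        else if s1 \<le> q then char_hat q r2 c d U P1 P2
        else if s2 \<le> q then char_hat q r1 c d U P2 P1
        else if 1 / q \<le> 1 / s1 + 1 / s2 then char4 q r2 c d U P1 P2 + char5 q r1 c d U P1 P2
        else char6 q r2 \<kappa> c d U P1 P2 + char7 q r1 \<kappa> c d U P1 P2)" for u v1 v2 c d
      unfolding local_char_def Let_def ff(1,3) using pos q(1) by simp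
    have top: "\<not> (p1 = top \<and> p2 = top)" using ff by simp
    consider (1) "s1 \<le> q" "s2 \<le> q" | (2) "s1 \<le> q" "q < s2" | (3) "q < s1" "s2 \<le> q"
      | (4) "q < s1" "q < s2" "1 / q \<le> 1 / s1 + 1 / s2" | (5) "q < s1" "q < s2" "1 / s1 + 1 / s2 < 1 / q"
      by linarith
    then have "\<exists>K. \<forall>v1 v2 c d \<delta> u. local_problem v1 v2 c d \<delta> u \<longrightarrow>
        two_sided q p1 p2 c d u v1 v2 (local_char q p1 p2 u v1 v2 c d) (max 1 K)"
    proof cases
      case 1
      then have eq: "local_char q p1 p2 u v1 v2 c d =
          char1 q c d (\<lambda>x. \<integral>\<^sup>+t\<in>{x..d}. u t \<partial>lebesgue) (profile (ennreal s1) v1 c d) (profile (ennreal s2) v2 c d)" for u v1 v2 c d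
        unfolding char Let_def by simp
      show ?thesis unfolding eq unfolding ff(1,3)
        by (intro exI allI impI) (erule local_problem.finite_problemE[OF _ q(1) ff(2,4)], rule finite_problem.two_sided_char1[OF _ 1])
    next
      case 2
      then have eq: "local_char q p1 p2 u v1 v2 c d =
          char_hat q (1 / (1 / q - 1 / s2)) c d (\<lambda>x. \<integral>\<^sup>+t\<in>{x..d}. u t \<partial>lebesgue) (profile (ennreal s1) v1 c d) (profile (ennreal s2) v2 c d)" for u v1 v2 c d
        unfolding char Let_def by simp
      show ?thesis unfolding eq unfolding ff(1,3)
        by (intro exI allI impI) (erule local_problem.finite_problemE[OF _ q(1) ff(2,4)], rule finite_problem.two_sided_char_hat[OF _ 2 refl])
    next
      case 3
      then have eq: "local_char q p1 p2 u v1 v2 c d =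
          char_hat q (1 / (1 / q - 1 / s1)) c d (\<lambda>x. \<integral>\<^sup>+t\<in>{x..d}. u t \<partial>lebesgue) (profile (ennreal s2) v2 c d) (profile (ennreal s1) v1 c d)" for u v1 v2 c d
        unfolding char Let_def by simp
      show ?thesis unfolding eq unfolding ff(1,3)
        by (intro exI allI impI) (rule two_sided_swap, drule local_problem.swap,
            erule local_problem.finite_problemE[OF _ q(1) ff(4,2)], rule finite_problem.two_sided_char_hat[OF _ 3(2,1) refl])
    next
      case 4
      then have eq: "local_char q p1 p2 u v1 v2 c d =
          char4 q (1 / (1 / q - 1 / s2)) c d (\<lambda>x. \<integral>\<^sup>+t\<in>{x..d}. u t \<partial>lebesgue) (profile (ennreal s1) v1 c d) (profile (ennreal s2) v2 c d) +
          char5 q (1 / (1 / q - 1 / s1)) c d (\<lambda>x. \<integral>\<^sup>+t\<in>{x..d}. u t \<partial>lebesgue) (profile (ennreal s1) v1 c d) (profile (ennreal s2) v2 c d)" for u v1 v2 c d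
        unfolding char Let_def by simp
      show ?thesis unfolding eq unfolding ff(1,3)
        by (intro exI allI impI) (erule local_problem.finite_problemE[OF _ q(1) ff(2,4)], rule finite_problem.two_sided_char4_5[OF _ 4 refl refl])
    next
      case 5
      then have eq: "local_char q p1 p2 u v1 v2 c d =
          char6 q (1 / (1 / q - 1 / s2)) (1 / (1 / q - 1 / s1 - 1 / s2)) c d (\<lambda>x. \<integral>\<^sup>+t\<in>{x..d}. u t \<partial>lebesgue) (profile (ennreal s1) v1 c d) (profile (ennreal s2) v2 c d) +
          char7 q (1 / (1 / q - 1 / s1)) (1 / (1 / q - 1 / s1 - 1 / s2)) c d (\<lambda>x. \<integral>\<^sup>+t\<in>{x..d}. u t \<partial>lebesgue) (profile (ennreal s1) v1 c d) (profile (ennreal s2) v2 c d)" for u v1 v2 c d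
        unfolding char Let_def by simp
      show ?thesis unfolding eq unfolding ff(1,3)
        by (intro exI allI impI) (erule local_problem.finite_problemE[OF _ q(1) ff(2,4)], rule finite_problem.two_sided_char6_7[OF _ 5 refl refl refl])
    qed
    then obtain K where K: "\<And>v1 v2 c d \<delta> u. local_problem v1 v2 c d \<delta> u \<Longrightarrow>
        two_sided q p1 p2 c d u v1 v2 (local_char q p1 p2 u v1 v2 c d) (max 1 K)" by blast
    show ?thesis
      using K top by (intro exI[of _ "max 1 K"]) auto
  qed
qed

section \<open>Exhaustion of an interval by compact intervals\<close>

lemma min_of_nat_SUP: "(SUP n. min x (of_nat (Suc n))) = (x :: ennreal)"
proof (rule antisym)
  show "(SUP n. min x (of_nat (Suc n))) \<le> x" by (intro SUP_least) simp
  show "x \<le> (SUP n. min x (of_nat (Suc n)))"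
  proof (cases x)
    case (real r)
    obtain n where "r \<le> real n" using real_arch_simple by blast
    then have "x \<le> of_nat (Suc n)"
      using real by (simp add: ennreal_of_nat_eq_real_of_nat ennreal_le_iff del: of_nat_Suc)
    then have "x = min x (of_nat (Suc n))" by (simp add: min_def)
    also have "\<dots> \<le> (SUP n. min x (of_nat (Suc n)))" by (rule SUP_upper) simp
    finally show ?thesis .
  next
    case top
    have "(SUP n. of_nat n :: ennreal) \<le> (SUP n. of_nat (Suc n))"
    proof (rule SUP_mono)
      fix n :: nat
      show "\<exists>m\<in>UNIV. of_nat n \<le> (of_nat (Suc m) :: ennreal)" by (intro bexI[of _ n]) (simp_all add: add_increasing)
    qed
    then show ?thesis using top by (simp add: ennreal_SUP_of_nat_eq_top top_unique min_def del: of_nat_Suc)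
  qed
qed

lemma incseq_min_of_nat: "incseq (\<lambda>n. min x (of_nat (Suc n)) :: ennreal)"
  by (intro incseq_SucI min.mono) (auto simp del: of_nat_Suc intro: of_nat_mono)

text \<open>
  Covering almost every point suffices for integrals and avoids a distinction of the endpoint
  types of I.
\<close>

definition exhausts :: "(nat \<Rightarrow> real) \<Rightarrow> (nat \<Rightarrow> real) \<Rightarrow> real set \<Rightarrow> bool" where
  "exhausts l r I \<longleftrightarrow> (\<forall>n. l n < r n) \<and> (\<forall>n. {l n..r n} \<subseteq> I) \<and>
    (\<forall>m n. m \<le> n \<longrightarrow> {l m..r m} \<subseteq> {l n..r n}) \<and> (AE t in lebesgue_on I. \<exists>n. t \<in> {l n..r n})"

lemma exhaustsD:
  assumes "exhausts l r I"
  shows "l n < r n" "{l n..r n} \<subseteq> I" "m \<le> n \<Longrightarrow> {l m..r m} \<subseteq> {l n..r n}"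
    "AE t in lebesgue_on I. \<exists>n. t \<in> {l n..r n}"
  using assms unfolding exhausts_def by (simp_all only:)

text \<open>
  The intervals spanned by the first n rational points of the interior.  Two further points x <
  b of the interior keep them nondegenerate, and the frontier of an interval is a null set.
\<close>

lemma interval_exhaustion:
  fixes I :: "real set"
  assumes I: "is_interval I" "interior I \<noteq> {}"
  shows "\<exists>l r. exhausts l r I"
proof -
  obtain x where "x \<in> interior I" using I by blast
  then obtain e where e: "0 < e" "ball x e \<subseteq> interior I" using open_contains_ball[of "interior I"] by auto
  define b where "b = x + e / 2"
  have xb: "x < b" "b \<in> interior I" "x \<in> interior I" using e by (auto simp: b_def dist_real_def)
  define Q where "Q = \<rat> \<inter> interior I"
  have Qc: "countable Q" unfolding Q_def by (intro countable_Int1 countable_rat)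
  have Qd: "\<exists>s\<in>Q. \<exists>s'\<in>Q. s < t \<and> t < s'" if "t \<in> interior I" for t
  proof -
    obtain \<epsilon> where \<epsilon>: "0 < \<epsilon>" "ball t \<epsilon> \<subseteq> interior I"
      using \<open>t \<in> interior I\<close> open_interior[of I] unfolding open_contains_ball by blast
    obtain s where s: "s \<in> \<rat>" "t - \<epsilon> < s" "s < t" using Rats_dense_in_real[of "t - \<epsilon>" t] \<epsilon> by auto
    obtain s' where s': "s' \<in> \<rat>" "t < s'" "s' < t + \<epsilon>" using Rats_dense_in_real[of t "t + \<epsilon>"] \<epsilon> by auto
    have "s \<in> ball t \<epsilon>" "s' \<in> ball t \<epsilon>" using s s' by (auto simp: dist_real_def)
    with s s' \<epsilon>(2) show ?thesis by (auto simp: Q_def)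
  qed
  have Qne: "Q \<noteq> {}" using Qd[OF xb(3)] by auto
  define z where "z = from_nat_into Q"
  have zr: "range z = Q" unfolding z_def by (rule range_from_nat_into[OF Qne Qc])
  then have zI: "z i \<in> interior I" for i by (auto simp: Q_def)
  define l where "l n = Min (insert x (z ` {..n}))" for n
  define r where "r n = Max (insert b (z ` {..n}))" for n
  have lx: "l n \<le> x" "b \<le> r n" for n by (auto simp: l_def r_def)
  have lz: "l n \<le> z i" "z i \<le> r n" if "i \<le> n" for i n
    unfolding l_def r_def using that by (auto intro!: Min_le Max_ge simp del: Min_insert Max_insert)
  have lmem: "l n \<in> insert x (z ` {..n})" for n unfolding l_def by (rule Min_in) auto
  have lI: "l n \<in> interior I" for n using lmem[of n] zI xb by auto
  have rmem: "r n \<in> insert b (z ` {..n})" for n unfolding r_def by (rule Max_in) auto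
  have rI: "r n \<in> interior I" for n using rmem[of n] zI xb by auto
  have "exhausts l r I"
    unfolding exhausts_def
  proof (intro conjI allI impI)
    show "l n < r n" for n using lx[of n] xb by linarith
    show "{l n..r n} \<subseteq> I" for n
    proof
      fix t assume "t \<in> {l n..r n}"
      moreover have "l n \<in> I" "r n \<in> I" using lI rI interior_subset by blast+
      ultimately show "t \<in> I" using I(1) unfolding is_interval_1 by (metis atLeastAtMost_iff)
    qed
    show "{l m..r m} \<subseteq> {l n..r n}" if "m \<le> n" for m n
    proof -
      have "l n \<le> l m" unfolding l_def by (rule Min_antimono) (use that in auto)
      moreover have "r m \<le> r n" unfolding r_def by (rule Max_mono) (use that in auto)
      ultimately show ?thesis by auto
    qed
    have in_int: "\<exists>n. t \<in> {l n..r n}" if t: "t \<in> interior I" for t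
    proof -
      obtain s s' where "s \<in> range z" "s' \<in> range z" "s < t" "t < s'" using Qd[OF t] zr by auto
      then obtain i j where "z i < t" "t < z j" by auto
      then have "l (max i j) \<le> t" "t \<le> r (max i j)" using lz[of i "max i j"] lz[of j "max i j"] by auto
      then show ?thesis by auto
    qed
    have "negligible (frontier I)" using I(1) by (intro negligible_convex_frontier) (simp add: is_interval_convex_1)
    then have "AE t in lebesgue. t \<notin> frontier I"
      by (intro AE_not_in) (simp add: negligible_iff_null_sets)
    then have "AE t in lebesgue. t \<in> I \<longrightarrow> (\<exists>n. t \<in> {l n..r n})"
    proof eventually_elim
      case (elim t)
      show ?case
      proof
        assume "t \<in> I"
        then have "t \<in> interior I" using elim closure_subset[of I] by (auto simp: frontier_def)
        then show "\<exists>n. t \<in> {l n..r n}" by (rule in_int)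
      qed
    qed
    moreover have "I \<in> sets lebesgue" using I(1) by (simp add: real_interval_borel_measurable)
    ultimately show "AE t in lebesgue_on I. \<exists>n. t \<in> {l n..r n}"
      by (subst AE_restrict_space_iff) simp_all
  qed
  then show ?thesis by blast
qed

section \<open>From compact intervals to the whole interval\<close>

locale global_problem =
  fixes I :: "real set" and u v1 v2 :: "real \<Rightarrow> ennreal" and q :: real and p1 p2 :: ennreal
  assumes I: "is_interval I" "interior I \<noteq> {}"
    and u [measurable]: "u \<in> borel_measurable (lebesgue_on I)"
    and v1 [measurable]: "v1 \<in> borel_measurable (lebesgue_on I)"
    and v2 [measurable]: "v2 \<in> borel_measurable (lebesgue_on I)"
    and q: "0 < q" and p: "1 \<le> p1" "1 \<le> p2"
begin

lemma I_sets [simp]: "I \<in> sets lebesgue"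
  using I(1) by (simp add: real_interval_borel_measurable)

lemma lebesgue_on_sub: "{c..d} \<subseteq> I \<Longrightarrow> lebesgue_on {c..d} = restrict_space (lebesgue_on I) {c..d}"
  by (simp add: restrict_restrict_space Int_absorb1)

lemma measurable_sub: "f \<in> borel_measurable (lebesgue_on I) \<Longrightarrow> {c..d} \<subseteq> I \<Longrightarrow> f \<in> borel_measurable (lebesgue_on {c..d})"
  unfolding lebesgue_on_sub by (rule measurable_restrict_space1)

lemma local_problem:
  assumes sub: "c < d" "{c..d} \<subseteq> I" and m: "1 \<le> m"
  shows "local_problem (\<lambda>t. v1 t + 1 / of_nat m) (\<lambda>t. v2 t + 1 / of_nat m) c d (1 / real m) (\<lambda>t. min (u t) (of_nat m))"
proof -
  have [measurable]: "u \<in> borel_measurable (lebesgue_on {c..d})" "v1 \<in> borel_measurable (lebesgue_on {c..d})"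
    "v2 \<in> borel_measurable (lebesgue_on {c..d})"
    by (rule measurable_sub[OF u sub(2)], rule measurable_sub[OF v1 sub(2)], rule measurable_sub[OF v2 sub(2)])
  have inv: "ennreal (1 / real m) = 1 / of_nat m"
    using m divide_ennreal[of 1 "real m"] by (simp add: ennreal_of_nat_eq_real_of_nat)
  show ?thesis
  proof (intro local_problem.intro local_weight.intro local_problem_axioms.intro)
    show "(\<lambda>t. v1 t + 1 / of_nat m) \<in> borel_measurable (lebesgue_on {c..d})"
      "(\<lambda>t. v2 t + 1 / of_nat m) \<in> borel_measurable (lebesgue_on {c..d})"
      "(\<lambda>t. min (u t) (of_nat m)) \<in> borel_measurable (lebesgue_on {c..d})" by measurable
    show "0 < 1 / real m" using m by simp
    show "ennreal (1 / real m) \<le> v1 t + 1 / of_nat m" "ennreal (1 / real m) \<le> v2 t + 1 / of_nat m" for t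
      unfolding inv by (auto simp: add_increasing)
  qed (use sub m in auto)
qed

lemma exponent_pos: "1 \<le> s \<Longrightarrow> s \<noteq> top \<Longrightarrow> 0 < enn2real s"
  by (cases s) auto

lemma norm_extend_le:
  assumes sub: "{c..d} \<subseteq> I" and s: "1 \<le> s" and v: "v \<in> borel_measurable (lebesgue_on I)"
    and f: "f \<in> borel_measurable (lebesgue_on {c..d})" and ww: "\<And>t. v t \<le> w t"
  shows "(\<lambda>t. f t * indicator {c..d} t) \<in> borel_measurable (lebesgue_on I)"
    and "wfunctional s v I (\<lambda>t. f t * indicator {c..d} t) \<le> wfunctional s w {c..d} f"
proof -
  have "(\<lambda>t. f t * indicator {c..d} t) \<in> borel_measurable lebesgue"
    using f by (subst (asm) borel_measurable_restrict_space_iff_ennreal) auto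
  then show meas: "(\<lambda>t. f t * indicator {c..d} t) \<in> borel_measurable (lebesgue_on I)"
    by (rule measurable_restrict_space1)
  show "wfunctional s v I (\<lambda>t. f t * indicator {c..d} t) \<le> wfunctional s w {c..d} f"
  proof (cases "s = top")
    case True
    have "AE t in lebesgue_on {c..d}. f t * w t \<le> esssup (lebesgue_on {c..d}) (\<lambda>t. f t * w t)" by (rule esssup_AE)
    then have ae: "AE t in lebesgue_on I. t \<in> {c..d} \<longrightarrow> f t * w t \<le> esssup (lebesgue_on {c..d}) (\<lambda>t. f t * w t)"
      unfolding lebesgue_on_sub[OF sub]
      by (subst (asm) AE_restrict_space_iff) (use sub in \<open>auto simp: sets_restrict_space_iff Int_absorb2\<close>)
    have "esssup (lebesgue_on I) (\<lambda>t. f t * indicator {c..d} t * v t) \<le> esssup (lebesgue_on {c..d}) (\<lambda>t. f t * w t)"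
    proof (rule esssup_I)
      show "(\<lambda>t. f t * indicator {c..d} t * v t) \<in> borel_measurable (lebesgue_on I)" using meas v by measurable
      show "AE t in lebesgue_on I. f t * indicator {c..d} t * v t \<le> esssup (lebesgue_on {c..d}) (\<lambda>t. f t * w t)"
        using ae
      proof eventually_elim
        case (elim t)
        have "f t * v t \<le> f t * w t" by (rule mult_left_mono[OF ww]) simp
        with elim show ?case by (auto simp: indicator_def intro: order_trans)
      qed
    qed
    then show ?thesis using True by (simp add: wfunctional_def)
  next
    case False
    let ?s = "enn2real s"
    have s0: "0 < ?s" using s False by (rule exponent_pos)
    have "(\<integral>\<^sup>+t. (f t * indicator {c..d} t) epowr ?s * v t * indicator I t \<partial>lebesgue) \<le>
        (\<integral>\<^sup>+t. f t epowr ?s * w t * indicator {c..d} t \<partial>lebesgue)"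
    proof (rule nn_integral_mono)
      fix t
      have "f t epowr ?s * v t \<le> f t epowr ?s * w t" by (rule mult_left_mono[OF ww]) simp
      then show "(f t * indicator {c..d} t) epowr ?s * v t * indicator I t \<le> f t epowr ?s * w t * indicator {c..d} t"
        using s0 sub by (auto simp: indicator_def)
    qed
    then show ?thesis using False s0 unfolding wfunctional_def by (simp add: epowr_mono)
  qed
qed

lemma hardy_extend: "{c..d} \<subseteq> I \<Longrightarrow> hardy I (\<lambda>t. f t * indicator {c..d} t) x = hardy {c..d} f x"
  unfolding hardy_def by (intro nn_integral_cong) (auto simp: indicator_def)

text \<open>
  Functions on [c,d] are extended by 0.  Lowering u reduces the left-hand side, and raising v1
  and v2 increases the right-hand side.
\<close>

lemma admissible_restrict:
  assumes sub: "c < d" "{c..d} \<subseteq> I" and adm: "admissible q p1 p2 I u v1 v2 C"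
    and w: "\<And>t. w t \<le> u t" "\<And>t. v1 t \<le> w1 t" "\<And>t. v2 t \<le> w2 t"
  shows "admissible q p1 p2 {c..d} w w1 w2 C"
  unfolding admissible_def
proof (intro allI impI)
  fix f g assume f: "f \<in> borel_measurable (lebesgue_on {c..d})" and g: "g \<in> borel_measurable (lebesgue_on {c..d})"
    and fin: "wfunctional p1 w1 {c..d} f < top" "wfunctional p2 w2 {c..d} g < top"
  let ?f = "\<lambda>t. f t * indicator {c..d} t" and ?g = "\<lambda>t. g t * indicator {c..d} t"
  note f' = norm_extend_le[OF sub(2) p(1) v1 f w(2)] and g' = norm_extend_le[OF sub(2) p(2) v2 g w(3)]
  have "wfunctional (ennreal q) w {c..d} (bihardy {c..d} f g) \<le> wfunctional (ennreal q) u I (bihardy I ?f ?g)"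
  proof -
    have "(\<integral>\<^sup>+t. bihardy {c..d} f g t epowr q * w t * indicator {c..d} t \<partial>lebesgue) \<le>
        (\<integral>\<^sup>+t. bihardy I ?f ?g t epowr q * u t * indicator I t \<partial>lebesgue)"
    proof (rule nn_integral_mono)
      fix t
      have "bihardy {c..d} f g t epowr q * w t \<le> bihardy {c..d} f g t epowr q * u t" by (rule mult_left_mono[OF w(1)]) simp
      moreover have "bihardy I ?f ?g t = bihardy {c..d} f g t" by (simp add: bihardy_def hardy_extend[OF sub(2)])
      ultimately show "bihardy {c..d} f g t epowr q * w t * indicator {c..d} t \<le> bihardy I ?f ?g t epowr q * u t * indicator I t"
        using sub(2) by (auto simp: indicator_def)
    qed
    then show ?thesis using q unfolding wfunctional_def by (simp add: epowr_mono)
  qed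
  also have "\<dots> \<le> C * wfunctional p1 v1 I ?f * wfunctional p2 v2 I ?g"
    using f' g' fin by (intro admissibleD[OF adm]) (auto intro: le_less_trans)
  also have "\<dots> \<le> C * wfunctional p1 w1 {c..d} f * wfunctional p2 w2 {c..d} g"
    using f' g' by (intro mult_mono mult_left_mono) auto
  finally show "wfunctional (ennreal q) w {c..d} (bihardy {c..d} f g) \<le> C * wfunctional p1 w1 {c..d} f * wfunctional p2 w2 {c..d} g" .
qed

text \<open>
  For f bounded by n on a bounded interval, adding 1/m to the weight can raise the norm above
  that of the majorant f' only by an amount that vanishes as m grows.  The bounds \<alpha> m are
  real numbers, since limits of products are taken later and multiplication is not continuous at
  0 * \<infinity>.
\<close>

lemma norm_regularised:
  assumes sub: "c < d" "{c..d} \<subseteq> I" and s: "1 \<le> s" and v [measurable]: "v \<in> borel_measurable (lebesgue_on I)"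
    and f [measurable]: "f \<in> borel_measurable (lebesgue_on I)"
    and bound: "\<And>t. f t \<le> of_nat n" "\<And>t. f t \<le> f' t" and f' [measurable]: "f' \<in> borel_measurable (lebesgue_on I)"
    and fin': "wfunctional s v I f' < top"
  shows "\<exists>\<alpha>. (\<forall>m\<ge>1. wfunctional s (\<lambda>t. v t + 1 / of_nat m) {c..d} f \<le> ennreal (\<alpha> m)) \<and>
    \<alpha> \<longlonglongrightarrow> enn2real (wfunctional s v I f') \<and> (\<forall>m. 0 \<le> \<alpha> m)"
proof -
  let ?J = "{c..d}"
  have [measurable]: "v \<in> borel_measurable (lebesgue_on ?J)" "f \<in> borel_measurable (lebesgue_on ?J)"
    by (rule measurable_sub[OF v sub(2)], rule measurable_sub[OF f sub(2)])
  have inv: "1 / of_nat m = ennreal (1 / real m)" if "1 \<le> m" for m :: nat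
    using that divide_ennreal[of 1 "real m"] by (simp add: ennreal_of_nat_eq_real_of_nat)
  have lim: "(\<lambda>m. k / real m) \<longlonglongrightarrow> 0" for k :: real by (rule lim_const_over_n)
  show ?thesis
  proof (cases "s = top")
    case True
    define N where "N = enn2real (wfunctional s v I f')"
    have N: "esssup (lebesgue_on I) (\<lambda>t. f' t * v t) = ennreal N" "0 \<le> N"
      using fin' True by (simp_all add: N_def wfunctional_def less_top)
    have "AE t in lebesgue_on I. f' t * v t \<le> ennreal N" using esssup_AE[of "\<lambda>t. f' t * v t" "lebesgue_on I"] unfolding N .
    then have "AE t in lebesgue. t \<in> I \<longrightarrow> f' t * v t \<le> ennreal N" by (subst (asm) AE_restrict_space_iff) auto
    then have ae: "AE t in lebesgue_on ?J. f' t * v t \<le> ennreal N"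
      by (subst AE_restrict_space_iff) (use sub in \<open>auto elim!: eventually_mono\<close>)
    have "wfunctional s (\<lambda>t. v t + 1 / of_nat m) ?J f \<le> ennreal (N + real n / real m)" if m: "1 \<le> m" for m
    proof -
      have "esssup (lebesgue_on ?J) (\<lambda>t. f t * (v t + 1 / of_nat m)) \<le> ennreal (N + real n / real m)"
      proof (rule esssup_I)
        show "AE t in lebesgue_on ?J. f t * (v t + 1 / of_nat m) \<le> ennreal (N + real n / real m)"
          using ae
        proof eventually_elim
          case (elim t)
          have "f t * (v t + 1 / of_nat m) \<le> f' t * v t + of_nat n * (1 / of_nat m)"
            unfolding distrib_left by (intro add_mono mult_right_mono bound) auto
          also have "\<dots> \<le> ennreal N + of_nat n * (1 / of_nat m)" using elim by (intro add_right_mono)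
          also have "of_nat n * (1 / of_nat m) = ennreal (real n / real m)"
            unfolding inv[OF m] by (simp add: ennreal_of_nat_eq_real_of_nat flip: ennreal_mult)
          finally show ?case using N by simp
        qed
      qed measurable
      then show ?thesis using True by (simp add: wfunctional_def)
    qed
    moreover have "(\<lambda>m. N + real n / real m) \<longlonglongrightarrow> N" using tendsto_add[OF tendsto_const lim[of "real n"]] by simp
    ultimately show ?thesis using N(2) unfolding N_def[symmetric] by (intro exI[of _ "\<lambda>m. N + real n / real m"]) auto
  next
    case False
    let ?s = "enn2real s"
    have s0: "0 < ?s" using s False by (rule exponent_pos)
    define X where "X = enn2real (\<integral>\<^sup>+t. f' t epowr ?s * v t \<partial>lebesgue_on I)"
    have wI: "wfunctional s v I f' = (\<integral>\<^sup>+t. f' t epowr ?s * v t \<partial>lebesgue_on I) epowr (1 / ?s)"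
      by (rule wfunctional_eq[OF I_sets False])
    then have X: "(\<integral>\<^sup>+t. f' t epowr ?s * v t \<partial>lebesgue_on I) = ennreal X" "0 \<le> X"
      using fin' s0 by (simp_all add: X_def less_top)
    have N: "enn2real (wfunctional s v I f') = X powr (1 / ?s)"
      unfolding wI X using s0 X(2) by (simp add: epowr_ennreal)
    define Y where "Y = real n powr ?s * (d - c)"
    have Y: "0 \<le> Y" using sub by (simp add: Y_def)
    have "wfunctional s (\<lambda>t. v t + 1 / of_nat m) ?J f \<le> ennreal ((X + Y / real m) powr (1 / ?s))" if m: "1 \<le> m" for m
    proof -
      have "(\<integral>\<^sup>+t. f t epowr ?s * (v t + 1 / of_nat m) \<partial>lebesgue_on ?J) =
          (\<integral>\<^sup>+t. f t epowr ?s * v t \<partial>lebesgue_on ?J) + (\<integral>\<^sup>+t. f t epowr ?s * (1 / of_nat m) \<partial>lebesgue_on ?J)"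
        by (simp add: distrib_left nn_integral_add)
      also have "\<dots> \<le> ennreal X + ennreal (Y / real m)"
      proof (intro add_mono)
        have "(\<integral>\<^sup>+t. f t epowr ?s * v t \<partial>lebesgue_on ?J) = (\<integral>\<^sup>+t. f t epowr ?s * v t * indicator ?J t \<partial>lebesgue)"
          by (rule nn_integral_lebesgue_on) simp
        also have "\<dots> \<le> (\<integral>\<^sup>+t. f' t epowr ?s * v t * indicator I t \<partial>lebesgue)"
          using sub s0 by (intro nn_integral_mono mult_mono epowr_mono bound) (auto simp: indicator_def)
        also have "\<dots> = ennreal X" unfolding X(1)[symmetric] by (rule nn_integral_lebesgue_on[symmetric]) simp
        finally show "(\<integral>\<^sup>+t. f t epowr ?s * v t \<partial>lebesgue_on ?J) \<le> ennreal X" .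
        have "(\<integral>\<^sup>+t. f t epowr ?s * (1 / of_nat m) \<partial>lebesgue_on ?J) \<le> (\<integral>\<^sup>+t. ennreal (real n powr ?s) * (1 / of_nat m) \<partial>lebesgue_on ?J)"
        proof (intro nn_integral_mono mult_right_mono)
          fix t
          have "f t epowr ?s \<le> of_nat n epowr ?s" by (rule epowr_mono[OF bound(1) s0])
          then show "f t epowr ?s \<le> ennreal (real n powr ?s)" using s0 by (simp add: ennreal_of_nat_eq_real_of_nat epowr_ennreal)
        qed simp
        also have "\<dots> = ennreal (real n powr ?s) * (1 / of_nat m) * ennreal (d - c)"
          using sub by (simp add: emeasure_restrict_space)
        also have "\<dots> = ennreal (Y / real m)"
          unfolding inv[OF m] using sub by (simp add: Y_def mult.commute flip: ennreal_mult)
        finally show "(\<integral>\<^sup>+t. f t epowr ?s * (1 / of_nat m) \<partial>lebesgue_on ?J) \<le> ennreal (Y / real m)" .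
      qed
      also have "\<dots> = ennreal (X + Y / real m)" using X Y by simp
      finally have "(\<integral>\<^sup>+t. f t epowr ?s * (v t + 1 / of_nat m) \<partial>lebesgue_on ?J) epowr (1 / ?s) \<le> ennreal (X + Y / real m) epowr (1 / ?s)"
        using s0 by (intro epowr_mono) auto
      also have "\<dots> = ennreal ((X + Y / real m) powr (1 / ?s))" using s0 X Y by (intro epowr_ennreal) auto
      finally show ?thesis using wfunctional_eq[OF Icc_sets_lebesgue False] by simp
    qed
    moreover have "(\<lambda>m. (X + Y / real m) powr (1 / ?s)) \<longlonglongrightarrow> X powr (1 / ?s)"
    proof (rule tendsto_powr')
      show "(\<lambda>m. X + Y / real m) \<longlonglongrightarrow> X" using tendsto_add[OF tendsto_const lim[of Y]] by simp
    qed (use s0 X Y in \<open>auto intro!: always_eventually\<close>)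
    ultimately show ?thesis unfolding N by (intro exI[of _ "\<lambda>m. (X + Y / real m) powr (1 / ?s)"]) auto
  qed
qed

lemma reg_char_le_dir_char:
  assumes "c < d" "{c..d} \<subseteq> I" "1 \<le> m"
  shows "reg_char q p1 p2 u v1 v2 c d m \<le> dir_char q p1 p2 I u v1 v2"
proof -
  have "reg_char q p1 p2 u v1 v2 c d m \<le> (SUP m\<in>{1..}. reg_char q p1 p2 u v1 v2 c d m)"
    using assms(3) by (intro SUP_upper) simp
  also have "\<dots> \<le> dir_char q p1 p2 I u v1 v2"
    unfolding dir_char_def by (rule SUP_upper2[of "(c, d)"]) (use assms in auto)
  finally show ?thesis .
qed

lemma hardy_SUP:
  assumes J: "\<And>n. {l n..r n} \<subseteq> I" "\<And>m n. m \<le> n \<Longrightarrow> {l m..r m} \<subseteq> {l n..r n}"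
    and cover: "AE t in lebesgue_on I. \<exists>n. t \<in> {l n..r n}"
    and f [measurable]: "f \<in> borel_measurable (lebesgue_on I)"
  shows "hardy I f x = (SUP n. hardy {l n..r n} (\<lambda>t. min (f t) (of_nat (Suc n))) x)"
    and "incseq (\<lambda>n. hardy {l n..r n} (\<lambda>t. min (f t) (of_nat (Suc n))) x)"
proof -
  let ?h = "\<lambda>n t. min (f t) (of_nat (Suc n)) * indicator {l n..r n} t * indicator {..x} t"
  have h: "hardy {l n..r n} (\<lambda>t. min (f t) (of_nat (Suc n))) x = (\<integral>\<^sup>+t. ?h n t \<partial>lebesgue_on I)" for n
    unfolding hardy_def nn_integral_lebesgue_on[OF I_sets] using J(1)[of n]
    by (intro nn_integral_cong) (auto simp: indicator_def)
  have ind: "incseq (\<lambda>n. indicator {l n..r n} t :: ennreal)" for t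
  proof (rule monoI)
    fix m n :: nat assume "m \<le> n"
    from J(2)[OF this] show "indicator {l m..r m} t \<le> (indicator {l n..r n} t :: ennreal)"
      by (auto simp: indicator_def)
  qed
  have h_mono: "?h m t \<le> ?h n t" if "m \<le> n" for m n t
    by (intro mult_right_mono mult_mono incseqD[OF incseq_min_of_nat that] incseqD[OF ind that]) simp_all
  have inc: "incseq ?h" by (intro monoI le_funI h_mono)
  have meas: "?h n \<in> borel_measurable (lebesgue_on I)" for n
  proof -
    have [measurable]: "(\<lambda>t. indicator {l n..r n} t :: ennreal) \<in> borel_measurable (lebesgue_on I)"
      "(\<lambda>t. indicator {..x} t :: ennreal) \<in> borel_measurable (lebesgue_on I)"
      by (intro borel_measurable_lebesgue_onI borel_measurable_indicator; simp)+
    show ?thesis by measurable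
  qed
  have "hardy I f x = (\<integral>\<^sup>+t. f t * indicator {..x} t \<partial>lebesgue_on I)" by (rule hardy_eq[OF I_sets])
  also have "\<dots> = (\<integral>\<^sup>+t. (SUP n. ?h n t) \<partial>lebesgue_on I)"
  proof (rule nn_integral_cong_AE, rule AE_mp[OF cover], rule AE_I2, rule impI)
    fix t assume "\<exists>n. t \<in> {l n..r n}"
    then obtain n where n: "t \<in> {l n..r n}" by blast
    have one: "(SUP n. indicator {l n..r n} t) = (1::ennreal)"
    proof (rule antisym)
      have "(1::ennreal) = indicator {l n..r n} t" using n by simp
      also have "\<dots> \<le> (SUP n. indicator {l n..r n} t)" by (rule SUP_upper) simp
      finally show "1 \<le> (SUP n. indicator {l n..r n} t :: ennreal)" .
    qed (auto intro!: SUP_least simp: indicator_def)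
    have "(SUP n. ?h n t) = (SUP n. min (f t) (of_nat (Suc n)) * indicator {l n..r n} t) * indicator {..x} t"
      by (rule SUP_mult_right_ennreal[symmetric])
    also have "\<dots> = f t * 1 * indicator {..x} t"
      unfolding SUP_mult_incseq[OF incseq_min_of_nat ind, symmetric] min_of_nat_SUP one ..
    finally show "f t * indicator {..x} t = (SUP n. ?h n t)" by simp
  qed
  also have "\<dots> = (SUP n. \<integral>\<^sup>+t. ?h n t \<partial>lebesgue_on I)"
    by (rule nn_integral_monotone_convergence_SUP[OF inc meas])
  finally show "hardy I f x = (SUP n. hardy {l n..r n} (\<lambda>t. min (f t) (of_nat (Suc n))) x)" unfolding h .
  show "incseq (\<lambda>n. hardy {l n..r n} (\<lambda>t. min (f t) (of_nat (Suc n))) x)"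
  proof (rule monoI)
    fix m n :: nat assume "m \<le> n"
    then show "hardy {l m..r m} (\<lambda>t. min (f t) (of_nat (Suc m))) x \<le> hardy {l n..r n} (\<lambda>t. min (f t) (of_nat (Suc n))) x"
      unfolding h by (intro nn_integral_mono h_mono)
  qed
qed

text \<open>
  On the n-th interval of the exhaustion, with f, g and u truncated at n + 1, the local theorem
  applies to the regularised weights for every m > n, with a constant that does not depend on m.
  Letting m tend to infinity replaces the regularised norms by the norms on I, and then n tends
  to infinity by monotone convergence.
\<close>

lemma admissible_of_dir_char:
  assumes K: "1 \<le> K"
    and loc: "\<And>v1 v2 c d \<delta> u. local_problem v1 v2 c d \<delta> u \<Longrightarrow> two_sided q p1 p2 c d u v1 v2 (local_char q p1 p2 u v1 v2 c d) K"
    and fin: "dir_char q p1 p2 I u v1 v2 < top"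
  shows "admissible q p1 p2 I u v1 v2 (ennreal K * dir_char q p1 p2 I u v1 v2)"
  unfolding admissible_def
proof (intro allI impI)
  fix f g assume f [measurable]: "f \<in> borel_measurable (lebesgue_on I)" and g [measurable]: "g \<in> borel_measurable (lebesgue_on I)"
    and fN: "wfunctional p1 v1 I f < top" and gN: "wfunctional p2 v2 I g < top"
  let ?D = "dir_char q p1 p2 I u v1 v2"
  let ?Nf = "wfunctional p1 v1 I f" and ?Ng = "wfunctional p2 v2 I g"
  obtain l r where ex: "exhausts l r I" using interval_exhaustion[OF I] by blast
  note lr = exhaustsD(1-3)[OF ex] and cover = exhaustsD(4)[OF ex]
  define fn where "fn n t = min (f t) (of_nat (Suc n))" for n t
  define gn where "gn n t = min (g t) (of_nat (Suc n))" for n t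
  have [measurable]: "fn n \<in> borel_measurable (lebesgue_on I)" "gn n \<in> borel_measurable (lebesgue_on I)" for n
    unfolding fn_def[abs_def] gn_def[abs_def] by measurable
  let ?w = "\<lambda>n t. min (u t) (of_nat (Suc n))"
  obtain k where k: "ennreal K * ?D = ennreal k" "0 \<le> k"
    using fin K by (cases "ennreal K * ?D") (auto simp: ennreal_mult_eq_top_iff)
  have piece: "wfunctional (ennreal q) (?w n) {l n..r n} (bihardy {l n..r n} (fn n) (gn n)) \<le> ennreal K * ?D * ?Nf * ?Ng" for n
  proof -
    let ?J = "{l n..r n}"
    have J: "l n < r n" "?J \<subseteq> I" by (rule lr)+
    obtain \<alpha> where \<alpha>: "\<And>m. 1 \<le> m \<Longrightarrow> wfunctional p1 (\<lambda>t. v1 t + 1 / of_nat m) ?J (fn n) \<le> ennreal (\<alpha> m)"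
      "\<alpha> \<longlonglongrightarrow> enn2real ?Nf" "\<And>m. 0 \<le> \<alpha> m"
      using norm_regularised[OF J p(1) v1 _ _ _ f fN, of "fn n" "Suc n"] by (auto simp: fn_def[abs_def])
    obtain \<beta> where \<beta>: "\<And>m. 1 \<le> m \<Longrightarrow> wfunctional p2 (\<lambda>t. v2 t + 1 / of_nat m) ?J (gn n) \<le> ennreal (\<beta> m)"
      "\<beta> \<longlonglongrightarrow> enn2real ?Ng" "\<And>m. 0 \<le> \<beta> m"
      using norm_regularised[OF J p(2) v2 _ _ _ g gN, of "gn n" "Suc n"] by (auto simp: gn_def[abs_def])
    \<comment> \<open>Truncating u at n + 1 \<le> m only lowers it below the regularised
    weight.\<close>
    have le: "wfunctional (ennreal q) (?w n) ?J (bihardy ?J (fn n) (gn n)) \<le> ennreal (k * \<alpha> m * \<beta> m)" if m: "Suc n \<le> m" for m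
    proof -
      have m1: "1 \<le> m" using m by simp
      let ?um = "\<lambda>t. min (u t) (of_nat m)" and ?v1 = "\<lambda>t. v1 t + 1 / of_nat m" and ?v2 = "\<lambda>t. v2 t + 1 / of_nat m"
      let ?A = "local_char q p1 p2 ?um ?v1 ?v2 (l n) (r n)"
      have AD: "?A \<le> ?D" using reg_char_le_dir_char[OF J m1] by (simp add: reg_char_eq_local_char)
      then have "?A < top" using fin by (rule le_less_trans)
      then have "admissible q p1 p2 ?J ?um ?v1 ?v2 (ennreal K * ?A)"
        using loc[OF local_problem[OF J m1]] unfolding two_sided_def by blast
      then have adm: "admissible q p1 p2 ?J ?um ?v1 ?v2 (ennreal K * ?D)"
        by (rule admissible_mono) (rule mult_left_mono[OF AD], simp)
      have "wfunctional (ennreal q) (?w n) ?J (bihardy ?J (fn n) (gn n)) \<le> wfunctional (ennreal q) ?um ?J (bihardy ?J (fn n) (gn n))"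
      proof -
        have "?w n t \<le> ?um t" for t using m by (intro min.mono of_nat_mono) auto
        then show ?thesis
          unfolding wfunctional_def using q
          by (auto intro!: epowr_mono nn_integral_mono mult_right_mono mult_left_mono simp del: of_nat_Suc)
      qed
      also have "\<dots> \<le> ennreal K * ?D * wfunctional p1 ?v1 ?J (fn n) * wfunctional p2 ?v2 ?J (gn n)"
        using \<alpha>(1)[OF m1] \<beta>(1)[OF m1] J(2)
        by (intro admissibleD[OF adm] measurable_sub) (auto intro: le_less_trans)
      also have "\<dots> \<le> ennreal k * ennreal (\<alpha> m) * ennreal (\<beta> m)"
        unfolding k(1) by (intro mult_mono mult_left_mono \<alpha>(1) \<beta>(1) m1) auto
      also have "\<dots> = ennreal (k * \<alpha> m * \<beta> m)" using k(2) \<alpha>(3) \<beta>(3) by (simp add: ennreal_mult)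
      finally show ?thesis .
    qed
    have "(\<lambda>m. ennreal (k * \<alpha> m * \<beta> m)) \<longlonglongrightarrow> ennreal (k * enn2real ?Nf * enn2real ?Ng)"
      by (intro tendsto_ennrealI tendsto_mult tendsto_const \<alpha>(2) \<beta>(2))
    moreover have "\<forall>\<^sub>F m in sequentially. wfunctional (ennreal q) (?w n) ?J (bihardy ?J (fn n) (gn n)) \<le> ennreal (k * \<alpha> m * \<beta> m)"
      using le by (auto simp: eventually_sequentially)
    ultimately have "wfunctional (ennreal q) (?w n) ?J (bihardy ?J (fn n) (gn n)) \<le> ennreal (k * enn2real ?Nf * enn2real ?Ng)"
      by (rule tendsto_lowerbound) simp
    also have "\<dots> = ennreal k * ennreal (enn2real ?Nf) * ennreal (enn2real ?Ng)" using k(2) by (simp add: ennreal_mult)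
    also have "\<dots> = ennreal K * ?D * ?Nf * ?Ng" using fN gN by (simp add: k less_top)
    finally show ?thesis .
  qed
  let ?h = "\<lambda>n t. (hardy {l n..r n} (fn n) t * hardy {l n..r n} (gn n) t) epowr q * ?w n t * indicator {l n..r n} t"
  let ?Hf = "\<lambda>t n. hardy {l n..r n} (fn n) t" and ?Hg = "\<lambda>t n. hardy {l n..r n} (gn n) t"
  have Hf1: "hardy I f t = (SUP n. ?Hf t n)" for t
    unfolding fn_def[abs_def] by (rule hardy_SUP(1)[OF lr(2,3) cover f])
  have Hf2: "incseq (?Hf t)" for t
    unfolding fn_def[abs_def] by (rule hardy_SUP(2)[OF lr(2,3) cover f])
  have Hg1: "hardy I g t = (SUP n. ?Hg t n)" for t
    unfolding gn_def[abs_def] by (rule hardy_SUP(1)[OF lr(2,3) cover g])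
  have Hg2: "incseq (?Hg t)" for t
    unfolding gn_def[abs_def] by (rule hardy_SUP(2)[OF lr(2,3) cover g])
  have incP: "incseq (\<lambda>n. (?Hf t n * ?Hg t n) epowr q)" for t
  proof (rule monoI)
    fix m n :: nat assume mn: "m \<le> n"
    show "(?Hf t m * ?Hg t m) epowr q \<le> (?Hf t n * ?Hg t n) epowr q"
      by (rule epowr_mono[OF mult_mono[OF incseqD[OF Hf2 mn] incseqD[OF Hg2 mn]] q]) simp_all
  qed
  have ind: "incseq (\<lambda>n. indicator {l n..r n} t :: ennreal)" for t
  proof (rule monoI)
    fix m n :: nat assume "m \<le> n"
    from lr(3)[OF this] show "indicator {l m..r m} t \<le> (indicator {l n..r n} t :: ennreal)"
      by (auto simp: indicator_def)
  qed
  have inc2: "incseq (\<lambda>n. (?Hf t n * ?Hg t n) epowr q * ?w n t)" for t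
  proof (rule monoI)
    fix m n :: nat assume mn: "m \<le> n"
    show "(?Hf t m * ?Hg t m) epowr q * ?w m t \<le> (?Hf t n * ?Hg t n) epowr q * ?w n t"
      by (rule mult_mono[OF incseqD[OF incP mn] incseqD[OF incseq_min_of_nat mn]]) simp_all
  qed
  have inc: "incseq ?h"
  proof (intro monoI le_funI)
    fix m n :: nat and t assume mn: "m \<le> n"
    show "?h m t \<le> ?h n t"
      by (rule mult_mono[OF incseqD[OF inc2 mn] incseqD[OF ind mn]]) simp_all
  qed
  have meas: "?h n \<in> borel_measurable (lebesgue_on I)" for n
  proof -
    have [measurable]: "(\<lambda>t. indicator {l n..r n} t :: ennreal) \<in> borel_measurable (lebesgue_on I)"
      "hardy {l n..r n} h \<in> borel_measurable (lebesgue_on I)" for h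
      by (intro borel_measurable_lebesgue_onI borel_measurable_indicator hardy_measurable; simp)+
    show ?thesis by measurable
  qed
  have "(\<integral>\<^sup>+t. bihardy I f g t epowr q * u t \<partial>lebesgue_on I) \<le> (\<integral>\<^sup>+t. (SUP n. ?h n t) \<partial>lebesgue_on I)"
  proof (rule nn_integral_mono_AE, rule AE_mp[OF cover], rule AE_I2, rule impI)
    fix t assume "\<exists>n. t \<in> {l n..r n}"
    then obtain n where n: "t \<in> {l n..r n}" by blast
    have "(1::ennreal) = indicator {l n..r n} t" using n by simp
    also have "\<dots> \<le> (SUP n. indicator {l n..r n} t)" by (rule SUP_upper) simp
    finally have one: "1 \<le> (SUP n. indicator {l n..r n} t :: ennreal)" .
    let ?S = "SUP n. (?Hf t n * ?Hg t n) epowr q * ?w n t"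
    have "bihardy I f g t epowr q = (SUP n. ?Hf t n * ?Hg t n) epowr q"
      unfolding bihardy_def Hf1 Hg1 by (simp only: SUP_mult_incseq[OF Hf2 Hg2])
    also have "\<dots> = (SUP n. (?Hf t n * ?Hg t n) epowr q)" by (rule epowr_SUP[OF q]) simp
    finally have "bihardy I f g t epowr q * u t = (SUP n. (?Hf t n * ?Hg t n) epowr q) * (SUP n. ?w n t)"
      unfolding min_of_nat_SUP by (rule arg_cong)
    also have "\<dots> = ?S" by (rule SUP_mult_incseq[OF incP incseq_min_of_nat])
    finally have eq: "bihardy I f g t epowr q * u t = ?S" .
    have "?S * 1 \<le> ?S * (SUP n. indicator {l n..r n} t)" using one by (rule mult_left_mono) simp
    also have "?S * (SUP n. indicator {l n..r n} t) = (SUP n. ?h n t)" by (rule SUP_mult_incseq[OF inc2 ind])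
    finally show "bihardy I f g t epowr q * u t \<le> (SUP n. ?h n t)" unfolding eq mult_1_right .
  qed
  also have "\<dots> = (SUP n. \<integral>\<^sup>+t. ?h n t \<partial>lebesgue_on I)"
    by (rule nn_integral_monotone_convergence_SUP[OF inc meas])
  also have "\<dots> \<le> (ennreal K * ?D * ?Nf * ?Ng) epowr q"
  proof (rule SUP_least)
    fix n
    have "(\<integral>\<^sup>+t. ?h n t \<partial>lebesgue_on I) = (\<integral>\<^sup>+t. bihardy {l n..r n} (fn n) (gn n) t epowr q * ?w n t * indicator {l n..r n} t \<partial>lebesgue)"
      unfolding nn_integral_lebesgue_on[OF I_sets] bihardy_def using lr(2)[of n]
      by (intro nn_integral_cong) (auto simp: indicator_def)
    also have "\<dots> = wfunctional (ennreal q) (?w n) {l n..r n} (bihardy {l n..r n} (fn n) (gn n)) epowr q"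
      using q by (simp add: wfunctional_def del: of_nat_Suc)
    also have "\<dots> \<le> (ennreal K * ?D * ?Nf * ?Ng) epowr q" by (rule epowr_mono[OF piece q])
    finally show "(\<integral>\<^sup>+t. ?h n t \<partial>lebesgue_on I) \<le> (ennreal K * ?D * ?Nf * ?Ng) epowr q" .
  qed
  finally have "(\<integral>\<^sup>+t. bihardy I f g t epowr q * u t \<partial>lebesgue_on I) \<le> (ennreal K * ?D * ?Nf * ?Ng) epowr q" .
  then show "wfunctional (ennreal q) u I (bihardy I f g) \<le> ennreal K * ?D * ?Nf * ?Ng"
    using q wfunctional_eq[OF I_sets, of "ennreal q" u "bihardy I f g"] by (simp add: epowr_le_iff')
qed

lemma hardy_const_eq: "hardy_const q p1 p2 I u v1 v2 = Inf {C. C < top \<and> admissible q p1 p2 I u v1 v2 C}"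
  unfolding hardy_const_def admissible_def ..

text \<open>
  The lower bound tests every admissible constant on all compact intervals; in the upper bound
  an infinite characteristic leaves nothing to prove.
\<close>

lemma hardy_const_bounds:
  assumes K: "1 \<le> K"
    and loc: "\<And>v1 v2 c d \<delta> u. local_problem v1 v2 c d \<delta> u \<Longrightarrow> two_sided q p1 p2 c d u v1 v2 (local_char q p1 p2 u v1 v2 c d) K"
  shows "ennreal (1 / K) * dir_char q p1 p2 I u v1 v2 \<le> hardy_const q p1 p2 I u v1 v2"
    and "hardy_const q p1 p2 I u v1 v2 \<le> ennreal K * dir_char q p1 p2 I u v1 v2"
proof -
  let ?D = "dir_char q p1 p2 I u v1 v2"
  show "ennreal (1 / K) * ?D \<le> hardy_const q p1 p2 I u v1 v2"
    unfolding hardy_const_eq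
  proof (rule Inf_greatest)
    fix C assume "C \<in> {C. C < top \<and> admissible q p1 p2 I u v1 v2 C}"
    then have C: "C < top" "admissible q p1 p2 I u v1 v2 C" by auto
    have "?D \<le> ennreal K * C"
      unfolding dir_char_def
    proof (intro SUP_least, clarify, intro SUP_least)
      fix c d :: real and m :: nat assume J: "c < d" "{c..d} \<subseteq> I" and "m \<in> {1..}"
      then have m: "1 \<le> m" by simp
      have "admissible q p1 p2 {c..d} (\<lambda>t. min (u t) (of_nat m)) (\<lambda>t. v1 t + 1 / of_nat m) (\<lambda>t. v2 t + 1 / of_nat m) C"
        by (rule admissible_restrict[OF J C(2)]) auto
      then show "reg_char q p1 p2 u v1 v2 c d m \<le> ennreal K * C"
        using loc[OF local_problem[OF J m]] C(1) unfolding two_sided_def reg_char_eq_local_char by blast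
    qed
    then have "ennreal (1 / K) * ?D \<le> ennreal (1 / K) * (ennreal K * C)" by (rule mult_left_mono) simp
    also have "\<dots> = C" using K by (simp add: mult.assoc[symmetric] flip: ennreal_mult)
    finally show "ennreal (1 / K) * ?D \<le> C" .
  qed
  show "hardy_const q p1 p2 I u v1 v2 \<le> ennreal K * ?D"
  proof (cases "?D < top")
    case True
    then have "ennreal K * ?D < top" by (simp add: ennreal_mult_less_top)
    then show ?thesis
      unfolding hardy_const_eq using admissible_of_dir_char[OF K loc True] by (intro Inf_lower) auto
  next
    case False
    then have "?D = top" using less_top by blast
    then show ?thesis using K by (simp add: ennreal_mult_top)
  qed
qed

end

theorem theorem7p2:
  fixes q :: real and p1 p2 :: ennreal
  assumes "0 < q" and "1 \<le> p1" and "1 \<le> p2"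
  shows "(\<exists>k K :: real. 0 < k \<and> k \<le> K \<and>
            (\<forall>(I :: real set) (u :: real \<Rightarrow> ennreal) v1 v2.
               is_interval I \<longrightarrow> interior I \<noteq> {} \<longrightarrow>
               u \<in> borel_measurable (lebesgue_on I) \<longrightarrow>
               v1 \<in> borel_measurable (lebesgue_on I) \<longrightarrow>
               v2 \<in> borel_measurable (lebesgue_on I) \<longrightarrow>
               ennreal k * dir_char q p1 p2 I u v1 v2 \<le> hardy_const q p1 p2 I u v1 v2 \<and>
               hardy_const q p1 p2 I u v1 v2 \<le> ennreal K * dir_char q p1 p2 I u v1 v2))
       \<and> (p1 = top \<and> p2 = top \<longrightarrow>
            (\<forall>(I :: real set) (u :: real \<Rightarrow> ennreal) v1 v2.
               is_interval I \<longrightarrow> interior I \<noteq> {} \<longrightarrow>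
               u \<in> borel_measurable (lebesgue_on I) \<longrightarrow>
               v1 \<in> borel_measurable (lebesgue_on I) \<longrightarrow>
               v2 \<in> borel_measurable (lebesgue_on I) \<longrightarrow>
               hardy_const q p1 p2 I u v1 v2 = dir_char q p1 p2 I u v1 v2))"
proof -
  obtain K where K: "1 \<le> K" "p1 = top \<and> p2 = top \<longrightarrow> K = 1"
    and loc: "\<And>v1 v2 c d \<delta> u. local_problem v1 v2 c d \<delta> u \<Longrightarrow>
      two_sided q p1 p2 c d u v1 v2 (local_char q p1 p2 u v1 v2 c d) K"
    using local_two_sided[OF assms] by blast
  have bounds: "ennreal (1 / K) * dir_char q p1 p2 I u v1 v2 \<le> hardy_const q p1 p2 I u v1 v2 \<and>
      hardy_const q p1 p2 I u v1 v2 \<le> ennreal K * dir_char q p1 p2 I u v1 v2"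
    if "is_interval I" "interior I \<noteq> {}" "u \<in> borel_measurable (lebesgue_on I)"
      "v1 \<in> borel_measurable (lebesgue_on I)" "v2 \<in> borel_measurable (lebesgue_on I)" for I u v1 v2
  proof -
    interpret global_problem I u v1 v2 q p1 p2
      using that assms by unfold_locales
    show ?thesis by (intro conjI hardy_const_bounds[OF K(1)]) (erule loc)+
  qed
  show ?thesis
  proof (intro conjI impI)
    show "\<exists>k K :: real. 0 < k \<and> k \<le> K \<and>
            (\<forall>(I :: real set) (u :: real \<Rightarrow> ennreal) v1 v2.
               is_interval I \<longrightarrow> interior I \<noteq> {} \<longrightarrow>
               u \<in> borel_measurable (lebesgue_on I) \<longrightarrow>
               v1 \<in> borel_measurable (lebesgue_on I) \<longrightarrow>
               v2 \<in> borel_measurable (lebesgue_on I) \<longrightarrow>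
               ennreal k * dir_char q p1 p2 I u v1 v2 \<le> hardy_const q p1 p2 I u v1 v2 \<and>
               hardy_const q p1 p2 I u v1 v2 \<le> ennreal K * dir_char q p1 p2 I u v1 v2)"
    proof (intro exI conjI)
      show "0 < 1 / K" using K(1) by simp
      have "1 / K \<le> 1" using K(1) by simp
      then show "1 / K \<le> K" using K(1) by linarith
    qed (intro allI impI bounds)
  next
    assume "p1 = top \<and> p2 = top"
    then have K1: "K = 1" using K(2) by blast
    show "\<forall>(I :: real set) (u :: real \<Rightarrow> ennreal) v1 v2.
               is_interval I \<longrightarrow> interior I \<noteq> {} \<longrightarrow>
               u \<in> borel_measurable (lebesgue_on I) \<longrightarrow>
               v1 \<in> borel_measurable (lebesgue_on I) \<longrightarrow>
               v2 \<in> borel_measurable (lebesgue_on I) \<longrightarrow>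
               hardy_const q p1 p2 I u v1 v2 = dir_char q p1 p2 I u v1 v2"
    proof (intro allI impI)
      fix I :: "real set" and u v1 v2 :: "real \<Rightarrow> ennreal"
      assume "is_interval I" "interior I \<noteq> {}" "u \<in> borel_measurable (lebesgue_on I)"
        "v1 \<in> borel_measurable (lebesgue_on I)" "v2 \<in> borel_measurable (lebesgue_on I)"
      from bounds[OF this] show "hardy_const q p1 p2 I u v1 v2 = dir_char q p1 p2 I u v1 v2"
        by (intro antisym) (simp_all add: K1)
    qed
  qed
qed

end
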